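(* Let $S$ be a para-Hurwitz superalgebra over a field $k$ of characteristic $\neq 2$ and let $J=H_3(C,* )$ be the Jordan superalgebra of $3\times 3$ hermitian matrices over the associated Hurwitz superalgebra $C$ (so $S=\bar C$). Then the linear map $$\Phi:\mathfrak g(S_1,S)\longrightarrow\mathfrak{der}\,J$$ such that $$\Phi\bigl((d_0,d_1,d_2)\bigr)=D_{(d_0,d_1,d_2)},\qquad \Phi\bigl(\iota_i(1\otimes a)\bigr)=D_i(a),$$ for any $i=0,1,2$, $a\in S$ and $(d_0,d_1,d_2)\in\mathfrak{tri}(S)$, is an isomorphism of Lie superalgebras.
   Context: All vector spaces are over $k$; $|x|\in\{0,1\}$ is the parity of a homogeneous element $x$; indices $i=0,1,2$ are modulo $3$; $[\cdot,\cdot]$ of operators is the supercommutator. Composition superalgebras. A quadratic superform on $U=U_{\bar 0}\oplus U_{\bar 1}$ is a pair $q=(q_{\bar 0},\mathrm b)$ with $q_{\bar 0}$ a quadratic form on $U_{\bar 0}$ and $\mathrm b$ an even supersymmetric bilinear form on $U$ whose restriction to $U_{\bar 0}$ is the polar form of $q_{\bar 0}$; it is regular if $q_{\bar 0}$ is regular and $\mathrm b|_{U_{\bar 1}}$ is nondegenerate. A superalgebra $C$ with a regular quadratic superform is a composition superalgebra if $q_{\bar 0}(x_0y_0)=q_{\bar 0}(x_0)q_{\bar 0}(y_0)$, $\mathrm b(x_0y,x_0z)=q_{\bar 0}(x_0)\mathrm b(y,z)=\mathrm b(yx_0,zx_0)$ and $\mathrm b(xy,zt)+(-1)^{|x||y|+|x||z|+|y||z|}\mathrm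 b(zy,xt)=(-1)^{|y||z|}\mathrm b(x,z)\mathrm b(y,t)$ for $x_0,y_0\in C_{\bar 0}$ and homogeneous $x,y,z,t\in C$. Unital ones are called Hurwitz superalgebras; their standard involution is $\bar x=\mathrm b(x,1)1-x$. The para-Hurwitz superalgebra attached to a Hurwitz superalgebra $C$ is $\bar C$: the same superspace and norm with product $x\bullet y=\bar x\bar y$. $S_1=\bar k=k1$, with $1\bullet1=1$, $\mathrm b(1,1)=2$; one has $\mathfrak{tri}(S_1)=0$. Triality and $\mathfrak g(S,S')$. For a para-Hurwitz superalgebra $S$, $\mathfrak{tri}(S)$ is the Lie superalgebra (componentwise bracket) spanned by the homogeneous triples $(d_0,d_1,d_2)\in\mathfrak{osp}(S,q)^3$ of a common parity with $d_0(x\bullet y)=d_1(x)\bullet y+(-1)^{|d_0||x|}x\bullet d_2(y)$. Put $l_x(y)=x\bullet y$, $r_x(y)=(-1)^{|x||y|}y\bullet x$, $\sigma_{x,y}(z)=(-1)^{|y||z|}\mathrm b(x,z)y-(-1)^{|x|(|y|+|z|)}\mathrm b(y,z)x$, $t_{x,y}=(\sigma_{x,y},\tfrac12\mathrm b(x,y)1-r_xl_y,\tfrac12\mathrm b(x,y)1-l_xr_y)\in\mathfrak{tri}(S)$, $\theta(d_0,d_1,d_2)=(d_2,d_0,d_1)$. For para-Hurwitz superalgebras $S,S'$ (primes denote the objects for $S'$), $\mathfrak g(S,S')=(\mathfrak{tri}(S)\oplus\mathfrak{tri}(S'))\oplus(\oplus_{i=0}^2\iota_i(S\otimes S'))$,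 with $\iota_i(S\otimes S')$ a copy of $S\otimes S'$, is the Lie superalgebra in which $\mathfrak{tri}(S)\oplus\mathfrak{tri}(S')$ is a subsuperalgebra (direct sum of ideals) and $[(d_0,d_1,d_2),\iota_i(x\otimes x')]=\iota_i(d_i(x)\otimes x')$; $[(d_0',d_1',d_2'),\iota_i(x\otimes x')]=(-1)^{|d_i'||x|}\iota_i(x\otimes d_i'(x'))$; $[\iota_i(x\otimes x'),\iota_{i+1}(y\otimes y')]=(-1)^{|x'||y|}\iota_{i+2}((x\bullet y)\otimes(x'\bullet y'))$; $[\iota_i(x\otimes x'),\iota_i(y\otimes y')]=(-1)^{|x||x'|+|x||y'|+|y||y'|}\mathrm b'(x',y')\theta^i(t_{x,y})+(-1)^{|y||x'|}\mathrm b(x,y)\theta'^i(t'_{x',y'})$. In particular $\mathfrak g(S_1,S)=\mathfrak{tri}(S)\oplus(\oplus_{i=0}^2\iota_i(1\otimes S))$. The Jordan superalgebra. $J=H_3(C,* )$ consists of the $3\times3$ matrices over $C$ fixed by $(a_{ij})^*=(\bar a_{ji})$, with product $x\circ y=\frac12(xy+(-1)^{|x||y|}yx)$. $e_0,e_1,e_2$ are the diagonal matrix units (in positions $(1,1),(2,2),(3,3)$), and for $a\in S=\bar C$ (same space as $C$): $\iota_0(a)=2(\bar aE_{23}+aE_{32})$, $\iota_1(a)=2(aE_{13}+\bar aE_{31})$, $\iota_2(a)=2(\bar aE_{12}+aE_{21})$, so $J=(\oplus_i ke_i)\oplus(\oplus_i\iota_i(S))$. The product is determined by: the $e_i$ are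 orthogonal idempotents; $(\sum_j\alpha_je_j)\circ\iota_i(a)=\frac12(\alpha_{i+1}+\alpha_{i+2})\iota_i(a)$; $\iota_i(a)\circ\iota_{i+1}(b)=\iota_{i+2}(a\bullet b)$; $\iota_i(a)\circ\iota_i(b)=2\mathrm b(a,b)(e_{i+1}+e_{i+2})$; and supercommutativity. $\mathfrak{der}\,J$ is the Lie superalgebra of (super)derivations of $J$ and $L_x$ is multiplication by $x$. $D_{(d_0,d_1,d_2)}$ is defined, for $(d_0,d_1,d_2)\in\mathfrak{tri}(S)$, by $D_{(d_0,d_1,d_2)}(e_i)=0$, $D_{(d_0,d_1,d_2)}(\iota_i(a))=\iota_i(d_i(a))$; and $D_i(a)=2[L_{\iota_i(a)},L_{e_{i+1}}]$ for $a\in S$. *)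

theory Defs
  imports
    Complex_Main
    "HOL-Library.Z2"
    "HOL-Library.Numeral_Type"
    "HOL-Library.Function_Algebras"
    "HOL-Library.Product_Plus"
begin

section \<open>Superspaces and superalgebras\<close>

text \<open>
  Parities are elements of the field \<^typ>\<open>bit\<close> with two elements, so that the exponent of a sign
  can be computed there. The indices \<open>i = 0, 1, 2\<close> modulo \<open>3\<close> are elements of the type \<open>3\<close>.
  A superspace is given by its two homogeneous pieces \<open>gr A 0\<close> and \<open>gr A 1\<close> inside an ambient vector
  space; its underlying space is their sum \<open>scarrier A\<close>.
\<close>

record ('k, 'v) salg =
  scl :: "'k \<Rightarrow> 'v \<Rightarrow> 'v"
  gr :: "bit \<Rightarrow> 'v set"
  mul :: "'v \<Rightarrow> 'v \<Rightarrow> 'v"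

record ('k, 'v) qsalg = "('k, 'v) salg" +
  qf :: "'v \<Rightarrow> 'k"
  bf :: "'v \<Rightarrow> 'v \<Rightarrow> 'k"

record ('k, 'v) unital_qsalg = "('k, 'v) qsalg" +
  uone :: 'v

definition sg :: "bit \<Rightarrow> 'k::field" where
  "sg p = (if p = 0 then 1 else - 1)"

definition gsum :: "(bit \<Rightarrow> 'v::ab_group_add set) \<Rightarrow> 'v set" where
  "gsum V = {x + y | x y. x \<in> V 0 \<and> y \<in> V 1}"

definition scarrier :: "('k, 'v::ab_group_add, 'z) salg_scheme \<Rightarrow> 'v set" where
  "scarrier A = gsum (gr A)"

text \<open>The homogeneous component of parity \<open>p\<close>; used for elements of \<open>gsum V\<close> only.\<close>

definition hpart :: "(bit \<Rightarrow> 'v::ab_group_add set) \<Rightarrow> bit \<Rightarrow> 'v \<Rightarrow> 'v" where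
  "hpart V p x = (THE y. y \<in> V p \<and> x - y \<in> V (p + 1))"

definition superspace :: "('k::field, 'v::ab_group_add, 'z) salg_scheme \<Rightarrow> bool" where
  "superspace A \<longleftrightarrow> vector_space (scl A)
     \<and> (\<forall>p. module.subspace (scl A) (gr A p)) \<and> gr A 0 \<inter> gr A 1 = {0}"

definition linear_on ::
    "('k \<Rightarrow> 'v \<Rightarrow> 'v) \<Rightarrow> ('k \<Rightarrow> 'w \<Rightarrow> 'w) \<Rightarrow> 'v set \<Rightarrow> ('v::ab_group_add \<Rightarrow> 'w::ab_group_add) \<Rightarrow> bool" where
  "linear_on s1 s2 U f \<longleftrightarrow> (\<forall>x\<in>U. \<forall>y\<in>U. f (x + y) = f x + f y) \<and> (\<forall>c. \<forall>x\<in>U. f (s1 c x) = s2 c (f x))"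

definition bilinear_on :: "('k \<Rightarrow> 'v \<Rightarrow> 'v) \<Rightarrow> ('k \<Rightarrow> 'w \<Rightarrow> 'w) \<Rightarrow> ('k \<Rightarrow> 'u \<Rightarrow> 'u) \<Rightarrow> 'v set \<Rightarrow> 'w set \<Rightarrow>
    ('v::ab_group_add \<Rightarrow> 'w::ab_group_add \<Rightarrow> 'u::ab_group_add) \<Rightarrow> bool" where
  "bilinear_on s1 s2 s3 U W f \<longleftrightarrow>
     (\<forall>x\<in>U. linear_on s2 s3 W (f x)) \<and> (\<forall>y\<in>W. linear_on s1 s3 U (\<lambda>x. f x y))"

definition superalgebra :: "('k::field, 'v::ab_group_add, 'z) salg_scheme \<Rightarrow> bool" where
  "superalgebra A \<longleftrightarrow> superspace A
     \<and> bilinear_on (scl A) (scl A) (scl A) (scarrier A) (scarrier A) (mul A)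
     \<and> (\<forall>p q. \<forall>x\<in>gr A p. \<forall>y\<in>gr A q. mul A x y \<in> gr A (p + q))"

text \<open>
  The last two conditions follow from the others when the characteristic is different from \<open>2\<close> and
  from \<open>3\<close>, respectively.
\<close>

definition lie_superalgebra :: "('k::field, 'v::ab_group_add, 'z) salg_scheme \<Rightarrow> bool" where
  "lie_superalgebra L \<longleftrightarrow> superalgebra L
     \<and> (\<forall>p q. \<forall>x\<in>gr L p. \<forall>y\<in>gr L q. mul L x y = - scl L (sg (p * q)) (mul L y x))
     \<and> (\<forall>p q r. \<forall>x\<in>gr L p. \<forall>y\<in>gr L q. \<forall>z\<in>gr L r.
          mul L x (mul L y z) = mul L (mul L x y) z + scl L (sg (p * q)) (mul L y (mul L x z)))
     \<and> (\<forall>x\<in>gr L 0. mul L x x = 0)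
     \<and> (\<forall>x\<in>gr L 1. mul L x (mul L x x) = 0)"

definition lie_superalgebra_iso ::
    "('k::field, 'v::ab_group_add, 'y) salg_scheme \<Rightarrow> ('k, 'w::ab_group_add, 'z) salg_scheme \<Rightarrow> ('v \<Rightarrow> 'w) \<Rightarrow> bool" where
  "lie_superalgebra_iso L M f \<longleftrightarrow> lie_superalgebra L \<and> lie_superalgebra M
     \<and> linear_on (scl L) (scl M) (scarrier L) f
     \<and> bij_betw f (scarrier L) (scarrier M)
     \<and> (\<forall>p. f ` gr L p \<subseteq> gr M p)
     \<and> (\<forall>x\<in>scarrier L. \<forall>y\<in>scarrier L. f (mul L x y) = mul M (f x) (f y))"


section \<open>Operators\<close>

definition fscl :: "('k \<Rightarrow> 'v \<Rightarrow> 'v) \<Rightarrow> 'k \<Rightarrow> ('a \<Rightarrow> 'v) \<Rightarrow> 'a \<Rightarrow> 'v" where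
  "fscl s c f = (\<lambda>x. s c (f x))"

text \<open>
  The endomorphisms of a superspace, by parity. An endomorphism of a proper subspace of the ambient
  type is represented by the function that vanishes off that subspace.
\<close>

definition Endo :: "('k, 'v::ab_group_add, 'z) salg_scheme \<Rightarrow> bit \<Rightarrow> ('v \<Rightarrow> 'v) set" where
  "Endo A p = {f. linear_on (scl A) (scl A) (scarrier A) f \<and> (\<forall>x. x \<notin> scarrier A \<longrightarrow> f x = 0)
                \<and> (\<forall>q. \<forall>x\<in>gr A q. f x \<in> gr A (p + q))}"

definition scomm :: "('k::field, 'v::ab_group_add, 'z) salg_scheme \<Rightarrow> ('v \<Rightarrow> 'v) \<Rightarrow> ('v \<Rightarrow> 'v) \<Rightarrow> 'v \<Rightarrow> 'v" where
  "scomm A f g = (\<Sum>p\<in>{0, 1}. \<Sum>q\<in>{0, 1}.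
     (hpart (Endo A) p f \<circ> hpart (Endo A) q g)
       - fscl (scl A) (sg (p * q)) (hpart (Endo A) q g \<circ> hpart (Endo A) p f))"

definition der :: "('k::field, 'v::ab_group_add, 'z) salg_scheme \<Rightarrow> ('k, 'v \<Rightarrow> 'v) salg" where
  "der A = \<lparr> scl = fscl (scl A),
             gr = (\<lambda>p. {d \<in> Endo A p. \<forall>q. \<forall>x\<in>gr A q. \<forall>y\<in>scarrier A.
                     d (mul A x y) = mul A (d x) y + scl A (sg (p * q)) (mul A x (d y))}),
             mul = scomm A \<rparr>"

definition Lmul :: "('k, 'v::ab_group_add, 'z) salg_scheme \<Rightarrow> 'v \<Rightarrow> 'v \<Rightarrow> 'v" where
  "Lmul A x = (\<lambda>y. if y \<in> scarrier A then mul A x y else 0)"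


section \<open>Composition, Hurwitz and para-Hurwitz superalgebras\<close>

definition quadratic_superform :: "('k::field, 'v::ab_group_add, 'z) qsalg_scheme \<Rightarrow> bool" where
  "quadratic_superform A \<longleftrightarrow>
     bilinear_on (scl A) (scl A) (*) (scarrier A) (scarrier A) (bf A)
     \<and> (\<forall>p q. \<forall>x\<in>gr A p. \<forall>y\<in>gr A q. p \<noteq> q \<longrightarrow> bf A x y = 0)
     \<and> (\<forall>p q. \<forall>x\<in>gr A p. \<forall>y\<in>gr A q. bf A x y = sg (p * q) * bf A y x)
     \<and> (\<forall>c. \<forall>x\<in>gr A 0. qf A (scl A c x) = c\<^sup>2 * qf A x)
     \<and> (\<forall>x\<in>gr A 0. \<forall>y\<in>gr A 0. bf A x y = qf A (x + y) - qf A x - qf A y)"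

text \<open>
  Only characteristic different from \<open>2\<close> is of interest here, and there a quadratic form is regular
  if and only if its polar form is nondegenerate.
\<close>

definition regular_superform :: "('k::field, 'v::ab_group_add, 'z) qsalg_scheme \<Rightarrow> bool" where
  "regular_superform A \<longleftrightarrow> (\<forall>p. \<forall>x\<in>gr A p. (\<forall>y\<in>gr A p. bf A x y = 0) \<longrightarrow> x = 0)"

definition composition_superalgebra :: "('k::field, 'v::ab_group_add, 'z) qsalg_scheme \<Rightarrow> bool" where
  "composition_superalgebra A \<longleftrightarrow> superalgebra A \<and> quadratic_superform A \<and> regular_superform A
     \<and> (\<forall>x\<in>gr A 0. \<forall>y\<in>gr A 0. qf A (mul A x y) = qf A x * qf A y)
     \<and> (\<forall>x\<in>gr A 0. \<forall>y\<in>scarrier A. \<forall>z\<in>scarrier A.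
          bf A (mul A x y) (mul A x z) = qf A x * bf A y z
          \<and> bf A (mul A y x) (mul A z x) = qf A x * bf A y z)
     \<and> (\<forall>px py pz pt. \<forall>x\<in>gr A px. \<forall>y\<in>gr A py. \<forall>z\<in>gr A pz. \<forall>t\<in>gr A pt.
          bf A (mul A x y) (mul A z t)
            + sg (px * py + px * pz + py * pz) * bf A (mul A z y) (mul A x t)
          = sg (py * pz) * bf A x z * bf A y t)"

definition hurwitz_superalgebra :: "('k::field, 'v::ab_group_add, 'z) unital_qsalg_scheme \<Rightarrow> bool" where
  "hurwitz_superalgebra C \<longleftrightarrow> composition_superalgebra C
     \<and> uone C \<in> scarrier C \<and> (\<forall>x\<in>scarrier C. mul C (uone C) x = x \<and> mul C x (uone C) = x)"

definition hconj :: "('k, 'v::ab_group_add, 'z) unital_qsalg_scheme \<Rightarrow> 'v \<Rightarrow> 'v" where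
  "hconj C x = scl C (bf C x (uone C)) (uone C) - x"

definition para :: "('k, 'v::ab_group_add, 'z) unital_qsalg_scheme \<Rightarrow> ('k, 'v) qsalg" where
  "para C = \<lparr> scl = scl C, gr = gr C, mul = (\<lambda>x y. mul C (hconj C x) (hconj C y)), qf = qf C, bf = bf C \<rparr>"

text \<open>The field as a Hurwitz superalgebra, with norm \<open>x\<^sup>2\<close>, and \<open>S\<^sub>1\<close>.\<close>

definition field_alg :: "('k::field, 'k) unital_qsalg" where
  "field_alg = \<lparr> scl = (*), gr = (\<lambda>p. if p = 0 then UNIV else {0}), mul = (*),
                 qf = (\<lambda>x. x\<^sup>2), bf = (\<lambda>x y. 2 * x * y), uone = 1 \<rparr>"

definition S1 :: "('k::field, 'k) qsalg" where
  "S1 = para field_alg"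


section \<open>Triality\<close>

text \<open>
  From here on, the underlying space of a para-Hurwitz superalgebra \<open>S\<close> is supposed to be its whole
  type. A triple of operators is a function on the type \<open>3\<close>. Formulas containing signs are
  extended to arbitrary elements by summing over their homogeneous components.

  The part \<open>osp S p\<close> of parity \<open>p\<close> consists of the operators that are skew for the bilinear form, which
  in characteristic different from \<open>2\<close> determines the quadratic form.
\<close>

definition osp :: "('k::field, 'v::ab_group_add, 'z) qsalg_scheme \<Rightarrow> bit \<Rightarrow> ('v \<Rightarrow> 'v) set" where
  "osp S p = {d \<in> Endo S p. \<forall>q. \<forall>x\<in>gr S q. \<forall>y\<in>scarrier S.
                bf S (d x) y + sg (p * q) * bf S x (d y) = 0}"

definition tri :: "('k::field, 'v::ab_group_add, 'z) qsalg_scheme \<Rightarrow> ('k, 3 \<Rightarrow> 'v \<Rightarrow> 'v) salg" where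
  "tri S = \<lparr> scl = fscl (fscl (scl S)),
             gr = (\<lambda>p. {d. (\<forall>i. d i \<in> osp S p) \<and>
                     (\<forall>q. \<forall>x\<in>gr S q. \<forall>y\<in>scarrier S.
                        d 0 (mul S x y) = mul S (d 1 x) y + scl S (sg (p * q)) (mul S x (d 2 y)))}),
             mul = (\<lambda>d e i. scomm S (d i) (e i)) \<rparr>"

definition lop :: "('k, 'v::ab_group_add, 'z) qsalg_scheme \<Rightarrow> 'v \<Rightarrow> 'v \<Rightarrow> 'v" where
  "lop S x y = mul S x y"

definition rop :: "('k::field, 'v::ab_group_add, 'z) qsalg_scheme \<Rightarrow> 'v \<Rightarrow> 'v \<Rightarrow> 'v" where
  "rop S x y = (\<Sum>p\<in>{0, 1}. \<Sum>q\<in>{0, 1}.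
     scl S (sg (p * q)) (mul S (hpart (gr S) q y) (hpart (gr S) p x)))"

definition sigma :: "('k::field, 'v::ab_group_add, 'z) qsalg_scheme \<Rightarrow> 'v \<Rightarrow> 'v \<Rightarrow> 'v \<Rightarrow> 'v" where
  "sigma S x y z = (\<Sum>p\<in>{0, 1}. \<Sum>q\<in>{0, 1}. \<Sum>r\<in>{0, 1}.
     scl S (sg (q * r) * bf S (hpart (gr S) p x) (hpart (gr S) r z)) (hpart (gr S) q y)
       - scl S (sg (p * (q + r)) * bf S (hpart (gr S) q y) (hpart (gr S) r z)) (hpart (gr S) p x))"

definition tt :: "('k::field, 'v::ab_group_add, 'z) qsalg_scheme \<Rightarrow> 'v \<Rightarrow> 'v \<Rightarrow> 3 \<Rightarrow> 'v \<Rightarrow> 'v" where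
  "tt S x y i =
     (if i = 0 then sigma S x y
      else if i = 1 then (\<lambda>z. scl S (1 / 2 * bf S x y) z - rop S x (lop S y z))
      else (\<lambda>z. scl S (1 / 2 * bf S x y) z - lop S x (rop S y z)))"

text \<open>\<open>theta_pow i\<close> is the power \<open>\<theta>\<^sup>i\<close> of \<open>\<theta>(d\<^sub>0, d\<^sub>1, d\<^sub>2) = (d\<^sub>2, d\<^sub>0, d\<^sub>1)\<close>, which has order \<open>3\<close>.\<close>

definition theta_pow :: "3 \<Rightarrow> (3 \<Rightarrow> 'a) \<Rightarrow> 3 \<Rightarrow> 'a" where
  "theta_pow i d = (\<lambda>j. d (j - i))"


section \<open>Tensor products\<close>

text \<open>
  Over a field, the tensor product of \<open>V\<close> and \<open>W\<close> embeds into the dual of the space of bilinear forms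
  on \<open>V \<times> W\<close>: the pure tensor \<open>x \<otimes> y\<close> is evaluation at \<open>(x, y)\<close>, and the tensor product is the span
  of the pure tensors. The value off the bilinear forms is fixed to be \<open>0\<close>.
\<close>

type_synonym ('k, 'v, 'w) tensor = "('v \<Rightarrow> 'w \<Rightarrow> 'k) \<Rightarrow> 'k"

definition tens :: "('k::field, 'v::ab_group_add, 'y) salg_scheme \<Rightarrow> ('k, 'w::ab_group_add, 'z) salg_scheme \<Rightarrow>
    'v \<Rightarrow> 'w \<Rightarrow> ('k, 'v, 'w) tensor" where
  "tens S S' x y = (\<lambda>B. if bilinear_on (scl S) (scl S') (*) UNIV UNIV B then B x y else 0)"

definition tgr :: "('k::field, 'v::ab_group_add, 'y) salg_scheme \<Rightarrow> ('k, 'w::ab_group_add, 'z) salg_scheme \<Rightarrow>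
    bit \<Rightarrow> ('k, 'v, 'w) tensor set" where
  "tgr S S' p = module.span (fscl (*)) {tens S S' x y | x y q r. x \<in> gr S q \<and> y \<in> gr S' r \<and> q + r = p}"

text \<open>
  The linear map on the tensor product induced by a bilinear map \<open>\<beta>\<close>; for bilinear \<open>\<beta>\<close> the choice of
  the representation as a sum of pure tensors does not matter, see \<open>tlift_sum_list\<close> below.
\<close>

definition tlift :: "('k::field, 'v::ab_group_add, 'y) salg_scheme \<Rightarrow> ('k, 'w::ab_group_add, 'z) salg_scheme \<Rightarrow>
    ('v \<Rightarrow> 'w \<Rightarrow> 'u::ab_group_add) \<Rightarrow> ('k, 'v, 'w) tensor \<Rightarrow> 'u" where
  "tlift S S' \<beta> t =
     sum_list (map (case_prod \<beta>) (SOME ps. t = sum_list (map (case_prod (tens S S')) ps)))"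

lemma linear_on_UNIV_iff:
  fixes s1 :: "'k::field \<Rightarrow> 'v::ab_group_add \<Rightarrow> 'v" and s2 :: "'k \<Rightarrow> 'w::ab_group_add \<Rightarrow> 'w"
  assumes "vector_space s1" "vector_space s2"
  shows "linear_on s1 s2 UNIV f \<longleftrightarrow> Vector_Spaces.linear s1 s2 f"
  using assms
  by (auto simp: linear_on_def Vector_Spaces.linear_def module_hom_def module_hom_axioms_def
      module_iff_vector_space)

lemma linear_on_sum_list:
  assumes "linear_on s1 s2 UNIV f"
  shows "f (sum_list (map h ps)) = sum_list (map (\<lambda>p. f (h p)) ps)"
proof -
  have a: "f (x + y) = f x + f y" for x y
    using assms by (simp add: linear_on_def)
  have "f 0 = 0"
    using a[of 0 0] by simp
  then show ?thesis
    by (induction ps) (auto simp: a)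
qed

lemma exists_functional:
  fixes s :: "'k::field \<Rightarrow> 'u::ab_group_add \<Rightarrow> 'u"
  assumes s: "vector_space s" and u: "u \<noteq> 0"
  shows "\<exists>\<phi>. linear_on s (*) UNIV \<phi> \<and> \<phi> u \<noteq> 0"
proof -
  interpret vector_space s by fact
  interpret k: vector_space "(*) :: 'k \<Rightarrow> 'k \<Rightarrow> 'k"
    by standard (auto simp: algebra_simps)
  interpret vector_space_pair s "(*) :: 'k \<Rightarrow> 'k \<Rightarrow> 'k" ..
  have ind: "independent {u}"
    using u by (simp add: dependent_single)
  have lin: "Vector_Spaces.linear s (*) (construct {u} (\<lambda>_. 1))"
    using linear_construct[OF ind] .
  have "construct {u} (\<lambda>_. 1) u = 1"
    using construct_basis[OF ind] by simp
  then show ?thesis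
    using lin linear_on_UNIV_iff[OF s k.vector_space_axioms] by (metis zero_neq_one)
qed

lemma sum_list_tens_unique:
  fixes \<beta> :: "'v::ab_group_add \<Rightarrow> 'w::ab_group_add \<Rightarrow> 'u::ab_group_add" and s :: "'k::field \<Rightarrow> 'u \<Rightarrow> 'u"
  assumes s: "vector_space s" and \<beta>: "bilinear_on (scl S) (scl S') s UNIV UNIV \<beta>"
    and eq: "sum_list (map (case_prod (tens S S')) ps) = sum_list (map (case_prod (tens S S')) qs)"
  shows "sum_list (map (case_prod \<beta>) ps) = sum_list (map (case_prod \<beta>) qs)"
proof (rule ccontr)
  assume "\<not> ?thesis"
  then have "sum_list (map (case_prod \<beta>) ps) - sum_list (map (case_prod \<beta>) qs) \<noteq> 0"
    by simp
  then obtain \<phi> where \<phi>: "linear_on s (*) UNIV \<phi>"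
    and ne: "\<phi> (sum_list (map (case_prod \<beta>) ps) - sum_list (map (case_prod \<beta>) qs)) \<noteq> 0"
    using exists_functional[OF s] by blast
  have add: "\<phi> (x + y) = \<phi> x + \<phi> y" for x y
    using \<phi> by (simp add: linear_on_def)
  have diff: "\<phi> (x - y) = \<phi> x - \<phi> y" for x y
    using add[of "x - y" y] by simp
  define B where "B = (\<lambda>x y. \<phi> (\<beta> x y))"
  have bil: "bilinear_on (scl S) (scl S') (*) UNIV UNIV B"
    using \<phi> \<beta> by (auto simp: B_def bilinear_on_def linear_on_def)
  have app: "sum_list (map (case_prod (tens S S')) rs) B = \<phi> (sum_list (map (case_prod \<beta>) rs))" for rs
  proof -
    have "sum_list (map (case_prod (tens S S')) rs) B = sum_list (map (case_prod B) rs)"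
      using bil by (induction rs) (auto simp: tens_def)
    also have "\<dots> = \<phi> (sum_list (map (case_prod \<beta>) rs))"
      unfolding linear_on_sum_list[OF \<phi>] by (simp add: B_def case_prod_beta')
    finally show ?thesis .
  qed
  show False
    using ne by (simp add: diff flip: app) (simp add: eq)
qed

lemma tlift_sum_list:
  fixes \<beta> :: "'v::ab_group_add \<Rightarrow> 'w::ab_group_add \<Rightarrow> 'u::ab_group_add" and s :: "'k::field \<Rightarrow> 'u \<Rightarrow> 'u"
  assumes "vector_space s" and "bilinear_on (scl S) (scl S') s UNIV UNIV \<beta>"
  shows "tlift S S' \<beta> (sum_list (map (case_prod (tens S S')) ps)) = sum_list (map (case_prod \<beta>) ps)"
  unfolding tlift_def
  by (rule someI2[of _ ps], simp) (metis sum_list_tens_unique[OF assms])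

lemma tlift_tens:
  fixes \<beta> :: "'v::ab_group_add \<Rightarrow> 'w::ab_group_add \<Rightarrow> 'u::ab_group_add" and s :: "'k::field \<Rightarrow> 'u \<Rightarrow> 'u"
  assumes "vector_space s" and "bilinear_on (scl S) (scl S') s UNIV UNIV \<beta>"
  shows "tlift S S' \<beta> (tens S S' x y) = \<beta> x y"
  using tlift_sum_list[OF assms, of "[(x, y)]"] by simp


section \<open>The Lie superalgebra \<open>\<gg>(S, S')\<close>\<close>

text \<open>
  An element is a triple \<open>(d, d', u)\<close> with \<open>d\<close> in \<open>tri S\<close>, \<open>d'\<close> in \<open>tri S'\<close> and \<open>u\<close> the family of its
  components in the three copies of the tensor product, so \<open>u = \<Sum>\<^sub>i \<iota>\<^sub>i(u i)\<close>.
\<close>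

type_synonym ('k, 'v, 'w) gelem =
  "(3 \<Rightarrow> 'v \<Rightarrow> 'v) \<times> (3 \<Rightarrow> 'w \<Rightarrow> 'w) \<times> (3 \<Rightarrow> ('k, 'v, 'w) tensor)"

definition giota :: "3 \<Rightarrow> ('k, 'v, 'w) tensor \<Rightarrow> ('k::field, 'v::ab_group_add, 'w::ab_group_add) gelem" where
  "giota i t = (0, 0, (\<lambda>j. if j = i then t else 0))"

definition gtri :: "(3 \<Rightarrow> 'v \<Rightarrow> 'v) \<Rightarrow> ('k::field, 'v::ab_group_add, 'w::ab_group_add) gelem" where
  "gtri d = (d, 0, 0)"

definition gtri' :: "(3 \<Rightarrow> 'w \<Rightarrow> 'w) \<Rightarrow> ('k::field, 'v::ab_group_add, 'w::ab_group_add) gelem" where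
  "gtri' d = (0, d, 0)"

definition gscl :: "('k::field, 'v::ab_group_add, 'y) qsalg_scheme \<Rightarrow> ('k, 'w::ab_group_add, 'z) qsalg_scheme \<Rightarrow>
    'k \<Rightarrow> ('k, 'v, 'w) gelem \<Rightarrow> ('k, 'v, 'w) gelem" where
  "gscl S S' c = (\<lambda>(d, d', u). (fscl (fscl (scl S)) c d, fscl (fscl (scl S')) c d', fscl (fscl (*)) c u))"

definition ggr :: "('k::field, 'v::ab_group_add, 'y) qsalg_scheme \<Rightarrow> ('k, 'w::ab_group_add, 'z) qsalg_scheme \<Rightarrow>
    bit \<Rightarrow> ('k, 'v, 'w) gelem set" where
  "ggr S S' p = gr (tri S) p \<times> gr (tri S') p \<times> {u. \<forall>i. u i \<in> tgr S S' p}"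

text \<open>\<open>[(d\<^sub>0, d\<^sub>1, d\<^sub>2), \<iota>\<^sub>i(t)] = \<iota>\<^sub>i(act (d\<^sub>i) t)\<close> and likewise for \<open>act'\<close>.\<close>

definition act :: "('k::field, 'v::ab_group_add, 'y) qsalg_scheme \<Rightarrow> ('k, 'w::ab_group_add, 'z) qsalg_scheme \<Rightarrow>
    ('v \<Rightarrow> 'v) \<Rightarrow> ('k, 'v, 'w) tensor \<Rightarrow> ('k, 'v, 'w) tensor" where
  "act S S' f = tlift S S' (\<lambda>x x'. tens S S' (f x) x')"

definition act' :: "('k::field, 'v::ab_group_add, 'y) qsalg_scheme \<Rightarrow> ('k, 'w::ab_group_add, 'z) qsalg_scheme \<Rightarrow>
    ('w \<Rightarrow> 'w) \<Rightarrow> ('k, 'v, 'w) tensor \<Rightarrow> ('k, 'v, 'w) tensor" where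
  "act' S S' f = tlift S S' (\<lambda>x x'. \<Sum>p\<in>{0, 1}. \<Sum>q\<in>{0, 1}.
     fscl (*) (sg (p * q)) (tens S S' (hpart (gr S) q x) (hpart (Endo S') p f x')))"

text \<open>\<open>[\<iota>\<^sub>i(t), \<iota>\<^sub>i\<^sub>+\<^sub>1(u)] = \<iota>\<^sub>i\<^sub>+\<^sub>2(tprod t u)\<close>.\<close>

definition tprod :: "('k::field, 'v::ab_group_add, 'y) qsalg_scheme \<Rightarrow> ('k, 'w::ab_group_add, 'z) qsalg_scheme \<Rightarrow>
    ('k, 'v, 'w) tensor \<Rightarrow> ('k, 'v, 'w) tensor \<Rightarrow> ('k, 'v, 'w) tensor" where
  "tprod S S' t u = tlift S S' (\<lambda>x x'. tlift S S' (\<lambda>y y'. \<Sum>p'\<in>{0, 1}. \<Sum>q\<in>{0, 1}.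
     fscl (*) (sg (p' * q))
       (tens S S' (mul S x (hpart (gr S) q y)) (mul S' (hpart (gr S') p' x') y'))) u) t"

text \<open>
  \<open>[\<iota>\<^sub>i(t), \<iota>\<^sub>i(u)]\<close> has the components \<open>\<theta>\<^sup>i(diag t u)\<close> in \<open>tri S\<close> and \<open>\<theta>'\<^sup>i(diag' t u)\<close> in \<open>tri S'\<close>.
\<close>

definition diag :: "('k::field, 'v::ab_group_add, 'y) qsalg_scheme \<Rightarrow> ('k, 'w::ab_group_add, 'z) qsalg_scheme \<Rightarrow>
    ('k, 'v, 'w) tensor \<Rightarrow> ('k, 'v, 'w) tensor \<Rightarrow> 3 \<Rightarrow> 'v \<Rightarrow> 'v" where
  "diag S S' t u = tlift S S' (\<lambda>x x'. tlift S S' (\<lambda>y y'.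
     \<Sum>p\<in>{0, 1}. \<Sum>p'\<in>{0, 1}. \<Sum>q\<in>{0, 1}. \<Sum>q'\<in>{0, 1}.
       fscl (fscl (scl S))
         (sg (p * p' + p * q' + q * q') * bf S' (hpart (gr S') p' x') (hpart (gr S') q' y'))
         (tt S (hpart (gr S) p x) (hpart (gr S) q y))) u) t"

definition diag' :: "('k::field, 'v::ab_group_add, 'y) qsalg_scheme \<Rightarrow> ('k, 'w::ab_group_add, 'z) qsalg_scheme \<Rightarrow>
    ('k, 'v, 'w) tensor \<Rightarrow> ('k, 'v, 'w) tensor \<Rightarrow> 3 \<Rightarrow> 'w \<Rightarrow> 'w" where
  "diag' S S' t u = tlift S S' (\<lambda>x x'. tlift S S' (\<lambda>y y'.
     \<Sum>p'\<in>{0, 1}. \<Sum>q\<in>{0, 1}.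
       fscl (fscl (scl S')) (sg (q * p') * bf S x (hpart (gr S) q y))
         (tt S' (hpart (gr S') p' x') y')) u) t"

text \<open>
  The brackets \<open>[(d, d'), \<iota>\<^sub>i(t)]\<close> and \<open>[\<iota>\<^sub>i(t), \<iota>\<^sub>i\<^sub>+\<^sub>1(u)]\<close>, whose opposites
  \<open>[\<iota>\<^sub>i(t), (d, d')]\<close> and \<open>[\<iota>\<^sub>i\<^sub>+\<^sub>1(u), \<iota>\<^sub>i(t)]\<close> are then determined by super-anticommutativity.
  The component at \<open>j\<close> of the second kind comes from \<open>i = j + 1\<close>.
\<close>

definition ghalf :: "('k::field, 'v::ab_group_add, 'y) qsalg_scheme \<Rightarrow> ('k, 'w::ab_group_add, 'z) qsalg_scheme \<Rightarrow>
    ('k, 'v, 'w) gelem \<Rightarrow> ('k, 'v, 'w) gelem \<Rightarrow> ('k, 'v, 'w) gelem" where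
  "ghalf S S' = (\<lambda>(d, d', u) (e, e', v).
     (0, 0, (\<lambda>j. act S S' (d j) (v j) + act' S S' (d' j) (v j) + tprod S S' (u (j + 1)) (v (j + 2)))))"

definition gbracket :: "('k::field, 'v::ab_group_add, 'y) qsalg_scheme \<Rightarrow> ('k, 'w::ab_group_add, 'z) qsalg_scheme \<Rightarrow>
    ('k, 'v, 'w) gelem \<Rightarrow> ('k, 'v, 'w) gelem \<Rightarrow> ('k, 'v, 'w) gelem" where
  "gbracket S S' X Y =
     (case X of (d, d', u) \<Rightarrow> case Y of (e, e', v) \<Rightarrow>
       (mul (tri S) d e + (\<Sum>i\<in>UNIV. theta_pow i (diag S S' (u i) (v i))),
        mul (tri S') d' e' + (\<Sum>i\<in>UNIV. theta_pow i (diag' S S' (u i) (v i))),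
        0))
     + ghalf S S' X Y
     - (\<Sum>p\<in>{0, 1}. \<Sum>q\<in>{0, 1}.
         gscl S S' (sg (p * q)) (ghalf S S' (hpart (ggr S S') q Y) (hpart (ggr S S') p X)))"

definition galg :: "('k::field, 'v::ab_group_add, 'y) qsalg_scheme \<Rightarrow> ('k, 'w::ab_group_add, 'z) qsalg_scheme \<Rightarrow>
    ('k, ('k, 'v, 'w) gelem) salg" where
  "galg S S' = \<lparr> scl = gscl S S', gr = ggr S S', mul = gbracket S S' \<rparr>"


subsection \<open>The brackets of homogeneous elements\<close>

lemma hpart_homogeneous:
  assumes "\<And>q x y. x \<in> V q \<Longrightarrow> y \<in> V q \<Longrightarrow> x - y \<in> V q" and "\<And>q. 0 \<in> V q"
    and disj: "\<And>x. x \<in> V 0 \<Longrightarrow> x \<in> V 1 \<Longrightarrow> x = 0" and x: "x \<in> V q"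
  shows "hpart V p x = (if p = q then x else 0)"
  unfolding hpart_def
proof (rule the_equality)
  have pq: "q = p + 1" if "p \<noteq> q"
    using that by (cases p; cases q) auto
  show "(if p = q then x else 0) \<in> V p \<and> x - (if p = q then x else 0) \<in> V (p + 1)"
    using assms pq by auto
next
  fix y assume y: "y \<in> V p \<and> x - y \<in> V (p + 1)"
  have disj': "z = 0" if "z \<in> V p" "z \<in> V (p + 1)" for z
    using that disj by (cases p) auto
  show "y = (if p = q then x else 0)"
  proof (cases "p = q")
    case True
    then have "x - y \<in> V p"
      using y x assms(1) by blast
    then show ?thesis
      using disj' y True by fastforce
  next
    case False
    then have "q = p + 1"
      by (cases p; cases q) auto
    then have "x - (x - y) \<in> V (p + 1)"
      using y x assms(1) by blast
    then show ?thesis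
      using disj' y False by simp
  qed
qed

lemma linear_on_0: "linear_on s1 s2 UNIV f \<Longrightarrow> f 0 = 0"
  by (auto simp: linear_on_def) (metis add_cancel_left_left)

lemma linear_on_diff: "linear_on s1 s2 UNIV f \<Longrightarrow> f (x - y) = f x - f y"
  by (auto simp: linear_on_def eq_diff_eq) (metis diff_add_cancel)

lemma vector_space_fscl: "vector_space s \<Longrightarrow> vector_space (fscl s)"
  by (auto simp: vector_space_def fscl_def fun_eq_iff)

lemma vector_space_field: "vector_space ((*) :: 'k::field \<Rightarrow> 'k \<Rightarrow> 'k)"
  by (auto simp: vector_space_def algebra_simps)

lemma linear_on_sum:
  assumes "vector_space s2" and "\<And>i. i \<in> I \<Longrightarrow> linear_on s1 s2 UNIV (f i)"
  shows "linear_on s1 s2 UNIV (\<lambda>x. \<Sum>i\<in>I. f i x)"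
  using assms
  by (auto simp: linear_on_def sum.distrib module.scale_sum_right module_iff_vector_space)

lemma bilinear_on_sum:
  assumes "vector_space s3" and "\<And>i. i \<in> I \<Longrightarrow> bilinear_on s1 s2 s3 UNIV UNIV (f i)"
  shows "bilinear_on s1 s2 s3 UNIV UNIV (\<lambda>x y. \<Sum>i\<in>I. f i x y)"
  using assms by (auto simp: bilinear_on_def intro!: linear_on_sum)

lemma bilinear_on_comp:
  assumes "bilinear_on s1 s2 s3 UNIV UNIV f" and "linear_on t1 s1 UNIV g" and "linear_on t2 s2 UNIV h"
  shows "bilinear_on t1 t2 s3 UNIV UNIV (\<lambda>x y. f (g x) (h y))"
  using assms by (auto simp: bilinear_on_def linear_on_def)

lemma bilinear_on_scale:
  assumes "vector_space s3" and "bilinear_on s1 s2 s3 UNIV UNIV f"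
  shows "bilinear_on s1 s2 s3 UNIV UNIV (\<lambda>x y. s3 c (f x y))"
  using assms
  by (auto simp: bilinear_on_def linear_on_def vector_space_def mult.commute)

lemma bilinear_on_scalar1:
  assumes "vector_space s3" and "linear_on s1 (*) UNIV \<phi>" and "linear_on s2 s3 UNIV \<psi>"
  shows "bilinear_on s1 s2 s3 UNIV UNIV (\<lambda>x y. s3 (c * \<phi> x) (\<psi> y))"
  using assms
  by (auto simp: bilinear_on_def linear_on_def vector_space_def algebra_simps)

lemma bilinear_on_scalar2:
  assumes "vector_space s3" and "linear_on s1 s3 UNIV \<psi>" and "linear_on s2 (*) UNIV \<phi>"
  shows "bilinear_on s1 s2 s3 UNIV UNIV (\<lambda>x y. s3 (c * \<phi> y) (\<psi> x))"
  using assms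
  by (auto simp: bilinear_on_def linear_on_def vector_space_def algebra_simps)

lemma linear_on_id: "linear_on s s UNIV (\<lambda>x. x)"
  by (simp add: linear_on_def)

lemma linear_on_compose:
  "linear_on s2 s3 UNIV f \<Longrightarrow> linear_on s1 s2 UNIV g \<Longrightarrow> linear_on s1 s3 UNIV (\<lambda>x. f (g x))"
  by (simp add: linear_on_def)

lemma bilinear_tens:
  "bilinear_on (scl S) (scl S') (fscl (*)) UNIV UNIV (tens S S')"
  by (auto simp: bilinear_on_def linear_on_def tens_def fscl_def fun_eq_iff)

lemma tlift_0_left: "tlift S S' (\<lambda>x y. 0) t = 0"
  by (simp add: tlift_def case_prod_beta')

locale full_superspace =
  fixes S :: "('k::field, 'v::ab_group_add, 'z) qsalg_scheme"
  assumes superalgebra: "superalgebra S" and superform: "quadratic_superform S"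
    and full: "scarrier S = UNIV"
begin

sublocale vector_space "scl S"
  using superalgebra by (simp add: superalgebra_def superspace_def)

lemma sub: "subspace (gr S p)"
  using superalgebra by (simp add: superalgebra_def superspace_def)

lemma disj: "x \<in> gr S 0 \<Longrightarrow> x \<in> gr S 1 \<Longrightarrow> x = 0"
  using superalgebra by (auto simp: superalgebra_def superspace_def)

lemma disj2: "x \<in> gr S p \<Longrightarrow> x \<in> gr S q \<Longrightarrow> p \<noteq> q \<Longrightarrow> x = 0"
  using disj by (cases p; cases q) auto

lemma decomp: "\<exists>y\<in>gr S 0. \<exists>z\<in>gr S 1. x = y + z"
  using full unfolding scarrier_def gsum_def by blast

lemma hp: "x \<in> gr S q \<Longrightarrow> hpart (gr S) p x = (if p = q then x else 0)"
  using sub disj by (intro hpart_homogeneous) (auto simp: subspace_diff subspace_0)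

lemma hp_unique: "y \<in> gr S p \<Longrightarrow> x - y \<in> gr S (p + 1) \<Longrightarrow> hpart (gr S) p x = y"
  unfolding hpart_def
proof (rule the_equality)
  fix z assume "y \<in> gr S p" "x - y \<in> gr S (p + 1)" "z \<in> gr S p \<and> x - z \<in> gr S (p + 1)"
  then have "z - y \<in> gr S p" and "(x - y) - (x - z) \<in> gr S (p + 1)"
    using sub subspace_diff by blast+
  then have "z - y = 0"
    using disj2[of "z - y" p "p + 1"] by simp
  then show "z = y"
    by simp
qed auto

lemma hp_in: "hpart (gr S) p x \<in> gr S p" "x - hpart (gr S) p x \<in> gr S (p + 1)"
proof -
  have "\<exists>y\<in>gr S p. x - y \<in> gr S (p + 1)"
  proof -
    obtain y z where "y \<in> gr S 0" "z \<in> gr S 1" "x = y + z"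
      using decomp by blast
    then show ?thesis
      by (cases p) (auto intro: bexI[of _ y] bexI[of _ z])
  qed
  then obtain y where "y \<in> gr S p" "x - y \<in> gr S (p + 1)"
    by blast
  then show "hpart (gr S) p x \<in> gr S p" "x - hpart (gr S) p x \<in> gr S (p + 1)"
    using hp_unique by auto
qed

lemma hp_linear: "linear_on (scl S) (scl S) UNIV (hpart (gr S) p)"
proof -
  have "hpart (gr S) p (x + y) = hpart (gr S) p x + hpart (gr S) p y" for x y
  proof (rule hp_unique)
    show "hpart (gr S) p x + hpart (gr S) p y \<in> gr S p"
      using hp_in sub by (simp add: subspace_add)
    have "(x - hpart (gr S) p x) + (y - hpart (gr S) p y) \<in> gr S (p + 1)"
      using hp_in sub by (simp add: subspace_add)
    then show "x + y - (hpart (gr S) p x + hpart (gr S) p y) \<in> gr S (p + 1)"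
      by (simp add: algebra_simps)
  qed
  moreover have "hpart (gr S) p (scl S c x) = scl S c (hpart (gr S) p x)" for c x
  proof (rule hp_unique)
    show "scl S c (hpart (gr S) p x) \<in> gr S p"
      using hp_in sub by (simp add: subspace_scale)
    have "scl S c (x - hpart (gr S) p x) \<in> gr S (p + 1)"
      using hp_in sub by (simp add: subspace_scale)
    then show "scl S c x - scl S c (hpart (gr S) p x) \<in> gr S (p + 1)"
      by (simp add: scale_right_diff_distrib)
  qed
  ultimately show ?thesis
    by (simp add: linear_on_def)
qed

lemma mul_bilinear: "bilinear_on (scl S) (scl S) (scl S) UNIV UNIV (mul S)"
  using superalgebra full by (simp add: superalgebra_def)

lemma mul_linear: "linear_on (scl S) (scl S) UNIV (mul S x)" "linear_on (scl S) (scl S) UNIV (\<lambda>x. mul S x y)"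
  using mul_bilinear by (simp_all add: bilinear_on_def)

lemma bf_linear: "linear_on (scl S) (*) UNIV (bf S x)" "linear_on (scl S) (*) UNIV (\<lambda>x. bf S x y)"
  using superform full by (simp_all add: quadratic_superform_def bilinear_on_def)

lemma Endo_linear: "d \<in> Endo S p \<Longrightarrow> linear_on (scl S) (scl S) UNIV d"
  using full by (simp add: Endo_def)

lemma Endo_disj: "d \<in> Endo S 0 \<Longrightarrow> d \<in> Endo S 1 \<Longrightarrow> d = 0"
proof
  fix x assume d: "d \<in> Endo S 0" "d \<in> Endo S 1"
  obtain y z where y: "y \<in> gr S 0" and z: "z \<in> gr S 1" and x: "x = y + z"
    using decomp by blast
  have "d w = 0" if "w \<in> gr S q" for w q
    using d that disj2[of "d w" "0 + q" "1 + q"] by (auto simp: Endo_def)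
  then show "d x = 0 x"
    using Endo_linear[OF d(1)] y z by (simp add: x linear_on_def)
qed

lemma Endo_diff: "d \<in> Endo S p \<Longrightarrow> e \<in> Endo S p \<Longrightarrow> d - e \<in> Endo S p"
  using sub by (auto simp: Endo_def linear_on_def scale_right_diff_distrib subspace_diff)

lemma Endo_0: "0 \<in> Endo S p"
  using sub by (auto simp: Endo_def linear_on_def subspace_0)

lemma Endo_hp: "d \<in> Endo S q \<Longrightarrow> hpart (Endo S) p d = (if p = q then d else 0)"
  using Endo_disj Endo_diff Endo_0 by (intro hpart_homogeneous) auto

lemma Endo_hp0: "hpart (Endo S) p 0 = 0"
  using Endo_hp[OF Endo_0] by simp

lemma tri_in_Endo: "d \<in> gr (tri S) p \<Longrightarrow> d i \<in> Endo S p"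
  by (simp add: tri_def osp_def)

lemma tri_diff: "d \<in> gr (tri S) p \<Longrightarrow> e \<in> gr (tri S) p \<Longrightarrow> d - e \<in> gr (tri S) p"
proof -
  note m = linear_on_diff[OF mul_linear(1)] linear_on_diff[OF mul_linear(2)]
  note b = linear_on_diff[OF bf_linear(1)] linear_on_diff[OF bf_linear(2)]
  assume de: "d \<in> gr (tri S) p" "e \<in> gr (tri S) p"
  have "(d - e) i \<in> osp S p" for i
  proof -
    have o: "d i \<in> osp S p" "e i \<in> osp S p"
      using de by (auto simp: tri_def)
    have "bf S ((d i - e i) x) y + sg (p * q) * bf S x ((d i - e i) y) = 0" if "x \<in> gr S q" for x y q
    proof -
      have "bf S ((d i - e i) x) y + sg (p * q) * bf S x ((d i - e i) y)
          = (bf S (d i x) y + sg (p * q) * bf S x (d i y)) - (bf S (e i x) y + sg (p * q) * bf S x (e i y))"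
        by (simp add: b algebra_simps)
      also have "\<dots> = 0"
        using o that full by (simp add: osp_def)
      finally show ?thesis .
    qed
    then show ?thesis
      using o Endo_diff[of "d i" p "e i"] by (simp add: osp_def)
  qed
  then show ?thesis
    using de by (auto simp: tri_def m scale_right_diff_distrib)
qed

lemma tri_0: "0 \<in> gr (tri S) p"
  using Endo_0 linear_on_0[OF mul_linear(1)] linear_on_0[OF mul_linear(2)]
    linear_on_0[OF bf_linear(1)] linear_on_0[OF bf_linear(2)]
  by (auto simp: tri_def osp_def)

lemma tri_disj: "d \<in> gr (tri S) 0 \<Longrightarrow> d \<in> gr (tri S) 1 \<Longrightarrow> d = 0"
proof
  fix i assume "d \<in> gr (tri S) 0" "d \<in> gr (tri S) 1"
  then show "d i = 0 i"
    using Endo_disj[of "d i"] tri_in_Endo by auto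
qed

lemma scomm_0:
  assumes "e \<in> Endo S r"
  shows "scomm S 0 e = 0" "scomm S e 0 = 0"
proof -
  have 0: "hpart (Endo S) p 0 = 0" for p
    using Endo_hp[OF Endo_0] by simp
  have z: "hpart (Endo S) p e 0 = 0" for p
    using Endo_hp[OF assms] linear_on_0[OF Endo_linear[OF assms]] by simp
  show "scomm S e 0 = 0" "scomm S 0 e = 0"
    using z by (auto simp: scomm_def 0 fscl_def fun_eq_iff)
qed

lemma tri_mul_0:
  assumes "d \<in> gr (tri S) p"
  shows "mul (tri S) d 0 = 0" "mul (tri S) 0 d = 0"
  using scomm_0[OF tri_in_Endo[OF assms]] by (simp_all add: tri_def fun_eq_iff)

lemma sigma_linear:
  "linear_on (scl S) (scl S) UNIV (\<lambda>x. sigma S x y z)"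
  "linear_on (scl S) (scl S) UNIV (\<lambda>y. sigma S x y z)"
  using hp_linear bf_linear unfolding sigma_def
  by (auto simp: linear_on_def algebra_simps)

lemma rop_linear:
  "linear_on (scl S) (scl S) UNIV (\<lambda>x. rop S x y)"
  "linear_on (scl S) (scl S) UNIV (\<lambda>y. rop S x y)"
  using hp_linear mul_linear unfolding rop_def
  by (auto simp: linear_on_def algebra_simps)

lemma tt_linear:
  "linear_on (scl S) (fscl (fscl (scl S))) UNIV (\<lambda>x. tt S x y)"
  "linear_on (scl S) (fscl (fscl (scl S))) UNIV (\<lambda>y. tt S x y)"
  using sigma_linear rop_linear mul_linear bf_linear
  by (auto simp: linear_on_def fun_eq_iff tt_def fscl_def lop_def algebra_simps)

end

locale full_pair = S: full_superspace S + S': full_superspace S'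
  for S :: "('k::field, 'v::ab_group_add, 'y) qsalg_scheme"
    and S' :: "('k, 'w::ab_group_add, 'z) qsalg_scheme"
begin

sublocale tensor: vector_space "fscl (*) :: 'k \<Rightarrow> ('k, 'v, 'w) tensor \<Rightarrow> ('k, 'v, 'w) tensor"
  by (rule vector_space_fscl[OF vector_space_field])

lemma tens_in_tgr: "x \<in> gr S q \<Longrightarrow> y \<in> gr S' r \<Longrightarrow> tens S S' x y \<in> tgr S S' (q + r)"
  unfolding tgr_def by (rule tensor.span_base) blast

lemma tgr_subspace: "tensor.subspace (tgr S S' p)"
  unfolding tgr_def by (rule tensor.subspace_span)

text \<open>A tensor of parity \<open>p\<close> only sees the part of a bilinear form which is homogeneous of parity \<open>p\<close>.\<close>

lemma tgr_apply:
  assumes "t \<in> tgr S S' q" and B: "bilinear_on (scl S) (scl S') (*) UNIV UNIV B"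
  shows "t (\<lambda>x y. \<Sum>r\<in>{0, 1}. B (hpart (gr S) r x) (hpart (gr S') (p + r) y)) = (if p = q then t B else 0)"
  using assms(1) unfolding tgr_def
proof (induction rule: tensor.span_induct_alt)
  case base
  show ?case by simp
next
  case (step c u v)
  then obtain x y a b where u: "u = tens S S' x y" and x: "x \<in> gr S a" and y: "y \<in> gr S' b" and q: "q = a + b"
    by blast
  have bil: "bilinear_on (scl S) (scl S') (*) UNIV UNIV
      (\<lambda>x y. \<Sum>r\<in>{0, 1}. B (hpart (gr S) r x) (hpart (gr S') (p + r) y))"
    by (intro bilinear_on_sum vector_space_field bilinear_on_comp[OF B] S.hp_linear S'.hp_linear)
  have "B 0 y = 0" "B x 0 = 0" for x y
    using B linear_on_0 unfolding bilinear_on_def by blast+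
  then have "u (\<lambda>x y. \<Sum>r\<in>{0, 1}. B (hpart (gr S) r x) (hpart (gr S') (p + r) y))
      = (if p = q then u B else 0)"
    using bil B by (cases a; cases b; cases p) (auto simp: u tens_def S.hp[OF x] S'.hp[OF y] q)
  then show ?case
    using step by (auto simp: fscl_def)
qed

lemma tgr_disj:
  assumes "t \<in> tgr S S' 0" "t \<in> tgr S S' 1"
  shows "t = 0"
proof
  fix B
  show "t B = 0 B"
  proof (cases "bilinear_on (scl S) (scl S') (*) UNIV UNIV B")
    case True
    show ?thesis
      using tgr_apply[OF assms(1) True, of 0] tgr_apply[OF assms(2) True, of 0] by simp
  next
    case False
    show ?thesis
      using assms(1) unfolding tgr_def
      by (induction rule: tensor.span_induct_alt) (auto simp: fscl_def tens_def False)
  qed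
qed

lemma ggr_hp:
  "X \<in> ggr S S' q \<Longrightarrow> hpart (ggr S S') p X = (if p = q then X else 0)"
proof (intro hpart_homogeneous)
  show "X \<in> ggr S S' q \<Longrightarrow> Y \<in> ggr S S' q \<Longrightarrow> X - Y \<in> ggr S S' q" for X Y q
    using S.tri_diff S'.tri_diff tgr_subspace tensor.subspace_diff by (auto simp: ggr_def)
  show "0 \<in> ggr S S' q" for q
    using S.tri_0 S'.tri_0 tgr_subspace tensor.subspace_0 by (auto simp: ggr_def zero_prod_def)
  show "X \<in> ggr S S' 0 \<Longrightarrow> X \<in> ggr S S' 1 \<Longrightarrow> X = 0" for X
    using S.tri_disj S'.tri_disj tgr_disj by (auto simp: ggr_def zero_prod_def fun_eq_iff)
qed auto

lemma ggr_0: "0 \<in> ggr S S' p"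
  using S.tri_0 S'.tri_0 tgr_subspace tensor.subspace_0 by (auto simp: ggr_def zero_prod_def)

lemma giota_in_ggr: "t \<in> tgr S S' p \<Longrightarrow> giota i t \<in> ggr S S' p"
  using S.tri_0 S'.tri_0 tgr_subspace tensor.subspace_0 by (auto simp: ggr_def giota_def)

lemma gtri_in_ggr: "d \<in> gr (tri S) p \<Longrightarrow> gtri d \<in> ggr S S' p" "e \<in> gr (tri S') p \<Longrightarrow> gtri' e \<in> ggr S S' p"
  using S.tri_0 S'.tri_0 tgr_subspace tensor.subspace_0 by (auto simp: ggr_def gtri_def gtri'_def)

lemma act_bilinear:
  "linear_on (scl S) (scl S) UNIV f \<Longrightarrow>
    bilinear_on (scl S) (scl S') (fscl (*)) UNIV UNIV (\<lambda>x x'. tens S S' (f x) x')"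
  by (intro bilinear_on_comp[OF bilinear_tens] linear_on_id)

lemma act_tens:
  "linear_on (scl S) (scl S) UNIV f \<Longrightarrow> act S S' f (tens S S' x x') = tens S S' (f x) x'"
  unfolding act_def by (rule tlift_tens[OF tensor.vector_space_axioms act_bilinear])

lemma act'_bilinear:
  assumes "f \<in> Endo S' r"
  shows "bilinear_on (scl S) (scl S') (fscl (*)) UNIV UNIV (\<lambda>x x'. \<Sum>p\<in>{0, 1}. \<Sum>q\<in>{0, 1}.
     fscl (*) (sg (p * q)) (tens S S' (hpart (gr S) q x) (hpart (Endo S') p f x')))"
proof -
  have "linear_on (scl S') (scl S') UNIV (\<lambda>x'. hpart (Endo S') p f x')" for p
    using S'.Endo_linear[OF assms] by (simp add: S'.Endo_hp[OF assms] linear_on_def)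
  then show ?thesis
    by (intro bilinear_on_sum bilinear_on_scale bilinear_on_comp[OF bilinear_tens]
        tensor.vector_space_axioms S.hp_linear)
qed

lemma tens_0: "tens S S' 0 y = 0" "tens S S' x 0 = 0"
  using bilinear_tens[of S S'] linear_on_0 unfolding bilinear_on_def by blast+

lemma act'_tens:
  assumes f: "f \<in> Endo S' p" and x: "x \<in> gr S q"
  shows "act' S S' f (tens S S' x x') = fscl (*) (sg (p * q)) (tens S S' x (f x'))"
  unfolding act'_def tlift_tens[OF tensor.vector_space_axioms act'_bilinear[OF f]]
  by (cases p; cases q) (auto simp: S'.Endo_hp[OF f] S.hp[OF x] tens_0)

lemma act_0: "linear_on (scl S) (scl S) UNIV f \<Longrightarrow> act S S' f 0 = 0" "act S S' 0 t = 0"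
  using tlift_sum_list[OF tensor.vector_space_axioms act_bilinear, where ps = "[]"]
  by (auto simp: act_def tens_0 tlift_0_left)

lemma act'_0: "f \<in> Endo S' p \<Longrightarrow> act' S S' f 0 = 0" "act' S S' 0 t = 0"
  using tlift_sum_list[OF tensor.vector_space_axioms act'_bilinear, where ps = "[]"]
  by (auto simp: act'_def tens_0 tlift_0_left S'.Endo_hp0 tensor.scale_zero_right)

lemma tlift2_tens:
  fixes s :: "'k \<Rightarrow> 'u::ab_group_add \<Rightarrow> 'u"
  assumes "vector_space s"
    and "\<And>x x'. bilinear_on (scl S) (scl S') s UNIV UNIV (\<lambda>y y'. \<beta> x x' y y')"
    and "\<And>y y'. bilinear_on (scl S) (scl S') s UNIV UNIV (\<lambda>x x'. \<beta> x x' y y')"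
  shows "tlift S S' (\<lambda>x x'. tlift S S' (\<beta> x x') (tens S S' y y')) (tens S S' x x') = \<beta> x x' y y'"
    and "tlift S S' (\<lambda>x x'. tlift S S' (\<beta> x x') 0) t = 0"
    and "tlift S S' (\<lambda>x x'. tlift S S' (\<beta> x x') u) 0 = 0"
proof -
  show "tlift S S' (\<lambda>x x'. tlift S S' (\<beta> x x') (tens S S' y y')) (tens S S' x x') = \<beta> x x' y y'"
    unfolding tlift_tens[OF assms(1,2)] by (rule tlift_tens[OF assms(1,3)])
  interpret s: vector_space s by fact
  have "bilinear_on (scl S) (scl S') s UNIV UNIV (\<lambda>x x'. sum_list (map (case_prod (\<beta> x x')) ps))" for ps
  proof (induction ps)
    case Nil
    show ?case by (simp add: bilinear_on_def linear_on_def)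
  next
    case (Cons a ps)
    then show ?case
      using assms(3)[of "fst a" "snd a"]
      by (simp add: bilinear_on_def linear_on_def case_prod_beta s.scale_right_distrib)
  qed
  then have "bilinear_on (scl S) (scl S') s UNIV UNIV (\<lambda>x x'. tlift S S' (\<beta> x x') u)"
    unfolding tlift_def .
  then show "tlift S S' (\<lambda>x x'. tlift S S' (\<beta> x x') u) 0 = 0"
    using tlift_sum_list[OF assms(1), where ps = "[]"] by fastforce
  have "tlift S S' (\<beta> x x') 0 = 0" for x x'
    using tlift_sum_list[OF assms(1,2), where ps = "[]"] by simp
  then show "tlift S S' (\<lambda>x x'. tlift S S' (\<beta> x x') 0) t = 0"
    by (simp add: tlift_0_left)
qed

lemma tprod_tens:
  "tprod S S' (tens S S' x x') (tens S S' y y') = (\<Sum>p'\<in>{0, 1}. \<Sum>q\<in>{0, 1}.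
     fscl (*) (sg (p' * q)) (tens S S' (mul S x (hpart (gr S) q y)) (mul S' (hpart (gr S') p' x') y')))"
  "tprod S S' t 0 = 0" "tprod S S' 0 u = 0"
  unfolding tprod_def
  by (rule tlift2_tens[OF tensor.vector_space_axioms];
      intro bilinear_on_sum bilinear_on_scale bilinear_on_comp[OF bilinear_tens]
        tensor.vector_space_axioms S.mul_linear linear_on_compose[OF S.mul_linear(1) S.hp_linear]
        S'.mul_linear linear_on_compose[OF S'.mul_linear(2) S'.hp_linear])+

lemma diag_tens:
  "diag S S' (tens S S' x x') (tens S S' y y') =
     (\<Sum>p\<in>{0, 1}. \<Sum>p'\<in>{0, 1}. \<Sum>q\<in>{0, 1}. \<Sum>q'\<in>{0, 1}.
       fscl (fscl (scl S))
         (sg (p * p' + p * q' + q * q') * bf S' (hpart (gr S') p' x') (hpart (gr S') q' y'))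
         (tt S (hpart (gr S) p x) (hpart (gr S) q y)))"
  "diag S S' t 0 = 0" "diag S S' 0 u = 0"
  unfolding diag_def
  by (rule tlift2_tens[OF vector_space_fscl[OF vector_space_fscl[OF S.vector_space_axioms]]];
      intro bilinear_on_sum bilinear_on_scalar2 vector_space_fscl S.vector_space_axioms
        linear_on_compose[OF S'.bf_linear(1) S'.hp_linear] linear_on_compose[OF S'.bf_linear(2) S'.hp_linear]
        linear_on_compose[OF S.tt_linear(1) S.hp_linear] linear_on_compose[OF S.tt_linear(2) S.hp_linear])+

lemma diag'_tens:
  "diag' S S' (tens S S' x x') (tens S S' y y') =
     (\<Sum>p'\<in>{0, 1}. \<Sum>q\<in>{0, 1}.
       fscl (fscl (scl S')) (sg (q * p') * bf S x (hpart (gr S) q y)) (tt S' (hpart (gr S') p' x') y'))"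
  "diag' S S' t 0 = 0" "diag' S S' 0 u = 0"
  unfolding diag'_def
  by (rule tlift2_tens[OF vector_space_fscl[OF vector_space_fscl[OF S'.vector_space_axioms]]];
      intro bilinear_on_sum bilinear_on_scalar1 vector_space_fscl S'.vector_space_axioms
        linear_on_compose[OF S.bf_linear(1) S.hp_linear] S.bf_linear
        linear_on_compose[OF S'.tt_linear(1) S'.hp_linear] S'.tt_linear)+

lemma act_tri_0:
  "d \<in> gr (tri S) p \<Longrightarrow> act S S' (d i) 0 = 0" "d' \<in> gr (tri S') p \<Longrightarrow> act' S S' (d' i) 0 = 0"
  using act_0(1)[OF S.Endo_linear[OF S.tri_in_Endo]] act'_0(1)[OF S'.tri_in_Endo] by auto

lemma ghalf_0:
  assumes "X \<in> ggr S S' p"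
  shows "ghalf S S' 0 X = 0" "ghalf S S' X 0 = 0"
  using assms
  by (auto simp: ggr_def ghalf_def zero_prod_def zero_fun_def[symmetric] act_0(2) act'_0(2) tprod_tens(2,3)
      act_tri_0)

lemma fscl_zero:
  "fscl (fscl (scl S)) c 0 = 0" "fscl (fscl (scl S')) c 0 = 0"
  "fscl (fscl ((*) :: 'k \<Rightarrow> 'k \<Rightarrow> 'k)) c 0 = 0"
  by (simp_all add: fscl_def fun_eq_iff)

lemma gscl_0: "gscl S S' c 0 = 0"
  by (simp add: gscl_def zero_prod_def fscl_def fun_eq_iff)

lemma gbracket_homogeneous:
  assumes X: "X \<in> ggr S S' p" and Y: "Y \<in> ggr S S' q"
  shows "gbracket S S' X Y =
     (case X of (d, d', u) \<Rightarrow> case Y of (e, e', v) \<Rightarrow>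
       (mul (tri S) d e + (\<Sum>i\<in>UNIV. theta_pow i (diag S S' (u i) (v i))),
        mul (tri S') d' e' + (\<Sum>i\<in>UNIV. theta_pow i (diag' S S' (u i) (v i))),
        0))
     + ghalf S S' X Y - gscl S S' (sg (p * q)) (ghalf S S' Y X)"
  unfolding gbracket_def ggr_hp[OF X] ggr_hp[OF Y]
  by (cases p; cases q) (simp_all add: ghalf_0[OF X] ghalf_0[OF Y] ghalf_0[OF ggr_0] gscl_0)

lemma theta_pow_0: "theta_pow i 0 = 0"
  by (simp add: theta_pow_def fun_eq_iff)

text \<open>
  These are the brackets by which \<open>\<gg>(S, S')\<close> is usually introduced; \<open>gbracket\<close> is their unique
  super-anticommutative bilinear extension.
\<close>

lemma gbracket_gtri_gtri:
  assumes d: "d \<in> gr (tri S) p" "e \<in> gr (tri S) q" and d': "d' \<in> gr (tri S') p" "e' \<in> gr (tri S') q"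
  shows "gbracket S S' (gtri d) (gtri e) = gtri (mul (tri S) d e)"
    and "gbracket S S' (gtri' d') (gtri' e') = gtri' (mul (tri S') d' e')"
    and "gbracket S S' (gtri d) (gtri' e') = 0"
  using S.tri_mul_0[OF d(1)] S.tri_mul_0[OF S.tri_0] S'.tri_mul_0[OF d'(2)] S'.tri_mul_0[OF S'.tri_0]
  unfolding gbracket_homogeneous[OF gtri_in_ggr(1)[OF d(1)] gtri_in_ggr(1)[OF d(2)]]
    gbracket_homogeneous[OF gtri_in_ggr(2)[OF d'(1)] gtri_in_ggr(2)[OF d'(2)]]
    gbracket_homogeneous[OF gtri_in_ggr(1)[OF d(1)] gtri_in_ggr(2)[OF d'(2)]]
  unfolding gtri_def gtri'_def ghalf_def prod.case
  by (simp_all add: gscl_def zero_prod_def zero_fun_def[symmetric] act_0(2) act'_0(2) tprod_tens(2,3)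
      diag_tens(2,3) diag'_tens(2,3) theta_pow_0 fscl_zero act_tri_0(1)[OF d(1)] act_tri_0(1)[OF d(2)]
      act_tri_0(2)[OF d'(1)] act_tri_0(2)[OF d'(2)])

lemma gbracket_gtri_giota:
  assumes d: "d \<in> gr (tri S) p" and x: "x \<in> gr S q" and x': "x' \<in> gr S' q'"
  shows "gbracket S S' (gtri d) (giota i (tens S S' x x')) = giota i (tens S S' (d i x) x')"
  unfolding gbracket_homogeneous[OF gtri_in_ggr(1)[OF d] giota_in_ggr[OF tens_in_tgr[OF x x']]]
  unfolding gtri_def giota_def ghalf_def prod.case
  by (auto simp: gscl_def zero_prod_def zero_fun_def[symmetric] act_0(2) act'_0(2) tprod_tens(2,3)
      diag_tens(2,3) diag'_tens(2,3) theta_pow_0 fscl_zero act_tri_0(1)[OF d]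
      act_tens[OF S.Endo_linear[OF S.tri_in_Endo[OF d]]] S.tri_mul_0[OF d] S'.tri_mul_0[OF S'.tri_0])

lemma gbracket_gtri'_giota:
  assumes d: "d \<in> gr (tri S') p" and x: "x \<in> gr S q" and x': "x' \<in> gr S' q'"
  shows "gbracket S S' (gtri' d) (giota i (tens S S' x x'))
    = giota i (fscl (*) (sg (p * q)) (tens S S' x (d i x')))"
  unfolding gbracket_homogeneous[OF gtri_in_ggr(2)[OF d] giota_in_ggr[OF tens_in_tgr[OF x x']]]
  unfolding gtri'_def giota_def ghalf_def prod.case
  by (auto simp: gscl_def zero_prod_def zero_fun_def[symmetric] act_0(2) act'_0(2) tprod_tens(2,3)
      diag_tens(2,3) diag'_tens(2,3) theta_pow_0 fscl_zero act_tri_0(2)[OF d]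
      act'_tens[OF S'.tri_in_Endo[OF d] x] S'.tri_mul_0[OF d] S.tri_mul_0[OF S.tri_0])

lemma gbracket_giota_next:
  assumes x: "x \<in> gr S p" "x' \<in> gr S' p'" and y: "y \<in> gr S q" "y' \<in> gr S' q'"
  shows "gbracket S S' (giota i (tens S S' x x')) (giota (i + 1) (tens S S' y y'))
    = giota (i + 2) (fscl (*) (sg (p' * q)) (tens S S' (mul S x y) (mul S' x' y')))"
proof -
  have t: "tprod S S' (tens S S' x x') (tens S S' y y')
      = fscl (*) (sg (p' * q)) (tens S S' (mul S x y) (mul S' x' y'))"
    by (cases p'; cases q) (auto simp: tprod_tens(1) S.hp[OF y(1)] S'.hp[OF x(2)] tens_0
        linear_on_0[OF S.mul_linear(1)] linear_on_0[OF S'.mul_linear(2)])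
  have i: "j + 1 = i \<longleftrightarrow> j = i + 2" "j + 2 = i + 1 \<longleftrightarrow> j = i + 2" "\<not> (j + 1 = i + 1 \<and> j + 2 = i)" for j :: 3
  proof -
    have e: "j + 1 + 2 = j" "i + 2 + 1 = i" "j + 2 + 2 = j + 1" "i + 2 + 2 = i + 1"
      by (simp_all add: add.assoc)
    show "j + 1 = i \<longleftrightarrow> j = i + 2"
      using e by auto
    show "j + 2 = i + 1 \<longleftrightarrow> j = i + 2"
      using e by (metis add_right_cancel)
    show "\<not> (j + 1 = i + 1 \<and> j + 2 = i)"
      by auto
  qed
  have t': "tprod S S' (if j + 1 = i + 1 then tens S S' y y' else 0) (if j + 2 = i then tens S S' x x' else 0) = 0" for j
    using i(3)[of j] by (simp add: tprod_tens(2,3))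
  have g: "diag S S' (if j = i then tens S S' x x' else 0) (if j = i + 1 then tens S S' y y' else 0) = 0"
    "diag' S S' (if j = i then tens S S' x x' else 0) (if j = i + 1 then tens S S' y y' else 0) = 0" for j
    by (simp_all add: diag_tens(2,3) diag'_tens(2,3))
  show ?thesis
    unfolding gbracket_homogeneous[OF giota_in_ggr[OF tens_in_tgr[OF x]] giota_in_ggr[OF tens_in_tgr[OF y]]]
    unfolding giota_def ghalf_def prod.case act_0(2) act'_0(2) add_0_left t' g theta_pow_0
    by (auto simp: gscl_def zero_prod_def fun_eq_iff fscl_def act_0(2) act'_0(2) i t[unfolded fscl_def] tprod_tens(2,3)
        S.tri_mul_0[OF S.tri_0] S'.tri_mul_0[OF S'.tri_0])
qed

lemma gbracket_giota_same:
  assumes x: "x \<in> gr S p" "x' \<in> gr S' p'" and y: "y \<in> gr S q" "y' \<in> gr S' q'"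
  shows "gbracket S S' (giota i (tens S S' x x')) (giota i (tens S S' y y'))
    = gtri (fscl (fscl (scl S)) (sg (p * p' + p * q' + q * q') * bf S' x' y') (theta_pow i (tt S x y)))
    + gtri' (fscl (fscl (scl S')) (sg (q * p') * bf S x y) (theta_pow i (tt S' x' y')))"
proof -
  interpret v: vector_space "fscl (fscl (scl S))"
    by (intro vector_space_fscl S.vector_space_axioms)
  interpret v': vector_space "fscl (fscl (scl S'))"
    by (intro vector_space_fscl S'.vector_space_axioms)
  have t: "diag S S' (tens S S' x x') (tens S S' y y')
      = fscl (fscl (scl S)) (sg (p * p' + p * q' + q * q') * bf S' x' y') (tt S x y)"
    by (cases p; cases p'; cases q; cases q') (auto simp: diag_tens(1) S.hp[OF x(1)] S.hp[OF y(1)]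
        S'.hp[OF x(2)] S'.hp[OF y(2)] linear_on_0[OF S'.bf_linear(1)] linear_on_0[OF S'.bf_linear(2)]
        linear_on_0[OF S.tt_linear(1)] linear_on_0[OF S.tt_linear(2)])
  have t': "diag' S S' (tens S S' x x') (tens S S' y y')
      = fscl (fscl (scl S')) (sg (q * p') * bf S x y) (tt S' x' y')"
    by (cases p'; cases q) (auto simp: diag'_tens(1) S.hp[OF y(1)] S'.hp[OF x(2)]
        linear_on_0[OF S.bf_linear(1)] linear_on_0[OF S'.tt_linear(1)])
  have i: "\<not> (j + 1 = i \<and> j + 2 = i)" for j :: 3
    by (metis add_left_cancel one_neq_zero numeral_eq_one_iff add_cancel_left_left one_add_one)
  have z: "tprod S S' (if j + 1 = i then a else 0) (if j + 2 = i then b else 0) = 0" for j a b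
    using i[of j] by (auto simp: tprod_tens(2,3))
  have s: "(\<Sum>j\<in>UNIV. theta_pow j (diag S S' (if j = i then tens S S' x x' else 0) (if j = i then tens S S' y y' else 0)))
      = theta_pow i (diag S S' (tens S S' x x') (tens S S' y y'))"
    "(\<Sum>j\<in>UNIV. theta_pow j (diag' S S' (if j = i then tens S S' x x' else 0) (if j = i then tens S S' y y' else 0)))
      = theta_pow i (diag' S S' (tens S S' x x') (tens S S' y y'))"
    by (subst sum.mono_neutral_right[where S = "{i}"]; auto simp: diag_tens(2) diag'_tens(2) theta_pow_0)+
  show ?thesis
    unfolding gbracket_homogeneous[OF giota_in_ggr[OF tens_in_tgr[OF x]] giota_in_ggr[OF tens_in_tgr[OF y]]]
    unfolding giota_def ghalf_def prod.case act_0(2) act'_0(2) add_0_left z s t t' gtri_def gtri'_def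
    by (auto simp: gscl_def zero_prod_def fun_eq_iff fscl_def theta_pow_def act_0(2) act'_0(2)
        S.tri_mul_0[OF S.tri_0] S'.tri_mul_0[OF S'.tri_0])
qed

end


section \<open>The Jordan superalgebra \<open>H\<^sub>3(C, *)\<close>\<close>

text \<open>
  Rows and columns are numbered by the type \<open>3\<close>: the matrix position \<open>(r, s)\<close> with \<open>1 \<le> r, s \<le> 3\<close>
  is \<open>(r - 1, s - 1)\<close> here. Thus \<open>e\<^sub>i\<close> is the diagonal matrix unit at \<open>(i, i)\<close>, and the three
  formulas for \<open>\<iota>\<^sub>i(a)\<close> become \<open>2 (hconj C a E\<^bsub>i+1,i+2\<^esub> + a E\<^bsub>i+2,i+1\<^esub>)\<close>.
\<close>

type_synonym 'v mat3 = "3 \<Rightarrow> 3 \<Rightarrow> 'v"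

definition munit :: "3 \<Rightarrow> 3 \<Rightarrow> 'v::ab_group_add \<Rightarrow> 'v mat3" where
  "munit r s x = (\<lambda>i j. if i = r \<and> j = s then x else 0)"

definition mmul :: "('k, 'v::ab_group_add, 'z) unital_qsalg_scheme \<Rightarrow> 'v mat3 \<Rightarrow> 'v mat3 \<Rightarrow> 'v mat3" where
  "mmul C X Y = (\<lambda>i j. \<Sum>l\<in>UNIV. mul C (X i l) (Y l j))"

definition mstar :: "('k, 'v::ab_group_add, 'z) unital_qsalg_scheme \<Rightarrow> 'v mat3 \<Rightarrow> 'v mat3" where
  "mstar C X = (\<lambda>i j. hconj C (X j i))"

definition mgr :: "('k, 'v::ab_group_add, 'z) unital_qsalg_scheme \<Rightarrow> bit \<Rightarrow> 'v mat3 set" where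
  "mgr C p = {X. \<forall>i j. X i j \<in> gr C p}"

definition H3 :: "('k::field, 'v::ab_group_add, 'z) unital_qsalg_scheme \<Rightarrow> ('k, 'v mat3) salg" where
  "H3 C = \<lparr> scl = fscl (fscl (scl C)),
            gr = (\<lambda>p. {X \<in> mgr C p. mstar C X = X}),
            mul = (\<lambda>X Y. fscl (fscl (scl C)) (1 / 2) (mmul C X Y +
                    (\<Sum>p\<in>{0, 1}. \<Sum>q\<in>{0, 1}.
                      fscl (fscl (scl C)) (sg (p * q)) (mmul C (hpart (mgr C) q Y) (hpart (mgr C) p X))))) \<rparr>"

definition je :: "('k, 'v::ab_group_add, 'z) unital_qsalg_scheme \<Rightarrow> 3 \<Rightarrow> 'v mat3" where
  "je C i = munit i i (uone C)"

definition jiota :: "('k::field, 'v::ab_group_add, 'z) unital_qsalg_scheme \<Rightarrow> 3 \<Rightarrow> 'v \<Rightarrow> 'v mat3" where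
  "jiota C i a = fscl (fscl (scl C)) 2 (munit (i + 1) (i + 2) (hconj C a) + munit (i + 2) (i + 1) a)"

text \<open>
  The linear map on \<open>J\<close> with \<open>e\<^sub>i \<mapsto> 0\<close> and \<open>\<iota>\<^sub>i(a) \<mapsto> \<iota>\<^sub>i(d\<^sub>i(a))\<close>: the \<open>\<iota>\<^sub>i\<close>-coordinate of \<open>X\<close> is half
  of its entry at \<open>(i + 2, i + 1)\<close>. See \<open>Dtri_je\<close> and \<open>Dtri_jiota\<close> below.
\<close>

definition Dtri :: "('k::field, 'v::ab_group_add, 'z) unital_qsalg_scheme \<Rightarrow> (3 \<Rightarrow> 'v \<Rightarrow> 'v) \<Rightarrow> 'v mat3 \<Rightarrow> 'v mat3" where
  "Dtri C d X = (if X \<in> scarrier (H3 C)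
     then \<Sum>i\<in>UNIV. jiota C i (d i (scl C (1 / 2) (X (i + 2) (i + 1)))) else 0)"

context
  fixes C :: "('k::field, 'v::ab_group_add, 'z) unital_qsalg_scheme"
  assumes C: "hurwitz_superalgebra C" and full: "scarrier C = UNIV"
begin

lemma hurwitz_vector_space: "vector_space (scl C)"
  and hurwitz_subspace: "module.subspace (scl C) (gr C p)"
  and hurwitz_decomp: "\<exists>y\<in>gr C 0. \<exists>z\<in>gr C 1. x = y + z"
  and hurwitz_disjoint: "x \<in> gr C 0 \<Longrightarrow> x \<in> gr C 1 \<Longrightarrow> x = 0"
  and hurwitz_mul_gr: "x \<in> gr C p \<Longrightarrow> y \<in> gr C q \<Longrightarrow> mul C x y \<in> gr C (p + q)"
  and hurwitz_mul_add: "mul C x (y + z) = mul C x y + mul C x z" "mul C (x + y) z = mul C x z + mul C y z"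
  and hurwitz_bf_add: "bf C (x + y) z = bf C x z + bf C y z"
  and hurwitz_bf_scl: "bf C (scl C c x) z = c * bf C x z"
  and hurwitz_bf_even: "x \<in> gr C p \<Longrightarrow> y \<in> gr C q \<Longrightarrow> p \<noteq> q \<Longrightarrow> bf C x y = 0"
  and hurwitz_unit: "mul C (uone C) x = x" "mul C x (uone C) = x"
proof -
  show "vector_space (scl C)" "module.subspace (scl C) (gr C p)"
    "mul C x (y + z) = mul C x y + mul C x z" "mul C (x + y) z = mul C x z + mul C y z"
    "bf C (x + y) z = bf C x z + bf C y z" "bf C (scl C c x) z = c * bf C x z"
    "mul C (uone C) x = x" "mul C x (uone C) = x"
    using C full
    by (auto simp: hurwitz_superalgebra_def composition_superalgebra_def superalgebra_def superspace_def
        quadratic_superform_def bilinear_on_def linear_on_def)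
  show "x \<in> gr C p \<Longrightarrow> y \<in> gr C q \<Longrightarrow> mul C x y \<in> gr C (p + q)"
    using C by (auto simp: hurwitz_superalgebra_def composition_superalgebra_def superalgebra_def)
  show "x \<in> gr C p \<Longrightarrow> y \<in> gr C q \<Longrightarrow> p \<noteq> q \<Longrightarrow> bf C x y = 0"
    using C by (auto simp: hurwitz_superalgebra_def composition_superalgebra_def quadratic_superform_def)
  show "\<exists>y\<in>gr C 0. \<exists>z\<in>gr C 1. x = y + z"
    using full unfolding scarrier_def gsum_def by blast
  show "x \<in> gr C 0 \<Longrightarrow> x \<in> gr C 1 \<Longrightarrow> x = 0"
    using C unfolding hurwitz_superalgebra_def composition_superalgebra_def superalgebra_def superspace_def by blast
qed

lemma hurwitz_unit_even: "uone C \<in> gr C 0"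
proof -
  interpret vector_space "scl C" by (rule hurwitz_vector_space)
  obtain u v where u: "u \<in> gr C 0" and v: "v \<in> gr C 1" and uv: "uone C = u + v"
    using hurwitz_decomp by blast
  have e: "mul C x v = 0" if x: "x \<in> gr C 0" for x
  proof -
    have "x = mul C x u + mul C x v"
      using hurwitz_unit(2)[of x] by (simp add: uv hurwitz_mul_add)
    then have "mul C x v = x - mul C x u"
      by (simp add: algebra_simps)
    moreover have "x - mul C x u \<in> gr C 0"
      using hurwitz_mul_gr[OF x u] x by (simp add: subspace_diff hurwitz_subspace)
    moreover have "mul C x v \<in> gr C 1"
      using hurwitz_mul_gr[OF x v] by simp
    ultimately show ?thesis
      using hurwitz_disjoint by metis
  qed
  have o: "mul C x v = 0" if x: "x \<in> gr C 1" for x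
  proof -
    have "x = mul C x u + mul C x v"
      using hurwitz_unit(2)[of x] by (simp add: uv hurwitz_mul_add)
    then have "mul C x v = x - mul C x u"
      by (simp add: algebra_simps)
    moreover have "x - mul C x u \<in> gr C 1"
      using hurwitz_mul_gr[OF x u] x by (simp add: subspace_diff hurwitz_subspace)
    moreover have "mul C x v \<in> gr C 0"
      using hurwitz_mul_gr[OF x v] by simp
    ultimately show ?thesis
      using hurwitz_disjoint by metis
  qed
  have "v = mul C u v + mul C v v"
    using hurwitz_unit(1)[of v] by (simp add: uv hurwitz_mul_add)
  then show ?thesis
    using e[OF u] o[OF v] u uv by simp
qed

lemma hurwitz_bf_unit: "scl C (bf C (uone C) (uone C)) (uone C) = scl C 2 (uone C)"
proof (cases "uone C = 0")
  case True
  interpret vector_space "scl C" by (rule hurwitz_vector_space)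
  show ?thesis
    by (simp add: True)
next
  case False
  interpret vector_space "scl C" by (rule hurwitz_vector_space)
  note c = C[unfolded hurwitz_superalgebra_def composition_superalgebra_def]
  obtain y where "y \<in> gr C 0" and ne: "bf C (uone C) y \<noteq> 0"
    using c False hurwitz_unit_even unfolding regular_superform_def by metis
  moreover have "bf C (mul C (uone C) (uone C)) (mul C (uone C) y) = qf C (uone C) * bf C (uone C) y"
    using c hurwitz_unit_even unfolding full by blast
  ultimately have q: "qf C (uone C) = 1"
    by (simp add: hurwitz_unit)
  have q2: "qf C (scl C 2 (uone C)) = 2\<^sup>2 * qf C (uone C)"
    and b: "bf C (uone C) (uone C) = qf C (uone C + uone C) - qf C (uone C) - qf C (uone C)"
    using c hurwitz_unit_even unfolding quadratic_superform_def by blast+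
  have "scl C 2 (uone C) = uone C + uone C"
    using scale_left_distrib[of 1 1 "uone C"] by simp
  then have "bf C (uone C) (uone C) = 2"
    using b q2 q by simp
  then show ?thesis
    by simp
qed

lemma hconj_linear: "linear_on (scl C) (scl C) UNIV (hconj C)"
proof -
  interpret vector_space "scl C" by (rule hurwitz_vector_space)
  show ?thesis
    by (simp add: linear_on_def hconj_def hurwitz_bf_add hurwitz_bf_scl scale_left_distrib
        scale_right_diff_distrib)
qed

lemma hconj_hconj: "hconj C (hconj C x) = x"
proof -
  interpret vector_space "scl C" by (rule hurwitz_vector_space)
  have "hconj C (hconj C x) + hconj C x = scl C (bf C (hconj C x) (uone C)) (uone C)"
    by (simp add: hconj_def)
  moreover have "bf C (hconj C x) (uone C) = bf C x (uone C) * bf C (uone C) (uone C) - bf C x (uone C)"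
    using hurwitz_bf_add[of "hconj C x" x "uone C"] hurwitz_bf_scl[of "bf C x (uone C)" "uone C" "uone C"]
    by (simp add: hconj_def algebra_simps)
  ultimately have "hconj C (hconj C x) + hconj C x
      = scl C (bf C x (uone C)) (scl C (bf C (uone C) (uone C)) (uone C)) - scl C (bf C x (uone C)) (uone C)"
    by (simp add: scale_left_diff_distrib)
  also have "\<dots> = scl C (bf C x (uone C)) (uone C)"
    unfolding hurwitz_bf_unit
    by (simp add: algebra_simps flip: scale_left_distrib scale_left_diff_distrib scale_right_diff_distrib)
  finally show ?thesis
    by (simp add: hconj_def)
qed

lemma hconj_gr: "x \<in> gr C p \<Longrightarrow> hconj C x \<in> gr C p"
proof -
  interpret vector_space "scl C" by (rule hurwitz_vector_space)
  assume x: "x \<in> gr C p"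
  have "scl C (bf C x (uone C)) (uone C) \<in> gr C p"
    using hurwitz_bf_even[OF x hurwitz_unit_even] hurwitz_unit_even
    by (cases p) (auto simp: subspace_scale subspace_0 hurwitz_subspace)
  then show ?thesis
    using x by (simp add: hconj_def subspace_diff hurwitz_subspace)
qed

lemma jiota_gr: "a \<in> gr C p \<Longrightarrow> jiota C i a \<in> gr (H3 C) p"
proof -
  interpret vector_space "scl C" by (rule hurwitz_vector_space)
  assume a: "a \<in> gr C p"
  have 0: "hconj C 0 = 0" and s: "hconj C (scl C c x) = scl C c (hconj C x)" for c x
    using hconj_linear by (auto simp: linear_on_def) (metis add_cancel_left_left)
  have "i + 1 \<noteq> i + 2"
    by simp
  then show ?thesis
    using a hconj_gr[OF a]
    by (auto simp: H3_def mgr_def jiota_def fscl_def munit_def mstar_def fun_eq_iff hconj_hconj 0 s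
        subspace_scale subspace_0 hurwitz_subspace)
qed

lemma jiota_carrier: "jiota C i a \<in> scarrier (H3 C)"
proof -
  interpret vector_space "scl C" by (rule hurwitz_vector_space)
  obtain x y where x: "x \<in> gr C 0" and y: "y \<in> gr C 1" and a: "a = x + y"
    using hurwitz_decomp by blast
  have "hconj C a = hconj C x + hconj C y"
    using hconj_linear by (simp add: linear_on_def a)
  then have "jiota C i a = jiota C i x + jiota C i y"
    by (auto simp: jiota_def fscl_def munit_def fun_eq_iff a scale_right_distrib)
  then show ?thesis
    using jiota_gr[OF x] jiota_gr[OF y] by (auto simp: scarrier_def gsum_def)
qed

lemma Dtri_je:
  assumes "\<And>j. linear_on (scl C) (scl C) UNIV (d j)"
  shows "Dtri C d (je C i) = 0"
proof -
  interpret vector_space "scl C" by (rule hurwitz_vector_space)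
  have "d j 0 = 0" for j
    using assms[of j] by (auto simp: linear_on_def) (metis add_cancel_left_left)
  moreover have "jiota C j 0 = 0" for j
    using hconj_linear
    by (auto simp: linear_on_def jiota_def fscl_def munit_def fun_eq_iff) (metis add_cancel_left_left)
  moreover have "je C i (j + 2) (j + 1) = 0" for j
    by (auto simp: je_def munit_def)
  ultimately show ?thesis
    by (simp add: Dtri_def)
qed

lemma Dtri_jiota:
  assumes "\<And>j. linear_on (scl C) (scl C) UNIV (d j)" and two: "(2::'k) \<noteq> 0"
  shows "Dtri C d (jiota C i a) = jiota C i (d i a)"
proof -
  interpret vector_space "scl C" by (rule hurwitz_vector_space)
  have d0: "d j 0 = 0" for j
    using assms(1)[of j] by (auto simp: linear_on_def) (metis add_cancel_left_left)
  have j0: "jiota C j 0 = 0" for j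
    using hconj_linear
    by (auto simp: linear_on_def jiota_def fscl_def munit_def fun_eq_iff) (metis add_cancel_left_left)
  have "j + 2 \<noteq> j + 1" and "\<not> (j + 2 = i + 1 \<and> j + 1 = i + 2)" for j :: 3
  proof -
    show "j + 2 \<noteq> j + 1" by simp
    show "\<not> (j + 2 = i + 1 \<and> j + 1 = i + 2)"
    proof
      assume *: "j + 2 = i + 1 \<and> j + 1 = i + 2"
      then have "i = j + 1" and "j = i + 1"
        by (auto simp: algebra_simps)
      then have "j = j + 2"
        by (simp add: add.assoc)
      then show False
        by simp
    qed
  qed
  then have "scl C (1 / 2) (jiota C i a (j + 2) (j + 1)) = (if j = i then a else 0)" for j
    using two by (auto simp: jiota_def fscl_def munit_def)
  then have "jiota C j (d j (scl C (1 / 2) (jiota C i a (j + 2) (j + 1))))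
      = (if j = i then jiota C i (d i a) else 0)" for j
    by (simp add: d0 j0)
  then show ?thesis
    by (simp add: Dtri_def jiota_carrier)
qed

end

definition Diota :: "('k::field, 'v::ab_group_add, 'z) unital_qsalg_scheme \<Rightarrow> 3 \<Rightarrow> 'v \<Rightarrow> 'v mat3 \<Rightarrow> 'v mat3" where
  "Diota C i a = fscl (scl (H3 C)) 2
     (scomm (H3 C) (Lmul (H3 C) (jiota C i a)) (Lmul (H3 C) (je C (i + 1))))"


section \<open>The map\<close>

text \<open>
  The defining property of the map \<open>\<Phi>\<close>. As \<open>tri S\<^sub>1 = 0\<close>, the listed elements span \<open>\<gg>(S\<^sub>1, S)\<close>.
\<close>

definition is_Phi :: "('k::field, 'v::ab_group_add, 'z) unital_qsalg_scheme \<Rightarrow>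
    (('k, 'k, 'v) gelem \<Rightarrow> 'v mat3 \<Rightarrow> 'v mat3) \<Rightarrow> bool" where
  "is_Phi C \<Phi> \<longleftrightarrow>
     linear_on (scl (galg S1 (para C))) (scl (der (H3 C))) (scarrier (galg S1 (para C))) \<Phi>
     \<and> \<Phi> ` scarrier (galg S1 (para C)) \<subseteq> scarrier (der (H3 C))
     \<and> (\<forall>d\<in>scarrier (tri (para C)). \<Phi> (gtri' d) = Dtri C d)
     \<and> (\<forall>i. \<forall>a\<in>scarrier (para C). \<Phi> (giota i (tens S1 (para C) 1 a)) = Diota C i a)"

end

theory Submission
  imports Defs
begin

text \<open>
  Why the theorem is true. The Peirce decomposition of \<open>J = H\<^sub>3(C, *)\<close> with respect to the idempotents
  \<open>e\<^sub>0, e\<^sub>1, e\<^sub>2\<close> consists of the diagonal and of three copies \<open>\<iota>\<^sub>i(S)\<close> of the para-Hurwitz superalgebra \<open>S\<close>,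
  and it has a simple multiplication table (\<open>jtable\<close>). A derivation is determined by two pieces of data:
  what it does to the \<open>e\<^sub>i\<close>, and what is left after these values have been subtracted.
  
  A derivation which kills the \<open>e\<^sub>i\<close> commutes with their multiplications, so it preserves each
  \<open>\<iota>\<^sub>i(S)\<close> and is given there by three operators \<open>d\<^sub>i\<close>. The products \<open>\<iota>\<^sub>i(a) \<circ> \<iota>\<^sub>i(b)\<close> say that \<open>d\<^sub>i\<close> is
  skew, the products \<open>\<iota>\<^sub>i(a) \<circ> \<iota>\<^sub>i\<^sub>+\<^sub>1(b)\<close> are the triality condition. So these derivations are exactly the
  \<open>D\<^sub>d\<close> with \<open>d \<in> tri S\<close> (\<open>Dtri_der\<close>, \<open>derivation_killing_idempotents\<close>). For an arbitrary derivation,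
  the relations \<open>e\<^sub>i \<circ> e\<^sub>j = \<delta>\<^sub>i\<^sub>j e\<^sub>i\<close> leave one free parameter in each \<open>\<iota>\<^sub>i(S)\<close> for the values on the \<open>e\<^sub>i\<close>,
  and \<open>\<Sum>\<^sub>i D\<^sub>i(a\<^sub>i)\<close> takes precisely these values. Hence
  every derivation is \<open>D\<^sub>d + \<Sum>\<^sub>i D\<^sub>i(a\<^sub>i)\<close> (\<open>derivation_decomposition\<close>), and \<open>d\<close> and the \<open>a\<^sub>i\<close> can be read off
  from its values (\<open>phi_kernel\<close>). As \<open>tri S\<^sub>1 = 0\<close> and \<open>S\<^sub>1 \<otimes> S = S\<close>, the same data \<open>(d, a)\<close> are coordinates on
  \<open>\<gg>(S\<^sub>1, S)\<close>, so \<open>\<Phi>\<close> is bijective.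
  
  That the \<open>D\<^sub>i(a)\<close> are derivations, and that the brackets of these operators are the ones which define
  \<open>\<gg>(S\<^sub>1, S)\<close>, is checked on generators of \<open>J\<close> (\<open>D_der\<close>, \<open>bracket_Dtri_D\<close>, \<open>bracket_D_next\<close>,
  \<open>bracket_D_same\<close>). Everything comes down to two properties of the para-Hurwitz product: its form is
  associative (\<open>form_assoc\<close>), and \<open>x (y x) = q(x) y = (x y) x\<close> in linearised form (\<open>symmetric_composition\<close>). Both
  follow from the composition law.
  
  The axioms for \<open>\<gg>(S\<^sub>1, S)\<close> are not verified separately: the derivations form a Lie superalgebra, and
  the injective homomorphism \<open>\<Phi>\<close> pulls its axioms back (\<open>lie_superalgebra_pullback\<close>). In the same way,
  closure of \<open>tri S\<close> under brackets and \<open>t\<^sub>a\<^sub>,\<^sub>b \<in> tri S\<close> are seen inside the derivations.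
\<close>

(* Signs are settled by case distinction on parities; rewriting sums and products of bits into
   bitwise operations would break up the expressions p + q and p * q in which they are stated. *)
declare add_bit_eq_xor [simp del] mult_bit_eq_and [simp del]

section \<open>Homogeneous components\<close>

text \<open>
  The pair of homogeneous subspaces of a superspace. All the superspaces below (the algebras, their
  endomorphisms, matrices, triples of operators) are instances, so that \<open>hpart\<close> has to be
  analysed only once.
\<close>

locale graded_space = vector_space s for s :: "'k::field \<Rightarrow> 'v::ab_group_add \<Rightarrow> 'v" +
  fixes V :: "bit \<Rightarrow> 'v set"
  assumes sub: "subspace (V p)" and disj: "x \<in> V 0 \<Longrightarrow> x \<in> V 1 \<Longrightarrow> x = 0"
begin

lemma hpart_hom: "x \<in> V q \<Longrightarrow> hpart V p x = (if p = q then x else 0)"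
  using sub disj by (intro hpart_homogeneous) (auto simp: subspace_diff subspace_0)

lemma hpart_sum2:
  assumes x: "x \<in> V 0" and y: "y \<in> V 1"
  shows "hpart V p (x + y) = (if p = 0 then x else y)"
  unfolding hpart_def
proof (rule the_equality)
  show "(if p = 0 then x else y) \<in> V p \<and> x + y - (if p = 0 then x else y) \<in> V (p + 1)"
    using x y by (cases p) simp_all
next
  fix z assume z: "z \<in> V p \<and> x + y - z \<in> V (p + 1)"
  show "z = (if p = 0 then x else y)"
  proof (cases "p = 0")
    case True
    then have "x - z \<in> V 0" "(x + y - z) - y \<in> V 1"
      using z x y subspace_diff[OF sub, of "x + y - z" 1 y] by (simp_all add: subspace_diff[OF sub])
    then show ?thesis
      using disj[of "x - z"] True by (simp add: algebra_simps)
  next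
    case False
    then have p: "p = 1" by simp
    then have "y - z \<in> V 1" "(x + y - z) - x \<in> V 0"
      using z x y subspace_diff[OF sub, of "x + y - z" 0 x] by (simp_all add: subspace_diff[OF sub])
    then show ?thesis
      using disj[of "y - z"] p by (simp add: algebra_simps)
  qed
qed

lemma gsumE:
  assumes "x \<in> gsum V"
  obtains y z where "y \<in> V 0" "z \<in> V 1" "x = y + z"
  using assms by (auto simp: gsum_def)

lemma gsumI: "x \<in> V 0 \<Longrightarrow> y \<in> V 1 \<Longrightarrow> x + y \<in> gsum V"
  by (auto simp: gsum_def)

lemma hom_gsum: "x \<in> V p \<Longrightarrow> x \<in> gsum V"
  using gsumI[of x 0] gsumI[of 0 x] subspace_0[OF sub] by (cases p) simp_all

lemma gsum_subspace: "subspace (gsum V)"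
proof (rule subspaceI)
  show "0 \<in> gsum V"
    using hom_gsum[OF subspace_0[OF sub]] .
next
  fix x y assume "x \<in> gsum V" "y \<in> gsum V"
  then obtain a b c d where "a \<in> V 0" "b \<in> V 1" "x = a + b" "c \<in> V 0" "d \<in> V 1" "y = c + d"
    by (metis gsumE)
  then have "(a + c) + (b + d) \<in> gsum V" "x + y = (a + c) + (b + d)"
    using subspace_add[OF sub] by (auto intro!: gsumI)
  then show "x + y \<in> gsum V" by simp
next
  fix c x assume "x \<in> gsum V"
  then obtain y z where "y \<in> V 0" "z \<in> V 1" "x = y + z"
    by (rule gsumE)
  then show "s c x \<in> gsum V"
    using gsumI[OF subspace_scale[OF sub] subspace_scale[OF sub]] by (simp add: scale_right_distrib)
qed

lemma hpart_in: "x \<in> gsum V \<Longrightarrow> hpart V p x \<in> V p"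
  by (erule gsumE, cases p) (simp_all add: hpart_sum2)

lemma hpart_decomp: "x \<in> gsum V \<Longrightarrow> x = hpart V 0 x + hpart V 1 x"
  by (erule gsumE) (simp add: hpart_sum2)

lemma hpart_add:
  assumes "x \<in> gsum V" "y \<in> gsum V"
  shows "hpart V p (x + y) = hpart V p x + hpart V p y"
proof -
  obtain a b c d where "a \<in> V 0" "b \<in> V 1" "x = a + b" "c \<in> V 0" "d \<in> V 1" "y = c + d"
    using assms by (metis gsumE)
  moreover from this have "x + y = (a + c) + (b + d)" "a + c \<in> V 0" "b + d \<in> V 1"
    using subspace_add[OF sub] by auto
  ultimately show ?thesis
    by (metis hpart_sum2)
qed

lemma hpart_scale:
  assumes "x \<in> gsum V"
  shows "hpart V p (s c x) = s c (hpart V p x)"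
proof -
  obtain a b where "a \<in> V 0" "b \<in> V 1" "x = a + b"
    using assms by (metis gsumE)
  moreover from this have "s c x = s c a + s c b" "s c a \<in> V 0" "s c b \<in> V 1"
    using subspace_scale[OF sub] by (auto simp: scale_right_distrib)
  ultimately show ?thesis
    by (simp add: hpart_sum2)
qed

end

lemma bit_add_self: "(1::bit) + 1 = 0"
  by simp

lemma sg_simps [simp]: "sg 0 = 1" "sg 1 = - 1"
  by (simp_all add: sg_def)

lemma sg_mult: "sg p * sg q = (sg (p + q) :: 'k::field)"
  by (cases p; cases q) simp_all

lemma sg_square [simp]: "sg p * sg p = (1 :: 'k::field)" "sg p * (sg p * c) = (c :: 'k::field)"
  by (cases p; simp)+


section \<open>The Lie superalgebra of derivations\<close>

text \<open>
  The underlying space may be a proper subspace \<open>carr\<close> of the ambient type, as it is for \<open>H\<^sub>3(C, *)\<close>. All laws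
  are therefore relative to \<open>carr\<close>, and operators vanish off it.
\<close>

locale super_algebra =
  fixes A :: "('k::field, 'v::ab_group_add, 'z) salg_scheme"
  assumes superalgebra: "superalgebra A"
begin

sublocale graded_space "scl A" "gr A"
  using superalgebra unfolding superalgebra_def superspace_def graded_space_def graded_space_axioms_def
  by blast

abbreviation "carr \<equiv> scarrier A"

lemma carr_gsum: "carr = gsum (gr A)"
  by (simp add: scarrier_def)

lemma carr_subspace: "subspace carr"
  using gsum_subspace by (simp add: carr_gsum)

lemma hom_carr: "x \<in> gr A p \<Longrightarrow> x \<in> carr"
  using hom_gsum by (simp add: carr_gsum)

lemmas carr_add = subspace_add[OF carr_subspace] and carr_scale = subspace_scale[OF carr_subspace]
  and carr_diff = subspace_diff[OF carr_subspace] and carr_neg = subspace_neg[OF carr_subspace]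
  and carr_0 = subspace_0[OF carr_subspace]

lemma mul_linear: "x \<in> carr \<Longrightarrow> linear_on (scl A) (scl A) carr (mul A x)"
    "y \<in> carr \<Longrightarrow> linear_on (scl A) (scl A) carr (\<lambda>x. mul A x y)"
  using superalgebra by (auto simp: superalgebra_def bilinear_on_def)

lemma mul_add:
  assumes "x \<in> carr" "y \<in> carr" "z \<in> carr"
  shows "mul A x (y + z) = mul A x y + mul A x z" "mul A (x + y) z = mul A x z + mul A y z"
  using mul_linear assms by (auto simp: linear_on_def)

lemma mul_scale:
  assumes "x \<in> carr" "y \<in> carr"
  shows "mul A x (scl A c y) = scl A c (mul A x y)" "mul A (scl A c x) y = scl A c (mul A x y)"
  using mul_linear assms by (auto simp: linear_on_def)

lemma mul_gr: "x \<in> gr A p \<Longrightarrow> y \<in> gr A q \<Longrightarrow> mul A x y \<in> gr A (p + q)"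
  using superalgebra by (auto simp: superalgebra_def)

lemma mul_carr:
  assumes "x \<in> carr" "y \<in> carr"
  shows "mul A x y \<in> carr"
proof -
  obtain a b c d where *: "a \<in> gr A 0" "b \<in> gr A 1" "x = a + b" "c \<in> gr A 0" "d \<in> gr A 1" "y = c + d"
    using assms by (metis gsumE carr_gsum)
  then show ?thesis
    by (simp add: mul_add carr_add hom_carr) (intro carr_add hom_carr[OF mul_gr])
qed

lemma mul_diff:
  assumes "x \<in> carr" "y \<in> carr" "z \<in> carr"
  shows "mul A x (y - z) = mul A x y - mul A x z" "mul A (x - y) z = mul A x z - mul A y z"
  using mul_add[of x "y - z" z] mul_add[of "x - y" y z] assms carr_diff by simp_all

lemma mul_0:
  assumes "x \<in> carr"
  shows "mul A x 0 = 0" "mul A 0 x = 0"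
  using mul_diff[of x 0 0] mul_diff[of 0 0 x] assms carr_0 by simp_all

lemma mul_neg:
  assumes "x \<in> carr" "y \<in> carr"
  shows "mul A x (- y) = - mul A x y" "mul A (- x) y = - mul A x y"
  using mul_diff[of x 0 y] mul_diff[of 0 x y] mul_0 assms carr_0 by simp_all

sublocale Op: vector_space "fscl (scl A) :: 'k \<Rightarrow> ('v \<Rightarrow> 'v) \<Rightarrow> 'v \<Rightarrow> 'v"
  by (rule vector_space_fscl[OF vector_space_axioms])

lemma EndoD:
  assumes "f \<in> Endo A p"
  shows "x \<in> carr \<Longrightarrow> y \<in> carr \<Longrightarrow> f (x + y) = f x + f y"
    "x \<in> carr \<Longrightarrow> f (scl A c x) = scl A c (f x)"
    "x \<notin> carr \<Longrightarrow> f x = 0" "x \<in> gr A q \<Longrightarrow> f x \<in> gr A (p + q)"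
  using assms by (auto simp: Endo_def linear_on_def)

lemma EndoI:
  assumes "\<And>x y. x \<in> carr \<Longrightarrow> y \<in> carr \<Longrightarrow> f (x + y) = f x + f y"
    "\<And>c x. x \<in> carr \<Longrightarrow> f (scl A c x) = scl A c (f x)"
    "\<And>x. x \<notin> carr \<Longrightarrow> f x = 0" "\<And>x q. x \<in> gr A q \<Longrightarrow> f x \<in> gr A (p + q)"
  shows "f \<in> Endo A p"
  using assms by (auto simp: Endo_def linear_on_def)

lemma Endo_subspace: "Op.subspace (Endo A p)"
proof (rule Op.subspaceI)
  show "0 \<in> Endo A p"
    by (rule EndoI) (auto simp: subspace_0[OF sub])
next
  fix f g assume "f \<in> Endo A p" "g \<in> Endo A p"
  then show "f + g \<in> Endo A p"
    by (intro EndoI)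
      (simp_all add: EndoD(1,2,3) algebra_simps, simp add: EndoD(4) subspace_add[OF sub] add.commute[of _ p])
next
  fix c f assume "f \<in> Endo A p"
  then show "fscl (scl A) c f \<in> Endo A p"
    by (intro EndoI)
      (simp_all add: EndoD fscl_def scale_right_distrib scale_scale mult.commute subspace_scale[OF sub])
qed

lemma Endo_disj:
  assumes f: "f \<in> Endo A 0" "f \<in> Endo A 1"
  shows "f = 0"
proof
  fix x
  have h: "f y = 0" if "y \<in> gr A q" for y q
    using EndoD(4)[OF f(1) that] EndoD(4)[OF f(2) that] disj by (cases q) auto
  show "f x = 0 x"
  proof (cases "x \<in> carr")
    case True
    then obtain y z where "y \<in> gr A 0" "z \<in> gr A 1" "x = y + z"
      by (metis gsumE carr_gsum)
    then show ?thesis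
      using h EndoD(1)[OF f(1), of y z] by (simp add: hom_carr)
  qed (simp add: EndoD[OF f(1)])
qed

sublocale E: graded_space "fscl (scl A)" "Endo A"
  by unfold_locales (use Endo_subspace Endo_disj in simp_all)

abbreviation "Ops \<equiv> gsum (Endo A)"

lemma OpsD:
  assumes "f \<in> Ops"
  shows "x \<in> carr \<Longrightarrow> y \<in> carr \<Longrightarrow> f (x + y) = f x + f y"
    "x \<in> carr \<Longrightarrow> f (scl A c x) = scl A c (f x)"
    "x \<notin> carr \<Longrightarrow> f x = 0" "x \<in> carr \<Longrightarrow> f x \<in> carr" "f 0 = 0"
proof -
  obtain g h where gh: "g \<in> Endo A 0" "h \<in> Endo A 1" "f = g + h"
    using assms by (metis E.gsumE)
  show a: "f (x + y) = f x + f y" if "x \<in> carr" "y \<in> carr" for x y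
    using that by (simp add: gh EndoD[OF gh(1)] EndoD[OF gh(2)])
  show "x \<in> carr \<Longrightarrow> f (scl A c x) = scl A c (f x)" "x \<notin> carr \<Longrightarrow> f x = 0"
    by (simp_all add: gh EndoD[OF gh(1)] EndoD[OF gh(2)] algebra_simps)
  have h: "f y \<in> carr" if "y \<in> gr A q" for y q
    using carr_add[OF hom_carr[OF EndoD(4)[OF gh(1) that]] hom_carr[OF EndoD(4)[OF gh(2) that]]]
    by (simp add: gh)
  show "f x \<in> carr" if "x \<in> carr"
  proof -
    obtain y z where "y \<in> gr A 0" "z \<in> gr A 1" "x = y + z"
      using \<open>x \<in> carr\<close> by (metis gsumE carr_gsum)
    then show ?thesis
      using h a[of y z] carr_add by (simp add: hom_carr)
  qed
  show "f 0 = 0"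
    using a[OF carr_0 carr_0] by simp
qed

lemma Ops_diff:
  assumes "f \<in> Ops"
  shows "x \<in> carr \<Longrightarrow> y \<in> carr \<Longrightarrow> f (x - y) = f x - f y" "x \<in> carr \<Longrightarrow> f (- x) = - f x"
proof -
  show d: "f (x - y) = f x - f y" if "x \<in> carr" "y \<in> carr" for x y
    using OpsD(1)[OF assms, of "x - y" y] that carr_diff by simp
  show "x \<in> carr \<Longrightarrow> f (- x) = - f x"
    using d[OF carr_0, of x] OpsD(5)[OF assms] by simp
qed

lemma Endo_comp:
  assumes f: "f \<in> Endo A p" and g: "g \<in> Endo A q"
  shows "f \<circ> g \<in> Endo A (p + q)"
proof -
  note F = OpsD[OF E.hom_gsum[OF f]] and G = OpsD[OF E.hom_gsum[OF g]]
  have "f (g x) \<in> gr A (p + q + r)" if "x \<in> gr A r" for x r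
    using EndoD(4)[OF f EndoD(4)[OF g that]] by (simp only: add.assoc)
  then show ?thesis
    by (intro EndoI) (simp_all add: F G)
qed

text \<open>
  The supercommutator is defined for sums of homogeneous operators; this is the usual formula, in which it
  is computed everywhere below.
\<close>

lemma scomm_hom:
  assumes f: "f \<in> Endo A p" and g: "g \<in> Endo A q"
  shows "scomm A f g = (f \<circ> g) - fscl (scl A) (sg (p * q)) (g \<circ> f)"
proof -
  have z: "0 \<circ> h = 0" "h \<in> Ops \<Longrightarrow> h \<circ> 0 = 0" for h :: "'v \<Rightarrow> 'v"
    by (auto simp: fun_eq_iff OpsD)
  note fg = E.hom_gsum[OF f] E.hom_gsum[OF g]
  show ?thesis
    unfolding scomm_def E.hpart_hom[OF f] E.hpart_hom[OF g]
    by (cases p; cases q) (simp_all add: z fg)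
qed

lemma scomm_Endo:
  assumes f: "f \<in> Endo A p" and g: "g \<in> Endo A q"
  shows "scomm A f g \<in> Endo A (p + q)"
  unfolding scomm_hom[OF f g]
  using Op.subspace_diff[OF Endo_subspace Endo_comp[OF f g]
      Op.subspace_scale[OF Endo_subspace Endo_comp[OF g f, unfolded add.commute[of q p]]]] .

lemma scomm_add:
  assumes "f \<in> Ops" "g \<in> Ops" "h \<in> Ops"
  shows "scomm A f (g + h) = scomm A f g + scomm A f h" "scomm A (f + g) h = scomm A f h + scomm A g h"
proof -
  have l: "u \<circ> (v + w) = (u \<circ> v) + (u \<circ> w)" if "u \<in> Endo A p" "v \<in> Endo A q" "w \<in> Endo A q" for u v w p q
  proof
    fix x
    show "(u \<circ> (v + w)) x = ((u \<circ> v) + (u \<circ> w)) x"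
      using OpsD(1)[OF E.hom_gsum[OF that(1)], of "v x" "w x"] OpsD[OF E.hom_gsum[OF that(2)]]
        OpsD[OF E.hom_gsum[OF that(3)]] OpsD(5)[OF E.hom_gsum[OF that(1)]] by (cases "x \<in> carr") auto
  qed
  have r: "(u + v) \<circ> w = (u \<circ> w) + (v \<circ> w)" for u v w :: "'v \<Rightarrow> 'v"
    by (simp add: fun_eq_iff)
  show "scomm A f (g + h) = scomm A f g + scomm A f h" "scomm A (f + g) h = scomm A f h + scomm A g h"
    using assms unfolding scomm_def
    by (simp_all add: E.hpart_add l[OF E.hpart_in E.hpart_in E.hpart_in] r Op.scale_right_distrib)
qed

lemma scomm_scale:
  assumes "f \<in> Ops" "g \<in> Ops"
  shows "scomm A f (fscl (scl A) c g) = fscl (scl A) c (scomm A f g)"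
    "scomm A (fscl (scl A) c f) g = fscl (scl A) c (scomm A f g)"
proof -
  have l: "u \<circ> fscl (scl A) c v = fscl (scl A) c (u \<circ> v)" if "u \<in> Endo A p" "v \<in> Endo A q" for u v p q
  proof
    fix x
    show "(u \<circ> fscl (scl A) c v) x = fscl (scl A) c (u \<circ> v) x"
      using OpsD(2)[OF E.hom_gsum[OF that(1)], of "v x" c] OpsD[OF E.hom_gsum[OF that(2)]]
        OpsD(5)[OF E.hom_gsum[OF that(1)]] by (cases "x \<in> carr") (auto simp: fscl_def)
  qed
  have r: "fscl (scl A) c u \<circ> w = fscl (scl A) c (u \<circ> w)" for u w :: "'v \<Rightarrow> 'v"
    by (simp add: fun_eq_iff fscl_def)
  show "scomm A f (fscl (scl A) c g) = fscl (scl A) c (scomm A f g)"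
    "scomm A (fscl (scl A) c f) g = fscl (scl A) c (scomm A f g)"
    using assms unfolding scomm_def
    by (simp_all add: E.hpart_scale l[OF E.hpart_in E.hpart_in] r Op.scale_right_diff_distrib
        Op.scale_right_distrib mult.commute)
qed

lemma scomm_0:
  assumes "f \<in> Ops"
  shows "scomm A f 0 = 0" "scomm A 0 f = 0"
  using scomm_scale[OF assms assms, of 0] by simp_all

lemma scomm_sums:
  assumes "f \<in> Ops" "\<And>i. g i \<in> Ops"
  shows "scomm A f (\<Sum>i\<in>I. g i) = (\<Sum>i\<in>I. scomm A f (g i))"
    "scomm A (\<Sum>i\<in>I. g i) f = (\<Sum>i\<in>I. scomm A (g i) f)"
proof -
  have s: "(\<Sum>i\<in>I. g i) \<in> Ops" for I
    by (intro Op.subspace_sum[OF E.gsum_subspace] assms(2))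
  show "scomm A f (\<Sum>i\<in>I. g i) = (\<Sum>i\<in>I. scomm A f (g i))"
    "scomm A (\<Sum>i\<in>I. g i) f = (\<Sum>i\<in>I. scomm A (g i) f)"
    by (induction I rule: infinite_finite_induct)
      (simp_all only: sum.infinite sum.empty sum.insert not_False_eq_True scomm_0 scomm_add assms s)
qed

lemma scomm_bilinear:
  "bilinear_on (fscl (scl A)) (fscl (scl A)) (fscl (scl A)) Ops Ops (scomm A)"
  by (auto simp: bilinear_on_def linear_on_def scomm_add scomm_scale)

lemma scomm_anticomm:
  assumes "f \<in> Endo A p" "g \<in> Endo A q"
  shows "scomm A f g = - fscl (scl A) (sg (p * q)) (scomm A g f)"
  unfolding scomm_hom[OF assms] scomm_hom[OF assms(2,1)]
  by (simp add: Op.scale_right_diff_distrib mult.commute)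

lemma scomm_jacobi:
  assumes f: "f \<in> Endo A p" and g: "g \<in> Endo A q" and h: "h \<in> Endo A r"
  shows "scomm A f (scomm A g h)
    = scomm A (scomm A f g) h + fscl (scl A) (sg (p * q)) (scomm A g (scomm A f h))"
proof
  fix x
  note F = OpsD[OF E.hom_gsum[OF f]] and G = OpsD[OF E.hom_gsum[OF g]] and H = OpsD[OF E.hom_gsum[OF h]]
  note c = scomm_hom[OF f scomm_Endo[OF g h]] scomm_hom[OF scomm_Endo[OF f g] h]
    scomm_hom[OF g scomm_Endo[OF f h]]
  note c' = scomm_hom[OF f g] scomm_hom[OF g h] scomm_hom[OF f h]
  have d: "u (y - z) = u y - u z" if "u \<in> Ops" "y \<in> carr" "z \<in> carr" for u y z
    using OpsD(1)[OF that(1), of "y - z" z] carr_diff that by simp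
  note d' = d[OF E.hom_gsum[OF f]] d[OF E.hom_gsum[OF g]] d[OF E.hom_gsum[OF h]]
  show "scomm A f (scomm A g h) x
    = (scomm A (scomm A f g) h + fscl (scl A) (sg (p * q)) (scomm A g (scomm A f h))) x"
  proof (cases "x \<in> carr")
    case True
    then show ?thesis
      unfolding c unfolding c'
      by (cases p; cases q; cases r)
        (simp_all add: fscl_def F G H d' carr_scale carr_neg algebra_simps
          OpsD(1) carr_add carr_diff)
  next
    case False
    then show ?thesis
      unfolding c unfolding c' by (simp add: fscl_def F G H)
  qed
qed

lemma der_simps [simp]: "scl (der A) = fscl (scl A)" "mul (der A) = scomm A"
  by (simp_all add: der_def)

lemma der_Endo: "d \<in> gr (der A) p \<Longrightarrow> d \<in> Endo A p"
  by (simp add: der_def)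

lemma derD:
  assumes "d \<in> gr (der A) p" "x \<in> gr A q" "y \<in> carr"
  shows "d (mul A x y) = mul A (d x) y + scl A (sg (p * q)) (mul A x (d y))"
  using assms by (auto simp: der_def)

lemma derI:
  assumes "d \<in> Endo A p"
    "\<And>x y q. x \<in> gr A q \<Longrightarrow> y \<in> carr \<Longrightarrow> d (mul A x y) = mul A (d x) y + scl A (sg (p * q)) (mul A x (d y))"
  shows "d \<in> gr (der A) p"
  using assms by (auto simp: der_def)

lemma der_subspace: "Op.subspace (gr (der A) p)"
proof (rule Op.subspaceI)
  show "0 \<in> gr (der A) p"
  proof (rule derI[OF Op.subspace_0[OF Endo_subspace]])
    fix x y q assume "x \<in> gr A q" "y \<in> carr"
    then show "0 (mul A x y) = mul A (0 x) y + scl A (sg (p * q)) (mul A x (0 y))"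
      using mul_scale[where c = 0 and x = x and y = y] by (simp add: hom_carr)
  qed
next
  fix f g assume f: "f \<in> gr (der A) p" and g: "g \<in> gr (der A) p"
  show "f + g \<in> gr (der A) p"
  proof (rule derI)
    show "f + g \<in> Endo A p"
      using Op.subspace_add[OF Endo_subspace] f g der_Endo by blast
    fix x y q assume "x \<in> gr A q" "y \<in> carr"
    then show "(f + g) (mul A x y) = mul A ((f + g) x) y + scl A (sg (p * q)) (mul A x ((f + g) y))"
      by (simp add: derD[OF f] derD[OF g] mul_add OpsD(4)[OF E.hom_gsum[OF der_Endo[OF f]]]
          OpsD(4)[OF E.hom_gsum[OF der_Endo[OF g]]] hom_carr algebra_simps)
  qed
next
  fix c f assume f: "f \<in> gr (der A) p"
  show "fscl (scl A) c f \<in> gr (der A) p"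
  proof (rule derI)
    show "fscl (scl A) c f \<in> Endo A p"
      using Op.subspace_scale[OF Endo_subspace] f der_Endo by blast
    fix x y q assume "x \<in> gr A q" "y \<in> carr"
    then show "fscl (scl A) c f (mul A x y)
      = mul A (fscl (scl A) c f x) y + scl A (sg (p * q)) (mul A x (fscl (scl A) c f y))"
      by (simp add: derD[OF f] fscl_def mul_scale OpsD(4)[OF E.hom_gsum[OF der_Endo[OF f]]]
          hom_carr algebra_simps)
  qed
qed

sublocale D: graded_space "fscl (scl A)" "gr (der A)"
  by unfold_locales (use der_subspace Endo_disj[OF der_Endo der_Endo] in simp_all)

lemma scarrier_der: "scarrier (der A) = gsum (gr (der A))"
  by (simp add: scarrier_def)

lemma der_Ops: "f \<in> scarrier (der A) \<Longrightarrow> f \<in> Ops"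
  using der_Endo by (auto simp: scarrier_der gsum_def)

lemma scomm_der:
  assumes f: "f \<in> gr (der A) p" and g: "g \<in> gr (der A) q"
  shows "scomm A f g \<in> gr (der A) (p + q)"
proof (rule derI)
  show "scomm A f g \<in> Endo A (p + q)"
    using scomm_Endo der_Endo f g by blast
  fix x y r assume x: "x \<in> gr A r" and y: "y \<in> carr"
  note F = OpsD[OF E.hom_gsum[OF der_Endo[OF f]]] and G = OpsD[OF E.hom_gsum[OF der_Endo[OF g]]]
  note fx = EndoD(4)[OF der_Endo[OF f] x] and gx = EndoD(4)[OF der_Endo[OF g] x]
  note m = mul_carr hom_carr[OF x] y F(4) G(4) carr_scale
  have fg: "f (g (mul A x y)) = mul A (f (g x)) y + scl A (sg (p * (q + r))) (mul A (g x) (f y))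
    + scl A (sg (q * r)) (mul A (f x) (g y)) + scl A (sg (q * r) * sg (p * r)) (mul A x (f (g y)))"
    using derD[OF f gx, of y] derD[OF f x, of "g y"] derD[OF g x y]
    by (simp add: m F(1,2) G(1,2) algebra_simps)
  have gf: "g (f (mul A x y)) = mul A (g (f x)) y + scl A (sg (q * (p + r))) (mul A (f x) (g y))
    + scl A (sg (p * r)) (mul A (g x) (f y)) + scl A (sg (p * r) * sg (q * r)) (mul A x (g (f y)))"
    using derD[OF g fx, of y] derD[OF g x, of "f y"] derD[OF f x y]
    by (simp add: m F(1,2) G(1,2) algebra_simps)
  have d: "mul A (u - v) w = mul A u w - mul A v w" "mul A w (u - v) = mul A w u - mul A w v"
    if "u \<in> carr" "v \<in> carr" "w \<in> carr" for u v w
    using mul_add[of "u - v" v w] mul_add[of w "u - v" v] that carr_diff by simp_all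
  show "scomm A f g (mul A x y) = mul A (scomm A f g x) y
      + scl A (sg ((p + q) * r)) (mul A x (scomm A f g y))"
    unfolding scomm_hom[OF der_Endo[OF f] der_Endo[OF g]]
    by (cases p; cases q; cases r) (simp_all add: fscl_def fg gf m d mul_add mul_scale carr_add algebra_simps)
qed

theorem lie_superalgebra_der: "lie_superalgebra (der A)"
proof -
  have sup: "superalgebra (der A)"
    unfolding superalgebra_def superspace_def der_simps
  proof (intro conjI allI ballI)
    show "vector_space (fscl (scl A) :: _ \<Rightarrow> ('v \<Rightarrow> 'v) \<Rightarrow> _)"
      by (rule Op.vector_space_axioms)
    show "Op.subspace (gr (der A) p)" for p
      by (rule der_subspace)
    show "gr (der A) 0 \<inter> gr (der A) 1 = {0}"
      using D.disj Op.subspace_0[OF der_subspace] by blast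
    show "bilinear_on (fscl (scl A)) (fscl (scl A)) (fscl (scl A)) (scarrier (der A)) (scarrier (der A)) (scomm A)"
      using scomm_bilinear der_Ops unfolding bilinear_on_def linear_on_def by blast
    show "scomm A f g \<in> gr (der A) (p + q)" if "f \<in> gr (der A) p" "g \<in> gr (der A) q" for f g p q
      using scomm_der that .
  qed
  have e: "scomm A f f = 0" if "f \<in> Endo A 0" for f
    by (simp add: scomm_hom[OF that that])
  have o: "scomm A f (scomm A f f) = 0" if "f \<in> Endo A 1" for f
  proof -
    have "(f \<circ> ((f \<circ> f) + (f \<circ> f))) = (((f \<circ> f) + (f \<circ> f)) \<circ> f)"
    proof
      fix x
      show "(f \<circ> ((f \<circ> f) + (f \<circ> f))) x = (((f \<circ> f) + (f \<circ> f)) \<circ> f) x"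
        using OpsD[OF E.hom_gsum[OF that]] by (cases "x \<in> carr") auto
    qed
    moreover have "scomm A f f = (f \<circ> f) + (f \<circ> f)"
      by (simp add: scomm_hom[OF that that])
    ultimately show ?thesis
      using scomm_hom[OF that scomm_Endo[OF that that]] by (simp only: mult_zero_right bit_add_self
          sg_simps Op.scale_one diff_self)
  qed
  show ?thesis
    unfolding lie_superalgebra_def der_simps
    by (intro conjI allI ballI sup scomm_anticomm scomm_jacobi e o) (erule der_Endo)+
qed

lemma Lmul_Endo: "x \<in> gr A p \<Longrightarrow> Lmul A x \<in> Endo A p"
  by (rule EndoI) (auto simp: Lmul_def carr_add carr_scale mul_add mul_scale hom_carr mul_gr)

end

text \<open>
  Both sides of each Lie axiom lie in \<open>L\<close>, and their images under the injective map \<open>f\<close> agree. This also covers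
  the two axioms which in characteristic \<open>2\<close> and \<open>3\<close> are independent of the others.
\<close>

lemma lie_superalgebra_pullback:
  fixes f :: "'v::ab_group_add \<Rightarrow> 'w::ab_group_add"
  assumes L: "superalgebra (L :: ('k::field, 'v, 'y) salg_scheme)"
    and M: "lie_superalgebra (M :: ('k, 'w, 'z) salg_scheme)"
    and lin: "linear_on (scl L) (scl M) (scarrier L) f" and inj: "inj_on f (scarrier L)"
    and gr: "\<And>p x. x \<in> gr L p \<Longrightarrow> f x \<in> gr M p"
    and hom: "\<And>x y. x \<in> scarrier L \<Longrightarrow> y \<in> scarrier L \<Longrightarrow> f (mul L x y) = mul M (f x) (f y)"
  shows "lie_superalgebra L"
proof -
  interpret L: super_algebra L by (rule super_algebra.intro[OF L])
  note c = L.hom_carr L.mul_carr L.carr_scale L.carr_add L.carr_neg L.carr_0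
  have a: "f (x + y) = f x + f y" if "x \<in> scarrier L" "y \<in> scarrier L" for x y
    using lin that by (auto simp: linear_on_def)
  have s: "f (scl L k x) = scl M k (f x)" if "x \<in> scarrier L" for x k
    using lin that by (auto simp: linear_on_def)
  have zer: "f 0 = 0"
    using a[OF L.carr_0 L.carr_0] by simp
  have n: "f (- x) = - f x" if "x \<in> scarrier L" for x
    using a[of x "- x"] zer that c by (simp add: eq_neg_iff_add_eq_0 add.commute)
  have i: "x = y" if "f x = f y" "x \<in> scarrier L" "y \<in> scarrier L" for x y
    using inj that by (auto dest: inj_onD)
  note m = M[unfolded lie_superalgebra_def]
  show ?thesis
    unfolding lie_superalgebra_def
  proof (intro conjI allI ballI L)
    fix p q x y assume x: "x \<in> gr L p" and y: "y \<in> gr L q"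
    have "mul M (f x) (f y) = - scl M (sg (p * q)) (mul M (f y) (f x))"
      using m gr[OF x] gr[OF y] by blast
    then show "mul L x y = - scl L (sg (p * q)) (mul L y x)"
      by (intro i) (use x y in \<open>simp_all add: c hom s n\<close>)
    fix r z assume z: "z \<in> gr L r"
    have "mul M (f x) (mul M (f y) (f z))
        = mul M (mul M (f x) (f y)) (f z) + scl M (sg (p * q)) (mul M (f y) (mul M (f x) (f z)))"
      using m gr[OF x] gr[OF y] gr[OF z] by blast
    then show "mul L x (mul L y z) = mul L (mul L x y) z + scl L (sg (p * q)) (mul L y (mul L x z))"
      by (intro i) (use x y z in \<open>simp_all add: c hom s n a\<close>)
  next
    fix x assume x: "x \<in> gr L 0"
    show "mul L x x = 0"
      by (rule i) (use x m gr in \<open>simp_all add: c hom zer\<close>)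
  next
    fix x assume x: "x \<in> gr L 1"
    show "mul L x (mul L x x) = 0"
      by (rule i) (use x m gr in \<open>simp_all add: c hom zer\<close>)
  qed
qed

section \<open>Hurwitz superalgebras and their para-Hurwitz product\<close>

locale hurwitz =
  fixes C :: "('k::field, 'v::ab_group_add) unital_qsalg"
  assumes two: "(2::'k) \<noteq> 0" and hurwitz: "hurwitz_superalgebra C" and full: "scarrier C = UNIV"
begin

sublocale full_superspace C
  using hurwitz full
  by unfold_locales (auto simp: hurwitz_superalgebra_def composition_superalgebra_def)

abbreviation scale_by (infixr "\<cdot>" 75) where "c \<cdot> x \<equiv> scl C c x"
abbreviation unit ("\<one>") where "\<one> \<equiv> uone C"
abbreviation cprod (infixl "\<odot>" 70) where "x \<odot> y \<equiv> mul C x y"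
abbreviation form ("\<b>") where "\<b> \<equiv> bf C"
abbreviation cnj where "cnj \<equiv> hconj C"
abbreviation V where "V \<equiv> gr C"
abbreviation hp where "hp \<equiv> hpart (gr C)"

lemma para_simps [simp]: "scl (para C) = scl C" "gr (para C) = gr C" "bf (para C) = bf C" "qf (para C) = qf C"
  by (simp_all add: para_def)

lemma unit_even: "\<one> \<in> V 0"
  by (rule hurwitz_unit_even[OF hurwitz full])

lemma unit_mul [simp]: "\<one> \<odot> x = x" "x \<odot> \<one> = x"
  by (rule hurwitz_unit[OF hurwitz full])+

lemma V_add: "x \<in> V p \<Longrightarrow> y \<in> V p \<Longrightarrow> x + y \<in> V p"
  and V_diff: "x \<in> V p \<Longrightarrow> y \<in> V p \<Longrightarrow> x - y \<in> V p"
  and V_scale: "x \<in> V p \<Longrightarrow> c \<cdot> x \<in> V p"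
  and V_0: "0 \<in> V p"
  using sub by (simp_all add: subspace_add subspace_diff subspace_scale subspace_0)

lemma mul_rules [simp]:
  "(x + y) \<odot> z = x \<odot> z + y \<odot> z" "z \<odot> (x + y) = z \<odot> x + z \<odot> y"
  "(c \<cdot> x) \<odot> z = c \<cdot> (x \<odot> z)" "z \<odot> (c \<cdot> x) = c \<cdot> (z \<odot> x)"
  "(x - y) \<odot> z = x \<odot> z - y \<odot> z" "z \<odot> (x - y) = z \<odot> x - z \<odot> y"
  "(- x) \<odot> z = - (x \<odot> z)" "z \<odot> (- x) = - (z \<odot> x)" "0 \<odot> z = 0" "z \<odot> 0 = 0"
proof -
  note l = mul_linear(1)[of z] and r = mul_linear(2)[of z]
  show "(x + y) \<odot> z = x \<odot> z + y \<odot> z" "z \<odot> (x + y) = z \<odot> x + z \<odot> y"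
    "(c \<cdot> x) \<odot> z = c \<cdot> (x \<odot> z)" "z \<odot> (c \<cdot> x) = c \<cdot> (z \<odot> x)"
    using l r by (simp_all add: linear_on_def)
  show "(x - y) \<odot> z = x \<odot> z - y \<odot> z" "z \<odot> (x - y) = z \<odot> x - z \<odot> y" "0 \<odot> z = 0" "z \<odot> 0 = 0"
    using linear_on_diff[OF l] linear_on_diff[OF r] linear_on_0[OF l] linear_on_0[OF r] by simp_all
  show "(- x) \<odot> z = - (x \<odot> z)" "z \<odot> (- x) = - (z \<odot> x)"
    using linear_on_diff[OF l, of 0] linear_on_diff[OF r, of 0] linear_on_0[OF l] linear_on_0[OF r] by simp_all
qed

lemma form_rules [simp]:
  "\<b> (x + y) z = \<b> x z + \<b> y z" "\<b> z (x + y) = \<b> z x + \<b> z y"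
  "\<b> (c \<cdot> x) z = c * \<b> x z" "\<b> z (c \<cdot> x) = c * \<b> z x"
  "\<b> (x - y) z = \<b> x z - \<b> y z" "\<b> z (x - y) = \<b> z x - \<b> z y"
  "\<b> (- x) z = - \<b> x z" "\<b> z (- x) = - \<b> z x" "\<b> 0 z = 0" "\<b> z 0 = 0"
proof -
  note l = bf_linear(1)[of z] and r = bf_linear(2)[of z]
  show "\<b> (x + y) z = \<b> x z + \<b> y z" "\<b> z (x + y) = \<b> z x + \<b> z y"
    "\<b> (c \<cdot> x) z = c * \<b> x z" "\<b> z (c \<cdot> x) = c * \<b> z x"
    using l r by (simp_all add: linear_on_def)
  show "\<b> (x - y) z = \<b> x z - \<b> y z" "\<b> z (x - y) = \<b> z x - \<b> z y" "\<b> 0 z = 0" "\<b> z 0 = 0"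
    using linear_on_diff[OF l] linear_on_diff[OF r] linear_on_0[OF l] linear_on_0[OF r] by simp_all
  show "\<b> (- x) z = - \<b> x z" "\<b> z (- x) = - \<b> z x"
    using linear_on_diff[OF l, of 0] linear_on_diff[OF r, of 0] linear_on_0[OF l] linear_on_0[OF r] by simp_all
qed

lemma form_even: "x \<in> V p \<Longrightarrow> y \<in> V q \<Longrightarrow> p \<noteq> q \<Longrightarrow> \<b> x y = 0"
  using superform by (auto simp: quadratic_superform_def)

lemma form_sym: "x \<in> V p \<Longrightarrow> y \<in> V q \<Longrightarrow> \<b> x y = sg (p * q) * \<b> y x"
  using superform unfolding quadratic_superform_def by blast

lemma form_comm_unit: "\<b> \<one> x = \<b> x \<one>"
proof -
  obtain y z where "y \<in> V 0" "z \<in> V 1" "x = y + z"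
    using decomp by blast
  then show ?thesis
    using form_sym[OF unit_even, of y 0] form_sym[OF unit_even, of z 1] by simp
qed

text \<open>
  Regularity only speaks of homogeneous vectors. As the form vanishes between different parities, it applies
  to the two components of \<open>u - v\<close> separately.
\<close>

lemma form_nondeg:
  assumes "\<And>q y. y \<in> V q \<Longrightarrow> \<b> u y = \<b> v y"
  shows "u = v"
proof -
  obtain y z where yz: "y \<in> V 0" "z \<in> V 1" "u - v = y + z"
    using decomp by blast
  have reg: "w = 0" if "w \<in> V p" "\<And>t. t \<in> V p \<Longrightarrow> \<b> w t = 0" for w p
    using hurwitz that
    by (auto simp: hurwitz_superalgebra_def composition_superalgebra_def regular_superform_def)
  have b: "\<b> y t + \<b> z t = 0" if "t \<in> V q" for t q
    using assms[OF that] form_rules(1)[of y z t] form_rules(5)[of u v t] by (simp add: yz(3))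
  have "y = 0"
    using reg[OF yz(1)] b[of _ 0] form_even[OF yz(2), of _ 0] by simp
  moreover have "z = 0"
    using reg[OF yz(2)] b[of _ 1] form_even[OF yz(1), of _ 1] by simp
  ultimately show ?thesis
    using yz(3) by simp
qed

lemma cnj_rules [simp]:
  "cnj (x + y) = cnj x + cnj y" "cnj (c \<cdot> x) = c \<cdot> cnj x" "cnj (cnj x) = x"
  "cnj (x - y) = cnj x - cnj y" "cnj (- x) = - cnj x" "cnj 0 = 0"
proof -
  note l = hconj_linear[OF hurwitz full]
  show "cnj (x + y) = cnj x + cnj y" "cnj (c \<cdot> x) = c \<cdot> cnj x"
    using l by (simp_all add: linear_on_def)
  show "cnj (x - y) = cnj x - cnj y" "cnj 0 = 0"
    using linear_on_diff[OF l] linear_on_0[OF l] by simp_all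
  show "cnj (- x) = - cnj x"
    using linear_on_diff[OF l, of 0] linear_on_0[OF l] by simp
  show "cnj (cnj x) = x"
    by (rule hconj_hconj[OF hurwitz full])
qed

lemma cnj_V: "x \<in> V p \<Longrightarrow> cnj x \<in> V p"
  by (rule hconj_gr[OF hurwitz full])

lemma form_unit_unit: "\<b> \<one> \<one> \<cdot> \<one> = 2 \<cdot> \<one>"
  by (rule hurwitz_bf_unit[OF hurwitz full])

lemma cnj_unit [simp]: "cnj \<one> = \<one>"
  unfolding hconj_def form_unit_unit by (simp add: scale_left_distrib[of 1 1, simplified])

lemma form_cnj: "\<b> (cnj x) y = \<b> x (cnj y)"
  by (simp add: hconj_def form_comm_unit[of y])

lemma mul_V: "x \<in> V p \<Longrightarrow> y \<in> V q \<Longrightarrow> x \<odot> y \<in> V (p + q)"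
  by (rule hurwitz_mul_gr[OF hurwitz full])

lemma composition:
  assumes "x \<in> V p" "y \<in> V q" "z \<in> V r" "t \<in> V s"
  shows "\<b> (x \<odot> y) (z \<odot> t) + sg (p * q + p * r + q * r) * \<b> (z \<odot> y) (x \<odot> t)
    = sg (q * r) * \<b> x z * \<b> y t"
  using hurwitz assms unfolding hurwitz_superalgebra_def composition_superalgebra_def by blast

text \<open>
  Adjoints of multiplications. Putting \<open>1\<close> for one factor in the composition law moves the other
  one to the opposite argument of the form, at the price of a conjugation.
\<close>

lemma form_left_adjoint:
  assumes "x \<in> V p" "y \<in> V q" "t \<in> V s"
  shows "\<b> (x \<odot> y) t = sg (p * q) * \<b> y (cnj x \<odot> t)"
  using composition[OF assms(1,2) unit_even assms(3)] form_even[OF assms(1) unit_even]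
  by (cases p; cases q) (simp_all add: hconj_def algebra_simps eq_neg_iff_add_eq_0)

lemma form_right_adjoint:
  assumes "x \<in> V p" "z \<in> V r" "t \<in> V s"
  shows "\<b> x (z \<odot> cnj t) = sg (p * r) * \<b> z (x \<odot> t)"
proof -
  have "\<b> t \<one> * \<b> x z = \<b> x (z \<odot> t) + sg (p * r) * \<b> z (x \<odot> t)"
    using composition[OF assms(1) unit_even assms(2,3)]
    by (simp add: form_comm_unit mult.commute)
  then show ?thesis
    by (simp add: hconj_def algebra_simps)
qed

text \<open>
  Conjugation is an anti-automorphism because both sides pair with \<open>t\<close> to \<open>\<b> (cnj x) (y \<odot> t)\<close>, by moving
  factors across the form.
\<close>

lemma cnj_mul:
  assumes x: "x \<in> V p" and y: "y \<in> V q"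
  shows "cnj (x \<odot> y) = sg (p * q) \<cdot> (cnj y \<odot> cnj x)"
proof (rule form_nondeg)
  fix s t assume t: "t \<in> V s"
  have "\<b> (cnj (x \<odot> y)) t = sg (p * q) * \<b> y (cnj x \<odot> cnj t)"
    by (simp add: form_cnj form_left_adjoint[OF x y cnj_V[OF t]])
  also have "\<dots> = \<b> (cnj x) (y \<odot> t)"
    using form_right_adjoint[OF y cnj_V[OF x] t] by (cases p; cases q) simp_all
  also have "\<dots> = \<b> (sg (p * q) \<cdot> (cnj y \<odot> cnj x)) t"
    using form_left_adjoint[OF cnj_V[OF y] cnj_V[OF x] t] by (cases p; cases q) simp_all
  finally show "\<b> (cnj (x \<odot> y)) t = \<b> (sg (p * q) \<cdot> (cnj y \<odot> cnj x)) t" .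
qed

text \<open>
  The linearisation of \<open>cnj x (x t) = q(x) t\<close>: in the composition law, the adjoint moves the left
  factors of both products to one side of the form, and the remaining argument is arbitrary.
\<close>

lemma mul_cnj_left:
  assumes x: "x \<in> V p" and z: "z \<in> V r" and t: "t \<in> V s"
  shows "cnj x \<odot> (z \<odot> t) + sg (p * r) \<cdot> (cnj z \<odot> (x \<odot> t)) = \<b> x z \<cdot> t"
proof (rule form_nondeg)
  fix q y assume y: "y \<in> V q"
  have e: "\<b> x z = 0" if "p \<noteq> r"
    using form_even[OF x z that] .
  have e': "\<b> t y = 0" if "q \<noteq> s"
    using form_even[OF t y] that by auto
  have b: "\<b> (cnj x \<odot> (z \<odot> t)) y = sg (q * (p + r + s)) * \<b> y (cnj x \<odot> (z \<odot> t))"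
    "\<b> (cnj z \<odot> (x \<odot> t)) y = sg (q * (p + r + s)) * \<b> y (cnj z \<odot> (x \<odot> t))"
    using form_sym[OF mul_V[OF cnj_V[OF x] mul_V[OF z t]] y] form_sym[OF mul_V[OF cnj_V[OF z] mul_V[OF x t]] y]
    by (simp_all add: add_ac mult.commute)
  have "sg (p * q) * \<b> y (cnj x \<odot> (z \<odot> t)) + sg (p * q + p * r) * \<b> y (cnj z \<odot> (x \<odot> t))
      = sg (q * r) * \<b> x z * \<b> y t" (is "?h")
    using composition[OF x y z t]
    unfolding form_left_adjoint[OF x y mul_V[OF z t]] form_left_adjoint[OF z y mul_V[OF x t]]
      mult.assoc[symmetric] sg_mult
    by (cases p; cases q; cases r) simp_all
  then have "sg (p * q) * (sg (p * q) * \<b> y (cnj x \<odot> (z \<odot> t)) + sg (p * q + p * r) * \<b> y (cnj z \<odot> (x \<odot> t)))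
      = sg (p * q) * (sg (q * r) * \<b> x z * \<b> y t)"
    by simp
  then have k: "\<b> y (cnj x \<odot> (z \<odot> t)) + sg (p * r) * \<b> y (cnj z \<odot> (x \<odot> t)) = \<b> x z * \<b> y t"
    using e by (cases p; cases q; cases r) (simp_all add: algebra_simps)
  have "\<b> (cnj x \<odot> (z \<odot> t) + sg (p * r) \<cdot> (cnj z \<odot> (x \<odot> t))) y
      = sg (q * (p + r + s)) * (\<b> x z * \<b> y t)"
    unfolding k[symmetric] by (simp add: b algebra_simps)
  also have "\<dots> = \<b> (\<b> x z \<cdot> t) y"
    using e e' form_sym[OF t y] by (cases "p = r") (auto simp: mult.commute)
  finally show "\<b> (cnj x \<odot> (z \<odot> t) + sg (p * r) \<cdot> (cnj z \<odot> (x \<odot> t))) y = \<b> (\<b> x z \<cdot> t) y" .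
qed

text \<open>
  The mirror image \<open>(t x) cnj x = q(x) t\<close>, obtained by conjugating the left-hand version.
\<close>

lemma mul_cnj_right:
  assumes x: "x \<in> V p" and z: "z \<in> V r" and t: "t \<in> V s"
  shows "(t \<odot> x) \<odot> cnj z + sg (p * r) \<cdot> ((t \<odot> z) \<odot> cnj x) = \<b> x z \<cdot> t"
proof -
  note a = cnj_V[OF x] cnj_V[OF z] cnj_V[OF t]
  have e: "\<b> x z = 0" if "p \<noteq> r"
    using form_even[OF x z that] .
  have "cnj (cnj (cnj x) \<odot> (cnj z \<odot> cnj t)) + sg (p * r) \<cdot> cnj (cnj (cnj z) \<odot> (cnj x \<odot> cnj t)) = \<b> x z \<cdot> t"
    using arg_cong[OF mul_cnj_left[OF a], of cnj] by (simp add: form_cnj)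
  then show ?thesis
    unfolding cnj_mul[OF cnj_V[OF a(1)] mul_V[OF a(2,3)]] cnj_mul[OF cnj_V[OF a(2)] mul_V[OF a(1,3)]]
      cnj_mul[OF a(1,3)] cnj_mul[OF a(2,3)]
    using e by (cases p; cases r; cases s) (simp_all add: add.commute neg_eq_iff_add_eq_0)
qed

subsection \<open>The para-Hurwitz product\<close>

abbreviation pprod (infixl "\<diamondop>" 70) where "x \<diamondop> y \<equiv> mul (para C) x y"

lemma pprod_def: "x \<diamondop> y = cnj x \<odot> cnj y"
  by (simp add: para_def)

lemma pprod_rules [simp]:
  "(x + y) \<diamondop> z = x \<diamondop> z + y \<diamondop> z" "z \<diamondop> (x + y) = z \<diamondop> x + z \<diamondop> y"
  "(c \<cdot> x) \<diamondop> z = c \<cdot> (x \<diamondop> z)" "z \<diamondop> (c \<cdot> x) = c \<cdot> (z \<diamondop> x)"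
  "(x - y) \<diamondop> z = x \<diamondop> z - y \<diamondop> z" "z \<diamondop> (x - y) = z \<diamondop> x - z \<diamondop> y"
  "(- x) \<diamondop> z = - (x \<diamondop> z)" "z \<diamondop> (- x) = - (z \<diamondop> x)" "0 \<diamondop> z = 0" "z \<diamondop> 0 = 0"
  by (simp_all add: pprod_def)

lemma pprod_V: "x \<in> V p \<Longrightarrow> y \<in> V q \<Longrightarrow> x \<diamondop> y \<in> V (p + q)"
  by (simp add: pprod_def mul_V cnj_V)

lemma scarrier_para: "scarrier (para C) = scarrier C"
  by (simp add: scarrier_def)

lemma para_full: "full_superspace (para C)"
proof
  show "scarrier (para C) = UNIV"
    using full by (simp add: scarrier_para)
  show "superalgebra (para C)"
    unfolding superalgebra_def
  proof (intro conjI allI ballI)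
    show "superspace (para C)"
      using superalgebra by (simp add: superalgebra_def superspace_def)
    show "bilinear_on (scl (para C)) (scl (para C)) (scl (para C)) (scarrier (para C)) (scarrier (para C))
        (mul (para C))"
      by (simp add: bilinear_on_def linear_on_def)
    show "mul (para C) x y \<in> gr (para C) (p + q)" if "x \<in> gr (para C) p" "y \<in> gr (para C) q" for x y p q
      using that by (simp add: pprod_V)
  qed
  show "quadratic_superform (para C)"
    using superform unfolding quadratic_superform_def para_simps scarrier_para .
qed

sublocale S: full_superspace "para C"
  rewrites "scl (para C) = scl C" and "gr (para C) = gr C" and "bf (para C) = bf C"
  by (rule para_full) simp_all

text \<open>
  Both sides are \<open>\<b> (cnj y) (x \<odot> z)\<close> up to the same sign: the left adjoint transforms one, the right
  adjoint the other.
\<close>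

lemma form_assoc: "\<b> (x \<diamondop> y) z = \<b> x (y \<diamondop> z)"
proof -
  have h: "\<b> (x \<diamondop> y) z = \<b> x (y \<diamondop> z)" if x: "x \<in> V p" and y: "y \<in> V q" and z: "z \<in> V r" for x y z p q r
    using form_left_adjoint[OF cnj_V[OF x] cnj_V[OF y] z] form_right_adjoint[OF x cnj_V[OF y] z]
    by (simp add: pprod_def)
  obtain a b c d e f where "a \<in> V 0" "b \<in> V 1" "x = a + b" "c \<in> V 0" "d \<in> V 1" "y = c + d"
    "e \<in> V 0" "f \<in> V 1" "z = e + f"
    using decomp by metis
  then show ?thesis
    by (simp add: h)
qed

text \<open>
  The two identities below, linearisations of \<open>x (y x) = q(x) y = (x y) x\<close>, are what makes the
  operators \<open>D\<^sub>i(a)\<close> derivations; together with the associativity of the form they express that the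
  product is a symmetric composition.
\<close>

lemma symmetric_composition:
  assumes x: "x \<in> V p" and y: "y \<in> V q" and z: "z \<in> V r"
  shows "sg (q * r) \<cdot> (x \<diamondop> (y \<diamondop> z)) + sg (p * r + p * q) \<cdot> (z \<diamondop> (y \<diamondop> x)) = \<b> x z \<cdot> y"
    "sg (p * q) \<cdot> ((x \<diamondop> y) \<diamondop> z) + sg (p * r + r * q) \<cdot> ((z \<diamondop> y) \<diamondop> x) = \<b> x z \<cdot> y"
proof -
  note c = cnj_V[OF x] cnj_V[OF y] cnj_V[OF z]
  note m = cnj_mul[OF c(2,3)] cnj_mul[OF c(2,1)] cnj_mul[OF c(1,2)] cnj_mul[OF c(3,2)]
  show "sg (q * r) \<cdot> (x \<diamondop> (y \<diamondop> z)) + sg (p * r + p * q) \<cdot> (z \<diamondop> (y \<diamondop> x)) = \<b> x z \<cdot> y"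
    using mul_cnj_left[OF x z y] unfolding pprod_def m
    by (cases p; cases q; cases r) simp_all
  show "sg (p * q) \<cdot> ((x \<diamondop> y) \<diamondop> z) + sg (p * r + r * q) \<cdot> ((z \<diamondop> y) \<diamondop> x) = \<b> x z \<cdot> y"
    using mul_cnj_right[OF x z y] unfolding pprod_def m
    by (cases p; cases q; cases r) simp_all
qed

text \<open>
  \<open>x \<lozenge> y\<close> is \<open>r\<^sub>x(y)\<close>, the product in the opposite order with the sign of the sign rule. Because it is bilinear
  on all of \<open>S\<close>, formulas in which arguments change places can be stated for arbitrary elements, without parities.
\<close>

abbreviation rprod (infixl "\<lozenge>" 70) where "x \<lozenge> y \<equiv> rop (para C) x y"

lemma rprod_hom: "x \<in> V p \<Longrightarrow> y \<in> V q \<Longrightarrow> x \<lozenge> y = sg (p * q) \<cdot> (y \<diamondop> x)"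
  by (cases p; cases q) (simp_all add: rop_def hp)

lemma rprod_rules [simp]:
  "(x + y) \<lozenge> z = x \<lozenge> z + y \<lozenge> z" "z \<lozenge> (x + y) = z \<lozenge> x + z \<lozenge> y"
  "(c \<cdot> x) \<lozenge> z = c \<cdot> (x \<lozenge> z)" "z \<lozenge> (c \<cdot> x) = c \<cdot> (z \<lozenge> x)"
  "(- x) \<lozenge> z = - (x \<lozenge> z)" "z \<lozenge> (- x) = - (z \<lozenge> x)"
  "(x - y) \<lozenge> z = x \<lozenge> z - y \<lozenge> z" "z \<lozenge> (x - y) = z \<lozenge> x - z \<lozenge> y" "0 \<lozenge> z = 0" "z \<lozenge> 0 = 0"
proof -
  note l = S.rop_linear(2)[of z] and r = S.rop_linear(1)[of z]
  show "(x + y) \<lozenge> z = x \<lozenge> z + y \<lozenge> z" "z \<lozenge> (x + y) = z \<lozenge> x + z \<lozenge> y"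
    "(c \<cdot> x) \<lozenge> z = c \<cdot> (x \<lozenge> z)" "z \<lozenge> (c \<cdot> x) = c \<cdot> (z \<lozenge> x)"
    using l r by (simp_all add: linear_on_def)
  show "(x - y) \<lozenge> z = x \<lozenge> z - y \<lozenge> z" "z \<lozenge> (x - y) = z \<lozenge> x - z \<lozenge> y" "0 \<lozenge> z = 0" "z \<lozenge> 0 = 0"
    using linear_on_diff[OF l] linear_on_diff[OF r] linear_on_0[OF l] linear_on_0[OF r] by simp_all
  show "(- x) \<lozenge> z = - (x \<lozenge> z)" "z \<lozenge> (- x) = - (z \<lozenge> x)"
    using linear_on_diff[OF l, of 0] linear_on_diff[OF r, of 0] linear_on_0[OF l] linear_on_0[OF r] by simp_all
qed

end

section \<open>The multiplication table of \<open>H\<^sub>3(C, *)\<close>\<close>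

lemma index3_simps [simp]:
  "(i::3) + 1 + 1 = i + 2" "i + 1 + 2 = i" "i + 2 + 1 = i" "i + 2 + 2 = i + 1"
  "i + 1 \<noteq> i" "i + 2 \<noteq> i" "i + 1 \<noteq> i + 2" "i + 2 \<noteq> i + 1" "i \<noteq> i + 1" "i \<noteq> i + 2"
  by (simp_all add: add.assoc)

lemma index3_cases: "j = i \<or> j = i + 1 \<or> j = i + 2" for i j :: 3
proof -
  have "j - i = 0 \<or> j - i = 1 \<or> j - i = 2"
  proof (cases "j - i" rule: bit1_cases)
    case (of_int z)
    then have "z = 0 \<or> z = 1 \<or> z = 2" by auto
    then show ?thesis using of_int(1) by auto
  qed
  then show ?thesis
    by (auto simp: algebra_simps)
qed

lemma UNIV_3: "(UNIV :: 3 set) = {i, i + 1, i + 2}"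
  using index3_cases[of _ i] by auto

lemma sum_3: "(\<Sum>j\<in>UNIV. f j) = f i + f (i + 1) + f (i + 2)" for i :: 3 and f :: "3 \<Rightarrow> 'a::comm_monoid_add"
  unfolding UNIV_3[of i] by (simp add: add.assoc)

lemma sum_shift_3: "(\<Sum>i\<in>UNIV. f (i + k)) = (\<Sum>i\<in>UNIV. f i)" for f :: "3 \<Rightarrow> 'a::comm_monoid_add"
  by (rule sum.reindex_bij_witness[of _ "\<lambda>i. i - k" "\<lambda>i. i + k"]) auto

context hurwitz
begin

sublocale G: graded_space "scl C" "gr C"
  by unfold_locales (use sub disj in simp_all)

lemma hp_decomp: "hp 0 x + hp 1 x = x"
  using G.hpart_decomp[of x] full by (simp add: scarrier_def)

lemma hp_V: "hp p x \<in> V p"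
  using G.hpart_in full by (simp add: scarrier_def)

lemma homogeneous_induct [case_names homogeneous add]:
  assumes "\<And>p x. x \<in> V p \<Longrightarrow> P x" "\<And>x y. P x \<Longrightarrow> P y \<Longrightarrow> P (x + y)"
  shows "P x"
  using assms(2)[OF assms(1)[OF hp_V[of 0 x]] assms(1)[OF hp_V[of 1 x]]] by (simp add: hp_decomp)

abbreviation "msc \<equiv> fscl (fscl (scl C))"

sublocale M: vector_space "msc :: 'k \<Rightarrow> 'v mat3 \<Rightarrow> 'v mat3"
  by (intro vector_space_fscl vector_space_axioms)

lemma msc_apply [simp]: "msc c X i j = c \<cdot> X i j"
  by (simp add: fscl_def)

sublocale MG: graded_space "msc :: 'k \<Rightarrow> 'v mat3 \<Rightarrow> 'v mat3" "mgr C"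
proof
  show "M.subspace (mgr C p)" for p
    by (rule M.subspaceI) (auto simp: mgr_def V_0 V_add V_scale)
  show "X = 0" if "X \<in> mgr C 0" "X \<in> mgr C 1" for X
    using that disj by (auto simp: mgr_def fun_eq_iff)
qed

lemma mgr_total: "gsum (mgr C) = UNIV"
proof -
  have "X = (\<lambda>i j. hp 0 (X i j)) + (\<lambda>i j. hp 1 (X i j))" for X :: "'v mat3"
    by (simp add: fun_eq_iff hp_decomp)
  moreover have "(\<lambda>i j. hp 0 (X i j)) + (\<lambda>i j. hp 1 (X i j)) \<in> gsum (mgr C)" for X :: "'v mat3"
    by (rule MG.gsumI) (simp_all add: mgr_def hp_V)
  ultimately show ?thesis
    by (metis UNIV_eq_I)
qed

lemma mmul_rules:
  "mmul C (X + Y) Z = mmul C X Z + mmul C Y Z" "mmul C Z (X + Y) = mmul C Z X + mmul C Z Y"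
  "mmul C (msc c X) Z = msc c (mmul C X Z)" "mmul C Z (msc c X) = msc c (mmul C Z X)"
  by (simp_all add: mmul_def fun_eq_iff sum.distrib scale_sum_right)

lemma mmul_0: "mmul C 0 X = 0" "mmul C X 0 = 0"
  by (simp_all add: mmul_def fun_eq_iff)

lemma mmul_mgr: "X \<in> mgr C p \<Longrightarrow> Y \<in> mgr C q \<Longrightarrow> mmul C X Y \<in> mgr C (p + q)"
  by (auto simp: mgr_def mmul_def intro!: subspace_sum[OF sub] mul_V)

lemma mstar_rules:
  "mstar C (X + Y) = mstar C X + mstar C Y" "mstar C (msc c X) = msc c (mstar C X)" "mstar C 0 = 0"
  by (simp_all add: mstar_def fun_eq_iff)

text \<open>
  The star reverses products only up to the sign rule. The sign in the Jordan product is therefore what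
  makes products of hermitian matrices hermitian.
\<close>

lemma mstar_mmul:
  assumes "X \<in> mgr C p" "Y \<in> mgr C q"
  shows "mstar C (mmul C X Y) = msc (sg (p * q)) (mmul C (mstar C Y) (mstar C X))"
proof -
  have s: "cnj (sum f A) = (\<Sum>i\<in>A. cnj (f i))" for f :: "3 \<Rightarrow> 'v" and A
    by (induction A rule: infinite_finite_induct) auto
  show ?thesis
    using assms by (simp add: mgr_def mstar_def mmul_def s fun_eq_iff cnj_mul[of _ p _ q] scale_sum_right)
qed

abbreviation J where "J \<equiv> H3 C"
abbreviation jprod (infixl "\<bullet>" 70) where "X \<bullet> Y \<equiv> mul (H3 C) X Y"
abbreviation E where "E \<equiv> je C"
abbreviation I where "I \<equiv> jiota C"

lemma scl_H3: "scl J = msc"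
  by (simp add: H3_def)

lemma gr_H3: "gr J p = {X \<in> mgr C p. mstar C X = X}"
  by (simp add: H3_def)

lemma jprod_def: "X \<bullet> Y = msc (1 / 2) (mmul C X Y + (\<Sum>p\<in>{0, 1}. \<Sum>q\<in>{0, 1}.
    msc (sg (p * q)) (mmul C (hpart (mgr C) q Y) (hpart (mgr C) p X))))"
  by (simp add: H3_def)

lemma jprod_hom:
  assumes "X \<in> mgr C p" "Y \<in> mgr C q"
  shows "X \<bullet> Y = msc (1 / 2) (mmul C X Y + msc (sg (p * q)) (mmul C Y X))"
  unfolding jprod_def MG.hpart_hom[OF assms(1)] MG.hpart_hom[OF assms(2)]
  by (cases p; cases q) (simp_all add: mmul_0)

lemma jprod_gr:
  assumes X: "X \<in> gr J p" and Y: "Y \<in> gr J q"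
  shows "X \<bullet> Y \<in> gr J (p + q)"
proof -
  have x: "X \<in> mgr C p" "mstar C X = X" and y: "Y \<in> mgr C q" "mstar C Y = Y"
    using X Y by (auto simp: gr_H3)
  have "mmul C X Y \<in> mgr C (p + q)" "mmul C Y X \<in> mgr C (p + q)"
    using mmul_mgr[OF x(1) y(1)] mmul_mgr[OF y(1) x(1)] by (simp_all add: add.commute)
  moreover have "mstar C (X \<bullet> Y) = X \<bullet> Y"
    unfolding jprod_hom[OF x(1) y(1)]
    by (simp add: mstar_rules mstar_mmul[OF x(1) y(1)] mstar_mmul[OF y(1) x(1)] x(2) y(2)
        M.scale_right_distrib add.commute mult.commute[of q p])
  ultimately show ?thesis
    unfolding gr_H3 jprod_hom[OF x(1) y(1)]
    by (simp add: M.subspace_add[OF MG.sub] M.subspace_scale[OF MG.sub])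
qed

lemma superalgebra_H3: "superalgebra J"
  unfolding superalgebra_def superspace_def
proof (intro conjI allI ballI)
  show "vector_space (scl J)"
    unfolding scl_H3 by (rule M.vector_space_axioms)
  show "module.subspace (scl J) (gr J p)" for p
    unfolding scl_H3 gr_H3
    by (rule M.subspaceI) (auto simp: mstar_rules M.subspace_0[OF MG.sub] M.subspace_add[OF MG.sub]
        M.subspace_scale[OF MG.sub])
  show "gr J 0 \<inter> gr J 1 = {0}"
    using MG.disj by (auto simp: gr_H3 mstar_rules M.subspace_0[OF MG.sub])
  show "bilinear_on (scl J) (scl J) (scl J) (scarrier J) (scarrier J) (mul J)"
    unfolding scl_H3
    by (simp add: bilinear_on_def linear_on_def jprod_def MG.hpart_add MG.hpart_scale mgr_total
        mmul_rules M.scale_right_distrib M.scale_right_diff_distrib algebra_simps)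
  show "X \<bullet> Y \<in> gr J (p + q)" if "X \<in> gr J p" "Y \<in> gr J q" for X Y p q
    using jprod_gr that .
qed

sublocale J: super_algebra "H3 C"
  by (rule super_algebra.intro[OF superalgebra_H3])

abbreviation jscale (infixr "\<star>" 75) where "c \<star> X \<equiv> scl (H3 C) c X"

lemma jprod_comm:
  assumes "X \<in> gr J p" "Y \<in> gr J q"
  shows "X \<bullet> Y = sg (p * q) \<star> (Y \<bullet> X)"
proof -
  have x: "X \<in> mgr C p" and y: "Y \<in> mgr C q"
    using assms by (auto simp: gr_H3)
  show ?thesis
    unfolding jprod_hom[OF x y] jprod_hom[OF y x] scl_H3
    by (simp add: M.scale_right_distrib M.scale_left_commute mult.commute[of q p] add.commute)
qed

subsection \<open>Products of the generators\<close>

lemma munit_rules: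
  "munit r s (x + y) = munit r s x + munit r s y" "munit r s (c \<cdot> x) = msc c (munit r s x)"
  "munit r s 0 = (0 :: 'v mat3)"
  "mmul C (munit r s x) (munit t u y) = (if s = t then munit r u (x \<odot> y) else 0)"
proof -
  have "munit r s x i l \<odot> munit t u y l j = (if l = s then if i = r \<and> s = t \<and> j = u then x \<odot> y else 0 else 0)"
    for i j l
    by (auto simp: munit_def)
  then show "mmul C (munit r s x) (munit t u y) = (if s = t then munit r u (x \<odot> y) else 0)"
    by (auto simp: mmul_def fun_eq_iff) (simp_all add: munit_def)
qed (simp_all add: munit_def fun_eq_iff)

lemma munit_mgr: "x \<in> V p \<Longrightarrow> munit r s x \<in> mgr C p"
  by (simp add: munit_def mgr_def V_0)

lemma I_def: "I i a = msc 2 (munit (i + 1) (i + 2) (cnj a) + munit (i + 2) (i + 1) a)"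
  by (rule jiota_def)

lemma I_rules [simp]:
  "I i (a + b) = I i a + I i b" "I i (c \<cdot> a) = c \<star> I i a" "I i (- a) = - I i a" "I i 0 = 0"
  "I i (a - b) = I i a - I i b"
proof -
  show add: "I i (a + b) = I i a + I i b" for a b
    by (simp add: I_def munit_rules M.scale_right_distrib)
  show "I i (c \<cdot> a) = c \<star> I i a"
    by (simp add: I_def munit_rules M.scale_right_distrib scl_H3 mult.commute)
  show 0: "I i 0 = 0"
    using add[of 0 0] by simp
  show neg: "I i (- a) = - I i a" for a
    using add[of a "- a"] 0 by (simp add: eq_neg_iff_add_eq_0 add.commute)
  show "I i (a - b) = I i a - I i b"
    using add[of a "- b"] neg by simp
qed

lemma I_gr: "a \<in> V p \<Longrightarrow> I i a \<in> gr J p"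
  by (rule jiota_gr[OF hurwitz full])

lemma I_mgr: "a \<in> V p \<Longrightarrow> I i a \<in> mgr C p"
  using I_gr by (auto simp: gr_H3)

lemma I_carr [simp]: "I i a \<in> J.carr"
  by (rule jiota_carrier[OF hurwitz full])

lemma E_mgr: "E i \<in> mgr C 0"
  by (simp add: je_def munit_mgr unit_even)

lemma E_gr: "E i \<in> gr J 0"
  using E_mgr by (auto simp: gr_H3 je_def mstar_def munit_def fun_eq_iff)

lemma E_carr [simp]: "E i \<in> J.carr"
  by (rule J.hom_carr[OF E_gr])

lemma half_half: "msc (1 / 2) (X + X) = X" "msc (1 / 2) (msc 2 X) = X" for X :: "'v mat3"
proof -
  show 2: "msc (1 / 2) (msc 2 X) = X"
    using two by simp
  show "msc (1 / 2) (X + X) = X"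
    using 2 M.scale_left_distrib[of 1 1 X] by (simp only: one_add_one M.scale_one)
qed

lemma table_EE: "E i \<bullet> E j = (if i = j then E i else 0)"
  unfolding jprod_hom[OF E_mgr E_mgr] by (auto simp: je_def munit_rules half_half)

lemma table_EI: "E j \<bullet> I i a = (if j = i then 0 else (1 / 2) \<star> I i a)"
  and table_IE: "I i a \<bullet> E j = (if j = i then 0 else (1 / 2) \<star> I i a)"
proof (induction a rule: homogeneous_induct)
  case (homogeneous p a)
  show "E j \<bullet> I i a = (if j = i then 0 else (1 / 2) \<star> I i a)"
    using index3_cases[of j i] two unfolding jprod_hom[OF E_mgr I_mgr[OF homogeneous]]
    by (auto simp: I_def je_def mmul_rules munit_rules scl_H3 M.scale_right_distrib)
  show "I i a \<bullet> E j = (if j = i then 0 else (1 / 2) \<star> I i a)"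
    using index3_cases[of j i] two unfolding jprod_hom[OF I_mgr[OF homogeneous] E_mgr]
    by (auto simp: I_def je_def mmul_rules munit_rules scl_H3 M.scale_right_distrib)
qed (simp_all add: J.mul_add J.scale_right_distrib)

lemma jprod_I_linear:
  "I i (a + b) \<bullet> Y = I i a \<bullet> Y + I i b \<bullet> Y" "Y \<bullet> I i (a + b) = Y \<bullet> I i a + Y \<bullet> I i b" if "Y \<in> J.carr"
  using that by (simp_all add: J.mul_add)

lemma bi_homogeneous_induct:
  assumes "\<And>p q x y. x \<in> V p \<Longrightarrow> y \<in> V q \<Longrightarrow> P x y"
    "\<And>x x' y. P x y \<Longrightarrow> P x' y \<Longrightarrow> P (x + x') y" "\<And>x y y'. P x y \<Longrightarrow> P x y' \<Longrightarrow> P x (y + y')"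
  shows "P x y"
proof (induction x rule: homogeneous_induct)
  case (homogeneous p x)
  show ?case
    by (induction y rule: homogeneous_induct) (use assms homogeneous in auto)
qed (use assms in auto)

text \<open>
  The diagonal entries of the two matrix products are \<open>cnj a b\<close>, \<open>a cnj b\<close> and their exchanged
  counterparts, which add up to multiples of the unit by the linearised norm laws with \<open>t = 1\<close>.
\<close>

lemma table_II_same: "I i a \<bullet> I i b = (2 * \<b> a b) \<star> (E (i + 1) + E (i + 2))"
proof (induction a b rule: bi_homogeneous_induct)
  case (1 p q a b)
  have l: "cnj a \<odot> b + sg (p * q) \<cdot> (cnj b \<odot> a) = \<b> a b \<cdot> \<one>"
    and r: "a \<odot> cnj b + sg (p * q) \<cdot> (b \<odot> cnj a) = \<b> a b \<cdot> \<one>"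
    using mul_cnj_left[OF 1 unit_even] mul_cnj_right[OF 1 unit_even] by simp_all
  have "mmul C (I i a) (I i b) + msc (sg (p * q)) (mmul C (I i b) (I i a))
      = msc 4 (munit (i + 1) (i + 1) (cnj a \<odot> b + sg (p * q) \<cdot> (cnj b \<odot> a))
        + munit (i + 2) (i + 2) (a \<odot> cnj b + sg (p * q) \<cdot> (b \<odot> cnj a)))"
    by (simp add: I_def mmul_rules munit_rules M.scale_right_distrib mult.commute algebra_simps)
  also have "\<dots> = msc 2 (msc (2 * \<b> a b) (E (i + 1) + E (i + 2)))"
    unfolding l r by (simp add: je_def munit_rules M.scale_right_distrib)
  finally show ?case
    unfolding jprod_hom[OF I_mgr[OF 1(1)] I_mgr[OF 1(2)]] scl_H3 by (simp only: half_half)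
qed (simp_all only: jprod_I_linear[OF I_carr] form_rules J.scale_left_distrib distrib_left)

lemma table_II_next: "I i a \<bullet> I (i + 1) b = I (i + 2) (a \<diamondop> b)"
proof (induction a b rule: bi_homogeneous_induct)
  case (1 p q a b)
  have "mmul C (I i a) (I (i + 1) b) + msc (sg (p * q)) (mmul C (I (i + 1) b) (I i a))
      = msc 4 (munit (i + 1) i (a \<diamondop> b) + munit i (i + 1) (sg (p * q) \<cdot> (b \<odot> a)))"
    by (simp add: I_def mmul_rules munit_rules M.scale_right_distrib pprod_def mult.commute)
  also have "\<dots> = msc 2 (I (i + 2) (a \<diamondop> b))"
    using cnj_mul[OF cnj_V[OF 1(1)] cnj_V[OF 1(2)]]
    by (simp add: I_def pprod_def M.scale_right_distrib)
  finally show ?case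
    unfolding jprod_hom[OF I_mgr[OF 1(1)] I_mgr[OF 1(2)]] by (simp only: half_half)
qed (simp_all only: I_rules pprod_rules J.mul_add I_carr)

lemma table_II_prev: "I (i + 1) a \<bullet> I i b = I (i + 2) (a \<lozenge> b)"
proof (induction a b rule: bi_homogeneous_induct)
  case (1 p q a b)
  show ?case
    unfolding jprod_comm[OF I_gr[OF 1(1)] I_gr[OF 1(2)]] table_II_next rprod_hom[OF 1] by simp
qed (simp_all only: I_rules rprod_rules J.mul_add I_carr)

text \<open>
  Products of two different \<open>\<iota>\<^sub>j(S)\<close> are listed for all three positions relative to a fixed \<open>i\<close>, so that the table can
  be used as a set of rewrite rules once the indices \<open>j\<close> have been replaced by \<open>i\<close>, \<open>i + 1\<close> or \<open>i + 2\<close>.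
\<close>

lemmas jtable = table_EE table_EI table_IE table_II_same
  table_II_next table_II_next[of "i + 1" for i, simplified] table_II_next[of "i + 2" for i, simplified]
  table_II_prev table_II_prev[of "i + 1" for i, simplified] table_II_prev[of "i + 2" for i, simplified]

subsection \<open>Coordinates\<close>

lemma J_fixed: "X \<in> J.carr \<Longrightarrow> mstar C X = X"
  by (auto simp: J.carr_gsum gsum_def gr_H3 mstar_rules)

text \<open>
  A diagonal entry \<open>x\<close> satisfies \<open>cnj x = x\<close>, that is \<open>2 x = \<b>(x, 1) 1\<close>. The entry at \<open>(i + 2, i + 1)\<close>
  determines the one at \<open>(i + 1, i + 2)\<close>.
\<close>

lemma J_decomp:
  assumes "X \<in> J.carr"
  shows "X = (\<Sum>i\<in>UNIV. (1 / 2 * \<b> (X i i) \<one>) \<star> E i + I i ((1 / 2) \<cdot> X (i + 2) (i + 1)))"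
proof (intro ext)
  fix r s
  have c: "cnj (X j i) = X i j" for i j
    using J_fixed[OF assms] by (metis mstar_def)
  have d: "(1 / 2 * \<b> (X i i) \<one>) \<cdot> \<one> = X i i" for i
  proof -
    have "\<b> (X i i) \<one> \<cdot> \<one> = X i i + X i i"
      using c[of i i] by (simp add: hconj_def algebra_simps)
    also have "\<dots> = 2 \<cdot> X i i"
      using scale_left_distrib[of 1 1 "X i i"] by (simp only: one_add_one scale_one)
    finally have "(1 / 2) \<cdot> (\<b> (X i i) \<one> \<cdot> \<one>) = (1 / 2) \<cdot> (2 \<cdot> X i i)"
      by simp
    then show ?thesis
      using two by simp
  qed
  show "X r s = (\<Sum>i\<in>UNIV. (1 / 2 * \<b> (X i i) \<one>) \<star> E i + I i ((1 / 2) \<cdot> X (i + 2) (i + 1))) r s"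
    unfolding sum_3[of _ r]
    using index3_cases[of s r] two
    by (auto simp: scl_H3 I_def je_def munit_def c d[simplified])
qed

text \<open>
  The generators of parity \<open>p\<close>: an odd matrix has diagonal \<open>0\<close>, so the \<open>e\<^sub>i\<close> occur only in the even part.
\<close>

lemma J_gr_induct [consumes 1, case_names E I add scale]:
  assumes X: "X \<in> gr J p"
    and E: "\<And>i. p = 0 \<Longrightarrow> P (E i)" and I: "\<And>i a. a \<in> V p \<Longrightarrow> P (I i a)"
    and add: "\<And>X Y. X \<in> gr J p \<Longrightarrow> Y \<in> gr J p \<Longrightarrow> P X \<Longrightarrow> P Y \<Longrightarrow> P (X + Y)"
    and scale: "\<And>c X. X \<in> gr J p \<Longrightarrow> P X \<Longrightarrow> P (c \<star> X)"
  shows "P X"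
proof -
  define D where "D i = (1 / 2 * \<b> (X i i) \<one>) \<star> E i" for i
  define N where "N i = I i ((1 / 2) \<cdot> X (i + 2) (i + 1))" for i
  have x: "X i j \<in> V p" for i j
    using X by (auto simp: gr_H3 mgr_def)
  have D: "D i \<in> gr J p \<and> P (D i)" for i
  proof (cases "p = 0")
    case True
    then show ?thesis
      using E scale E_gr J.subspace_scale[OF J.sub] by (auto simp: D_def)
  next
    case False
    then have "\<b> (X i i) \<one> = 0"
      using form_even[OF x unit_even] by simp
    moreover have "P 0" "0 \<in> gr J p"
      using I[OF V_0] J.subspace_0[OF J.sub] by auto
    ultimately show ?thesis
      by (simp add: D_def)
  qed
  have N: "N i \<in> gr J p \<and> P (N i)" for i
    unfolding N_def using I_gr[OF V_scale[OF x]] I[OF V_scale[OF x]] by blast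
  have s: "X + Y \<in> gr J p \<and> P (X + Y)" if "X \<in> gr J p \<and> P X" "Y \<in> gr J p \<and> P Y" for X Y
    using that add J.subspace_add[OF J.sub] by blast
  have "(D 0 + N 0) + (D 1 + N 1) + (D 2 + N 2) \<in> gr J p \<and> P ((D 0 + N 0) + (D 1 + N 1) + (D 2 + N 2))"
    by (intro s D N)
  moreover have "X = (D 0 + N 0) + (D 1 + N 1) + (D 2 + N 2)"
    using J_decomp[OF J.hom_carr[OF X]] sum_3[of "\<lambda>i. D i + N i" 0] by (simp add: D_def N_def)
  ultimately show ?thesis
    by simp
qed

lemma Ops_eqI:
  assumes f: "f \<in> J.Ops" and g: "g \<in> J.Ops"
    and E: "\<And>i. f (E i) = g (E i)" and I: "\<And>i p a. a \<in> V p \<Longrightarrow> f (I i a) = g (I i a)"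
  shows "f = g"
proof
  fix X
  note F = J.OpsD[OF f] and G = J.OpsD[OF g]
  have h: "f Y = g Y" if "Y \<in> gr J p" for Y p
    using that
  proof (induction rule: J_gr_induct)
    case (I i a)
    then show ?case by (rule assms(4))
  qed (simp_all only: E F G J.hom_carr)
  show "f X = g X"
  proof (cases "X \<in> J.carr")
    case True
    then obtain Y Z where "Y \<in> gr J 0" "Z \<in> gr J 1" "X = Y + Z"
      by (metis J.gsumE J.carr_gsum)
    then show ?thesis
      using h by (simp add: F G J.hom_carr)
  qed (simp add: F G)
qed

section \<open>Derivations of the Jordan superalgebra\<close>

abbreviation coord where "coord i X \<equiv> (1 / 2) \<cdot> X (i + 2) (i + 1)"

lemma coord_I: "coord i (I i a) = a"
  using two by (simp add: I_def munit_def)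

lemma four_neq_0: "(4::'k) \<noteq> 0"
proof -
  have "(4::'k) = 2 * 2" by simp
  then show ?thesis using two by (metis mult_eq_0_iff)
qed

lemma I_inject: "I i a = I i b \<longleftrightarrow> a = b"
  using coord_I by metis

lemma J_coords:
  assumes "X \<in> J.carr"
  shows "\<exists>\<alpha>. X = \<alpha> i \<star> E i + I i (coord i X) + (\<alpha> (i + 1) \<star> E (i + 1) + I (i + 1) (coord (i + 1) X))
    + (\<alpha> (i + 2) \<star> E (i + 2) + I (i + 2) (coord (i + 2) X))"
proof
  show "X = (1 / 2 * \<b> (X i i) \<one>) \<star> E i + I i (coord i X)
    + ((1 / 2 * \<b> (X (i + 1) (i + 1)) \<one>) \<star> E (i + 1) + I (i + 1) (coord (i + 1) X))
    + ((1 / 2 * \<b> (X (i + 2) (i + 2)) \<one>) \<star> E (i + 2) + I (i + 2) (coord (i + 2) X))"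
    using J_decomp[OF assms] unfolding sum_3[of _ i] .
qed

lemmas jcarr = J.carr_add J.carr_scale J.carr_diff J.carr_neg J.carr_0 J.mul_carr
lemmas jmul = J.mul_add J.mul_diff J.mul_neg J.mul_0 J.mul_scale jcarr

text \<open>
  The Peirce projection onto \<open>\<iota>\<^sub>i(S)\<close>: multiplication by \<open>e\<^sub>i\<^sub>+\<^sub>1\<close> and \<open>e\<^sub>i\<^sub>+\<^sub>2\<close> in turn kills every component
  except this one, where each of them halves. Expressing the projection by products
  is what makes it commute with derivations that kill the idempotents.
\<close>

lemma peirce_projection:
  assumes "X \<in> J.carr"
  shows "2 \<star> 2 \<star> (E (i + 1) \<bullet> (E (i + 2) \<bullet> X)) = I i (coord i X)"
proof -
  define x where "x = (\<lambda>i. coord i X)"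
  define a where "a = coord i X"
  obtain \<alpha> where X: "X = \<alpha> i \<star> E i + I i (coord i X) + (\<alpha> (i + 1) \<star> E (i + 1) + I (i + 1) (x (i + 1)))
    + (\<alpha> (i + 2) \<star> E (i + 2) + I (i + 2) (x (i + 2)))"
    using J_coords[OF assms, of i] unfolding x_def by blast
  have "E (i + 2) \<bullet> X = \<alpha> (i + 2) \<star> E (i + 2) + (1 / 2) \<star> I i a + (1 / 2) \<star> I (i + 1) (x (i + 1))"
    by (subst X, fold a_def) (simp add: jmul jtable algebra_simps)
  then have "E (i + 1) \<bullet> (E (i + 2) \<bullet> X) = (1 / 2) \<star> (1 / 2) \<star> I i a"
    by (simp add: jmul jtable)
  moreover have "2 * (2 * (1 / 2 * (1 / 2))) = (1 :: 'k)"
    using two four_neq_0 by (simp add: field_simps)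
  ultimately show ?thesis
    by (simp only: J.scale_scale J.scale_one a_def)
qed

lemma Lmul_add: "X \<in> J.carr \<Longrightarrow> Y \<in> J.carr \<Longrightarrow> Lmul J (X + Y) = Lmul J X + Lmul J Y"
  and Lmul_scale: "X \<in> J.carr \<Longrightarrow> Lmul J (c \<star> X) = fscl (scl J) c (Lmul J X)"
  by (auto simp: Lmul_def fscl_def fun_eq_iff J.mul_add J.mul_scale)

lemma Lmul_Ops: "X \<in> J.carr \<Longrightarrow> Lmul J X \<in> J.Ops"
proof -
  assume "X \<in> J.carr"
  then obtain Y Z where X: "Y \<in> gr J 0" "Z \<in> gr J 1" "X = Y + Z"
    by (metis J.gsumE J.carr_gsum)
  then show ?thesis
    using J.E.gsumI[OF J.Lmul_Endo[OF X(1)] J.Lmul_Endo[OF X(2)]] by (simp add: Lmul_add J.hom_carr)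
qed

subsection \<open>The operators \<open>D\<^sub>i(a)\<close>\<close>

abbreviation D where "D \<equiv> Diota C"

lemma D_add: "D i (a + b) = D i a + D i b"
  by (simp add: Diota_def Lmul_add J.scomm_add Lmul_Ops J.Op.scale_right_distrib)

lemma D_scale: "D i (c \<cdot> a) = fscl (scl J) c (D i a)"
  by (simp add: Diota_def Lmul_scale J.scomm_scale Lmul_Ops mult.commute)

lemma D_Endo: "a \<in> V p \<Longrightarrow> D i a \<in> Endo J p"
  using J.Op.subspace_scale[OF J.Endo_subspace J.scomm_Endo[OF J.Lmul_Endo[OF I_gr] J.Lmul_Endo[OF E_gr]]]
  unfolding Diota_def by (metis add_0_right)

text \<open>
  Since \<open>e\<^sub>i\<^sub>+\<^sub>1\<close> is even, the supercommutator is an ordinary commutator whatever the parity of \<open>a\<close>, so the values of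
  \<open>D\<^sub>i(a)\<close> are given by sign-free formulas.
\<close>

lemma D_apply:
  assumes "X \<in> J.carr"
  shows "D i a X = 2 \<star> (I i a \<bullet> (E (i + 1) \<bullet> X) - E (i + 1) \<bullet> (I i a \<bullet> X))"
proof -
  have h: "D i a X = 2 \<star> (I i a \<bullet> (E (i + 1) \<bullet> X) - E (i + 1) \<bullet> (I i a \<bullet> X))" if a: "a \<in> V p" for a p
    unfolding Diota_def J.scomm_hom[OF J.Lmul_Endo[OF I_gr[OF a]] J.Lmul_Endo[OF E_gr]]
    using assms by (simp add: fscl_def Lmul_def J.mul_carr J.mul_0 jcarr)
  have "D i (b + c) X = 2 \<star> (I i (b + c) \<bullet> (E (i + 1) \<bullet> X) - E (i + 1) \<bullet> (I i (b + c) \<bullet> X))"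
    if "b \<in> V 0" "c \<in> V 1" for b c
    using assms by (simp add: D_add h[OF that(1)] h[OF that(2)] jmul algebra_simps)
  from this[OF hp_V hp_V, of a a] show ?thesis
    by (simp only: hp_decomp)
qed

lemma D_E:
  "D i a (E i) = 0" "D i a (E (i + 1)) = (1 / 2) \<star> I i a" "D i a (E (i + 2)) = - ((1 / 2) \<star> I i a)"
proof -
  have h: "2 \<star> ((1 / 2) \<star> X - (1 / 2) \<star> (1 / 2) \<star> X) = (1 / 2) \<star> X" for X
  proof -
    have "(2 :: 'k) * (1 / 2 - 1 / 2 * (1 / 2)) = 1 / 2"
      using two four_neq_0 by (simp add: field_simps)
    then show ?thesis
      by (metis J.scale_left_diff_distrib J.scale_scale)
  qed
  show "D i a (E i) = 0" "D i a (E (i + 1)) = (1 / 2) \<star> I i a" "D i a (E (i + 2)) = - ((1 / 2) \<star> I i a)"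
    using h[of "I i a"] two four_neq_0 unfolding D_apply[OF E_carr] by (simp_all add: jtable jmul J.scale_right_diff_distrib)
qed

lemma D_I:
  "D i a (I i b) = (2 * \<b> a b) \<star> (E (i + 2) - E (i + 1))"
  "D i a (I (i + 1) b) = - I (i + 2) (a \<diamondop> b)"
  "D i a (I (i + 2) b) = I (i + 1) (a \<lozenge> b)"
proof -
  have "2 \<star> ((1 / 2) \<star> X + (1 / 2) \<star> Y - X) = Y - X" for X Y
  proof -
    have "2 \<star> ((1 / 2) \<star> X + (1 / 2) \<star> Y - X) = 2 \<star> (1 / 2) \<star> X + 2 \<star> (1 / 2) \<star> Y - 2 \<star> X"
      by (simp only: J.scale_right_distrib J.scale_right_diff_distrib)
    also have "\<dots> = Y - X"
      using two J.scale_left_distrib[of 1 1 X] by simp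
    finally show ?thesis .
  qed
  from this[of "(2 * \<b> a b) \<star> E (i + 1)" "(2 * \<b> a b) \<star> E (i + 2)"]
  show "D i a (I i b) = (2 * \<b> a b) \<star> (E (i + 2) - E (i + 1))"
    unfolding D_apply[OF I_carr]
    by (simp add: jtable jmul J.scale_right_distrib J.scale_right_diff_distrib mult.commute del: J.scale_scale)
  show "D i a (I (i + 1) b) = - I (i + 2) (a \<diamondop> b)" "D i a (I (i + 2) b) = I (i + 1) (a \<lozenge> b)"
    using two unfolding D_apply[OF I_carr] by (simp_all add: jtable jmul)
qed

lemmas D_table = D_E D_E[of "i + 1" for i, simplified] D_E[of "i + 2" for i, simplified]
  D_I D_I[of "i + 1" for i, simplified] D_I[of "i + 2" for i, simplified]

subsection \<open>Derivations tested on generators\<close>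

text \<open>
  By supercommutativity, the Leibniz rule for \<open>(X, Y)\<close> implies the one for \<open>(Y, X)\<close>. This halves the checks
  on pairs of generators.
\<close>

lemma derivation_law_sym:
  assumes f: "f \<in> Endo J p" and X: "X \<in> gr J q" and Y: "Y \<in> gr J r"
    and law: "f (X \<bullet> Y) = f X \<bullet> Y + sg (p * q) \<star> (X \<bullet> f Y)"
  shows "f (Y \<bullet> X) = f Y \<bullet> X + sg (p * r) \<star> (Y \<bullet> f X)"
proof -
  note fX = J.EndoD(4)[OF f X] and fY = J.EndoD(4)[OF f Y]
  note c = J.hom_carr[OF X] J.hom_carr[OF Y] J.hom_carr[OF fX] J.hom_carr[OF fY]
  have 1: "f (Y \<bullet> X) = sg (r * q) \<star> f (X \<bullet> Y)"
    unfolding jprod_comm[OF Y X] by (simp add: J.EndoD[OF f] jcarr c)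
  show ?thesis
    unfolding 1 law jprod_comm[OF fX Y] jprod_comm[OF X fY]
    by (cases p; cases q; cases r) (simp_all add: algebra_simps)
qed

text \<open>
  The Leibniz rule is bilinear, so it suffices to check it on pairs of generators. Two elements of
  different \<open>\<iota>\<^sub>i(S)\<close> can be ordered so that the index grows by \<open>1\<close>.
\<close>

lemma derivation_on_generators:
  assumes f: "f \<in> Endo J p"
    and EE: "\<And>i j. f (E i \<bullet> E j) = f (E i) \<bullet> E j + E i \<bullet> f (E j)"
    and EI: "\<And>i j q a. a \<in> V q \<Longrightarrow> f (E j \<bullet> I i a) = f (E j) \<bullet> I i a + E j \<bullet> f (I i a)"
    and same: "\<And>i q r a b. a \<in> V q \<Longrightarrow> b \<in> V r \<Longrightarrow>
      f (I i a \<bullet> I i b) = f (I i a) \<bullet> I i b + sg (p * q) \<star> (I i a \<bullet> f (I i b))"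
    and succ: "\<And>i q r a b. a \<in> V q \<Longrightarrow> b \<in> V r \<Longrightarrow>
      f (I i a \<bullet> I (i + 1) b) = f (I i a) \<bullet> I (i + 1) b + sg (p * q) \<star> (I i a \<bullet> f (I (i + 1) b))"
  shows "f \<in> gr (der J) p"
proof -
  note F = J.OpsD[OF J.E.hom_gsum[OF f]]
  let ?law = "\<lambda>q X Y. f (X \<bullet> Y) = f X \<bullet> Y + sg (p * q) \<star> (X \<bullet> f Y)"
  have II: "?law q (I i a) (I j b)" if a: "a \<in> V q" and b: "b \<in> V r" for q r i j a b
  proof -
    consider "j = i" | "j = i + 1" | "j = i + 2"
      using index3_cases by blast
    then show ?thesis
    proof cases
      case 3
      then have "i = j + 1" by simp
      then show ?thesis
        using derivation_law_sym[OF f I_gr[OF b] I_gr[OF a]] succ[OF b a, of j] by blast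
    qed (use same[OF a b] succ[OF a b] in simp_all)
  qed
  have IE: "?law q (I i a) (E j)" if a: "a \<in> V q" for q i j a
    using derivation_law_sym[OF f E_gr I_gr[OF a], of j i] EI[OF a, of j i] by simp
  have h2: "?law q X Y" if X: "X \<in> gr J q" and Y: "Y \<in> gr J r" for q r X Y
    using X
  proof (induction rule: J_gr_induct)
    case (E i)
    show ?case
      using Y
    proof (induction rule: J_gr_induct)
      case (E j)
      show ?case using \<open>q = 0\<close> EE by simp
    next
      case (I j a)
      show ?case using \<open>q = 0\<close> EI[OF I] by simp
    qed (simp_all only: F jmul E_carr J.hom_carr J.scale_right_distrib J.scale_left_commute add_ac)
  next
    case (I i a)
    show ?case
      using Y
    proof (induction rule: J_gr_induct)
      case (E j)
      show ?case using IE[OF I] .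
    next
      case (I j b)
      show ?case using II[OF \<open>a \<in> V q\<close> I] .
    qed (simp_all only: F jmul I_carr J.hom_carr J.scale_right_distrib J.scale_left_commute add_ac)
  qed (simp_all only: F jmul J.hom_carr[OF Y] J.hom_carr J.scale_right_distrib J.scale_left_commute add_ac)
  show ?thesis
  proof (rule J.derI[OF f])
    fix X Y q assume X: "X \<in> gr J q" and "Y \<in> J.carr"
    then obtain Z W where Y: "Z \<in> gr J 0" "W \<in> gr J 1" "Y = Z + W"
      by (metis J.gsumE J.carr_gsum)
    show "?law q X Y"
      unfolding Y(3)
      by (simp only: F jmul J.hom_carr[OF X] J.hom_carr[OF Y(1)] J.hom_carr[OF Y(2)] h2[OF X Y(1)] h2[OF X Y(2)]
          J.scale_right_distrib add_ac)
  qed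
qed

subsection \<open>The identities of the product behind the derivations\<close>

lemma form_rprod:
  assumes "a \<in> V p" "b \<in> V q" "c \<in> V r"
  shows "sg (p * q) * \<b> b (a \<lozenge> c) = \<b> a (b \<diamondop> c)"
  using form_assoc[of b c a] form_sym[OF pprod_V[OF assms(2,3)] assms(1)]
  by (cases p; cases q; cases r) (simp_all add: rprod_hom[OF assms(1,3)] neg_eq_iff_add_eq_0 add.commute)

text \<open>
  The two identities of a symmetric composition, solved for one of the products in each of the shapes in which
  they occur below. The parities are compatible with the signs because \<open>\<b>\<close> vanishes on vectors of different parity.
\<close>

lemma prod_identities:
  assumes a: "a \<in> V p" and b: "b \<in> V q" and c: "c \<in> V r"
  shows "(a \<diamondop> b) \<lozenge> c = \<b> b c \<cdot> a - sg (p * q) \<cdot> (b \<diamondop> (a \<diamondop> c))"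
    "(a \<lozenge> b) \<diamondop> c = \<b> b c \<cdot> a - sg (p * q) \<cdot> (b \<lozenge> (a \<lozenge> c))"
    "a \<lozenge> (b \<diamondop> c) = \<b> a b \<cdot> c - sg (p * q) \<cdot> (b \<lozenge> (a \<diamondop> c))"
    "a \<diamondop> (b \<lozenge> c) = \<b> a b \<cdot> c - sg (p * q) \<cdot> (b \<diamondop> (a \<lozenge> c))"
    "a \<diamondop> (b \<diamondop> c) = (sg (p * q) * \<b> a c) \<cdot> b - (a \<lozenge> b) \<lozenge> c"
    "a \<lozenge> (b \<lozenge> c) = (sg (p * q) * \<b> a c) \<cdot> b - (a \<diamondop> b) \<diamondop> c"
proof -
  note r = rprod_hom[OF a b] rprod_hom[OF b c] rprod_hom[OF a c]
    rprod_hom[OF pprod_V[OF a b] c] rprod_hom[OF b pprod_V[OF a c]] rprod_hom[OF a pprod_V[OF b c]]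
    rprod_hom[OF b pprod_V[OF c a]] rprod_hom[OF a pprod_V[OF c b]] rprod_hom[OF pprod_V[OF b a] c]
  note e = form_even[OF a b] form_even[OF b c] form_even[OF a c]
  show "(a \<diamondop> b) \<lozenge> c = \<b> b c \<cdot> a - sg (p * q) \<cdot> (b \<diamondop> (a \<diamondop> c))"
    using symmetric_composition(1)[OF b a c] e
    by (cases p; cases q; cases r) (simp_all add: r algebra_simps eq_neg_iff_add_eq_0)
  show "(a \<lozenge> b) \<diamondop> c = \<b> b c \<cdot> a - sg (p * q) \<cdot> (b \<lozenge> (a \<lozenge> c))"
    using symmetric_composition(2)[OF b a c] e
    by (cases p; cases q; cases r) (simp_all add: r algebra_simps eq_neg_iff_add_eq_0)
  show "a \<lozenge> (b \<diamondop> c) = \<b> a b \<cdot> c - sg (p * q) \<cdot> (b \<lozenge> (a \<diamondop> c))"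
    using symmetric_composition(2)[OF a c b] e
    by (cases p; cases q; cases r) (simp_all add: r algebra_simps eq_neg_iff_add_eq_0)
  show "a \<diamondop> (b \<lozenge> c) = \<b> a b \<cdot> c - sg (p * q) \<cdot> (b \<diamondop> (a \<lozenge> c))"
    using symmetric_composition(1)[OF a c b] e
    by (cases p; cases q; cases r) (simp_all add: r algebra_simps eq_neg_iff_add_eq_0)
  show "a \<diamondop> (b \<diamondop> c) = (sg (p * q) * \<b> a c) \<cdot> b - (a \<lozenge> b) \<lozenge> c"
    using symmetric_composition(1)[OF a b c] e
    by (cases p; cases q; cases r) (simp_all add: r algebra_simps eq_neg_iff_add_eq_0)
  show "a \<lozenge> (b \<lozenge> c) = (sg (p * q) * \<b> a c) \<cdot> b - (a \<diamondop> b) \<diamondop> c"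
    using symmetric_composition(2)[OF a b c] e
    by (cases p; cases q; cases r) (simp_all add: r algebra_simps eq_neg_iff_add_eq_0)
qed

text \<open>
  On each pair of generators, the Leibniz rule for \<open>D\<^sub>i(a)\<close> becomes by the tables either trivial, or one of
  the preceding identities, or associativity of the form.
\<close>

lemma D_der:
  assumes a: "a \<in> V p"
  shows "D i a \<in> gr (der J) p"
proof (rule derivation_on_generators[OF D_Endo[OF a]])
  note F = J.OpsD[OF J.E.hom_gsum[OF D_Endo[OF a]]] J.Ops_diff[OF J.E.hom_gsum[OF D_Endo[OF a]]]
  have q: "(1 / 2) \<star> (1 / 2) \<star> X + (1 / 2) \<star> (1 / 2) \<star> X = (1 / 2) \<star> X" for X
    using two four_neq_0 by (simp add: field_simps flip: J.scale_left_distrib)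
  have q': "- ((1 / 2) \<star> (1 / 2) \<star> X) - (1 / 2) \<star> (1 / 2) \<star> X = - ((1 / 2) \<star> X)" for X
    using q[of X] by (metis minus_add_distrib diff_conv_add_uminus)
  have dbl: "(2 * c) \<star> X = c \<star> X + c \<star> X" for c X
    unfolding J.scale_left_distrib[symmetric] by simp
  note s = J.scale_right_distrib J.scale_right_diff_distrib
  have j: "j = i \<or> j = i + 1 \<or> j = i + 2" for j
    by (rule index3_cases)
  show "D i a (E j \<bullet> E k) = D i a (E j) \<bullet> E k + E j \<bullet> D i a (E k)" for j k
    using j[of j] j[of k] by (auto simp: jtable jmul D_table F q q' simp del: J.scale_scale)
  show "D i a (E j \<bullet> I k b) = D i a (E j) \<bullet> I k b + E j \<bullet> D i a (I k b)" if "b \<in> V q" for j k b q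
    using j[of j] j[of k] two by (auto simp: jtable jmul D_table F s) (simp_all add: algebra_simps dbl)
  show "D i a (I k b \<bullet> I k c) = D i a (I k b) \<bullet> I k c + sg (p * q) \<star> (I k b \<bullet> D i a (I k c))"
    if b: "b \<in> V q" and c: "c \<in> V r" for k b c q r
    using j[of k] two
    by (auto simp: jtable jmul D_table F s prod_identities[OF a b c])
  show "D i a (I k b \<bullet> I (k + 1) c) = D i a (I k b) \<bullet> I (k + 1) c + sg (p * q) \<star> (I k b \<bullet> D i a (I (k + 1) c))"
    if b: "b \<in> V q" and c: "c \<in> V r" for k b c q r
    using j[of k] two
    by (auto simp: jtable jmul D_table F s prod_identities[OF a b c] form_assoc form_rprod[OF a b c, symmetric])
      (simp_all add: algebra_simps dbl)
qed

section \<open>Triality and the derivations that kill the idempotents\<close>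

sublocale P: super_algebra "para C"
  rewrites "scl (para C) = scl C" and "gr (para C) = gr C" and "scarrier (para C) = UNIV"
  by (rule super_algebra.intro[OF S.superalgebra]) (simp_all add: S.full)

abbreviation PEndo where "PEndo \<equiv> Endo (para C)"
abbreviation T where "T \<equiv> gr (tri (para C))"

lemma tri_iff: "d \<in> T p \<longleftrightarrow> (\<forall>i. d i \<in> PEndo p) \<and>
   (\<forall>i q. \<forall>x\<in>V q. \<forall>y. \<b> (d i x) y + sg (p * q) * \<b> x (d i y) = 0) \<and>
   (\<forall>q. \<forall>x\<in>V q. \<forall>y. d 0 (x \<diamondop> y) = d 1 x \<diamondop> y + sg (p * q) \<cdot> (x \<diamondop> d 2 y))"
  by (auto simp: tri_def osp_def S.full)

lemma triD:
  assumes "d \<in> T p"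
  shows "d i \<in> PEndo p"
    "x \<in> V q \<Longrightarrow> \<b> (d i x) y + sg (p * q) * \<b> x (d i y) = 0"
    "x \<in> V q \<Longrightarrow> d 0 (x \<diamondop> y) = d 1 x \<diamondop> y + sg (p * q) \<cdot> (x \<diamondop> d 2 y)"
  using assms unfolding tri_iff by blast+

lemma PEndo_rules:
  assumes "f \<in> PEndo p"
  shows "f (x + y) = f x + f y" "f (c \<cdot> x) = c \<cdot> f x" "f (x - y) = f x - f y" "f (- x) = - f x" "f 0 = 0"
    "x \<in> V q \<Longrightarrow> f x \<in> V (p + q)"
  using P.EndoD[OF assms] P.OpsD(5)[OF P.E.hom_gsum[OF assms]] P.Ops_diff[OF P.E.hom_gsum[OF assms]]
  by simp_all

lemma tri_skew:
  assumes "d \<in> T p" "x \<in> V q"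
  shows "\<b> (d i x) y = - (sg (p * q) * \<b> x (d i y))" "\<b> x (d i y) = - (sg (p * q) * \<b> (d i x) y)"
proof -
  show 1: "\<b> (d i x) y = - (sg (p * q) * \<b> x (d i y))"
    using triD(2)[OF assms, of i y] by (simp add: eq_neg_iff_add_eq_0)
  show "\<b> x (d i y) = - (sg (p * q) * \<b> (d i x) y)"
    unfolding 1 by simp
qed

lemma form_nondeg_right:
  assumes "\<And>q y. y \<in> V q \<Longrightarrow> \<b> y u = \<b> y v"
  shows "u = v"
proof (rule form_nondeg)
  fix q y assume y: "y \<in> V q"
  have h: "\<b> x y = sg q * \<b> y x" for x
  proof (induction x rule: homogeneous_induct)
    case (homogeneous p x)
    show ?case
      using form_sym[OF homogeneous y] form_even[OF homogeneous y] form_even[OF y homogeneous]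
      by (cases p; cases q) auto
  qed (simp_all add: algebra_simps)
  show "\<b> u y = \<b> v y"
    using assms[OF y] by (simp add: h)
qed

text \<open>
  The triality condition singles out the index \<open>0\<close>, but associativity of the form and skewness of
  the components make it invariant under the cyclic shift of the indices.
\<close>

lemma tri_cyclic:
  assumes d: "d \<in> T p" and x: "x \<in> V q"
  shows "d (i + 2) (x \<diamondop> y) = d i x \<diamondop> y + sg (p * q) \<cdot> (x \<diamondop> d (i + 1) y)"
proof -
  have step: "d i (y \<diamondop> z) = d (i + 1) y \<diamondop> z + sg (p * r) \<cdot> (y \<diamondop> d (i + 2) z)"
    if t: "\<And>q x y. x \<in> V q \<Longrightarrow> d (i + 2) (x \<diamondop> y) = d i x \<diamondop> y + sg (p * q) \<cdot> (x \<diamondop> d (i + 1) y)"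
      and y: "y \<in> V r" for i r y z
  proof (rule form_nondeg_right)
    fix q x assume x: "x \<in> V q"
    have "\<b> (d i x) (y \<diamondop> z) = \<b> (d i x \<diamondop> y) z"
      by (simp add: form_assoc)
    also have "\<dots> = \<b> (d (i + 2) (x \<diamondop> y)) z - sg (p * q) * \<b> x (d (i + 1) y \<diamondop> z)"
      by (simp add: t[OF x] form_assoc)
    finally have 1: "\<b> (d i x) (y \<diamondop> z) = \<b> (d (i + 2) (x \<diamondop> y)) z - sg (p * q) * \<b> x (d (i + 1) y \<diamondop> z)" .
    have 2: "\<b> (d (i + 2) (x \<diamondop> y)) z = - (sg (p * (q + r)) * \<b> x (y \<diamondop> d (i + 2) z))"
      using tri_skew(1)[OF d pprod_V[OF x y]] by (simp add: form_assoc)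
    show "\<b> x (d i (y \<diamondop> z)) = \<b> x (d (i + 1) y \<diamondop> z + sg (p * r) \<cdot> (y \<diamondop> d (i + 2) z))"
      unfolding tri_skew(2)[OF d x, of i "y \<diamondop> z"] 1 2
      by (cases p; cases q; cases r) simp_all
  qed
  have n: "(1::3) + 1 = 2" "(1::3) + 2 = 0" "(2::3) + 1 = 0" "(2::3) + 2 = 1"
    by simp_all
  have t1: "d (1 + 2) (x \<diamondop> y) = d 1 x \<diamondop> y + sg (p * q) \<cdot> (x \<diamondop> d (1 + 1) y)" if "x \<in> V q" for x y q
    unfolding n by (rule triD(3)[OF d that])
  have t2: "d (2 + 2) (x \<diamondop> y) = d 2 x \<diamondop> y + sg (p * q) \<cdot> (x \<diamondop> d (2 + 1) y)" if "x \<in> V q" for x y q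
    using step[of 1, OF t1 that] unfolding n by simp
  have t0: "d (0 + 2) (x \<diamondop> y) = d 0 x \<diamondop> y + sg (p * q) \<cdot> (x \<diamondop> d (0 + 1) y)" if "x \<in> V q" for x y q
    using step[of 2, OF t2 that] unfolding n by simp
  have "i = 0 \<or> i = 1 \<or> i = 2"
    using index3_cases[of i 0] by simp
  then show ?thesis
    using t0[OF x] t1[OF x] t2[OF x] by auto
qed

lemma
  assumes "\<And>j. d j \<in> PEndo p"
  shows Dtri_E: "Dtri C d (E i) = 0" and Dtri_I: "Dtri C d (I i a) = I i (d i a)"
proof -
  have "linear_on (scl C) (scl C) UNIV (d j)" for j
    using PEndo_rules(1,2)[OF assms] by (simp add: linear_on_def)
  then show "Dtri C d (E i) = 0" "Dtri C d (I i a) = I i (d i a)"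
    using Dtri_je[OF hurwitz full] Dtri_jiota[OF hurwitz full _ two] by blast+
qed

lemma Dtri_Endo:
  assumes d: "\<And>j. d j \<in> PEndo p"
  shows "Dtri C d \<in> Endo J p"
proof (rule J.EndoI)
  note l = PEndo_rules[OF d]
  fix X Y c q
  show "Dtri C d (X + Y) = Dtri C d X + Dtri C d Y" if "X \<in> J.carr" "Y \<in> J.carr"
    using that J.carr_add[OF that] by (simp add: Dtri_def scale_right_distrib l(1) sum.distrib)
  have c: "(1 / 2) \<cdot> c \<cdot> x = c \<cdot> (1 / 2) \<cdot> x" for x
    by (simp add: mult.commute)
  show "Dtri C d (c \<star> X) = c \<star> Dtri C d X" if "X \<in> J.carr"
    using that J.carr_scale[OF that]
    by (simp add: Dtri_def scl_H3 c l(2) M.scale_sum_right I_rules(2)[unfolded scl_H3] del: scale_scale)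
  show "Dtri C d X = 0" if "X \<notin> J.carr"
    using that by (simp add: Dtri_def)
  show "Dtri C d X \<in> gr J (p + q)" if "X \<in> gr J q"
  proof -
    have "I i (d i (coord i X)) \<in> gr J (p + q)" for i
      using that by (intro I_gr l(6) V_scale) (auto simp: gr_H3 mgr_def)
    then show ?thesis
      using J.hom_carr[OF that] by (auto simp: Dtri_def intro!: J.subspace_sum[OF J.sub])
  qed
qed

lemma tri_rprod:
  assumes d: "d \<in> T p" and a: "a \<in> V q" and b: "b \<in> V r"
  shows "d (i + 1) (a \<lozenge> b) = d i a \<lozenge> b + sg (p * q) \<cdot> (a \<lozenge> d (i + 2) b)"
proof -
  note l = PEndo_rules[OF triD(1)[OF d]]
  show ?thesis
    using tri_cyclic[OF d b, of "i + 2" a]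
    by (cases p; cases q; cases r; simp add: rprod_hom[OF a b] rprod_hom[OF l(6)[OF a] b]
        rprod_hom[OF a l(6)[OF b]] l; (simp add: algebra_simps)?)
qed

lemma Dtri_der:
  assumes d: "d \<in> T p"
  shows "Dtri C d \<in> gr (der J) p"
proof (rule derivation_on_generators[OF Dtri_Endo[OF triD(1)[OF d]]])
  note F = J.OpsD[OF J.E.hom_gsum[OF Dtri_Endo[OF triD(1)[OF d]]]]
  note tab = jtable jmul Dtri_E[OF triD(1)[OF d]] Dtri_I[OF triD(1)[OF d]] F
  show "Dtri C d (E i \<bullet> E j) = Dtri C d (E i) \<bullet> E j + E i \<bullet> Dtri C d (E j)" for i j
    by (simp add: tab)
  show "Dtri C d (E j \<bullet> I i a) = Dtri C d (E j) \<bullet> I i a + E j \<bullet> Dtri C d (I i a)" if "a \<in> V q" for i j a q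
    by (simp add: tab)
  show "Dtri C d (I i a \<bullet> I i b) = Dtri C d (I i a) \<bullet> I i b + sg (p * q) \<star> (I i a \<bullet> Dtri C d (I i b))"
    if a: "a \<in> V q" and "b \<in> V r" for i a b q r
  proof -
    have "2 * \<b> (d i a) b + sg (p * q) * (2 * \<b> a (d i b)) = 0"
      using triD(2)[OF d a, of i b] by (metis distrib_left mult.left_commute mult_zero_right)
    then have "(2 * \<b> (d i a) b + sg (p * q) * (2 * \<b> a (d i b))) \<star> (E (i + 1) + E (i + 2)) = 0"
      by simp
    then show ?thesis
      by (simp add: tab J.scale_left_distrib)
  qed
  show "Dtri C d (I i a \<bullet> I (i + 1) b)
      = Dtri C d (I i a) \<bullet> I (i + 1) b + sg (p * q) \<star> (I i a \<bullet> Dtri C d (I (i + 1) b))"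
    if a: "a \<in> V q" and "b \<in> V r" for i a b q r
    by (simp add: tab tri_cyclic[OF d a])
qed

text \<open>
  A derivation that kills the idempotents \<open>e\<^sub>i\<close> commutes with their multiplications, hence preserves
  the Peirce components \<open>\<iota>\<^sub>i(S)\<close>; the products of these components say that it is given there by a
  triple in \<open>tri S\<close>.
\<close>

lemma derivation_killing_idempotents:
  assumes f: "f \<in> gr (der J) p" and 0: "\<And>i. f (E i) = 0"
  obtains d where "d \<in> T p" "f = Dtri C d"
proof
  note fE = J.der_Endo[OF f]
  note F = J.OpsD[OF J.E.hom_gsum[OF fE]]
  define d where "d i a = coord i (f (I i a))" for i a
  have E: "f (E i \<bullet> X) = E i \<bullet> f X" if "X \<in> J.carr" for X i
    using J.derD[OF f E_gr that, of i] that by (simp add: 0 F jmul)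
  have fI: "f (I i a) = I i (d i a)" for i a
  proof -
    have "f (I i a) = f (2 \<star> 2 \<star> (E (i + 1) \<bullet> (E (i + 2) \<bullet> I i a)))"
      unfolding peirce_projection[OF I_carr] coord_I ..
    also have "\<dots> = 2 \<star> 2 \<star> (E (i + 1) \<bullet> (E (i + 2) \<bullet> f (I i a)))"
      by (simp add: F E jmul del: J.scale_scale)
    also have "\<dots> = I i (d i a)"
      unfolding d_def by (rule peirce_projection) (simp add: F)
    finally show ?thesis .
  qed
  have dE: "d i \<in> PEndo p" for i
  proof (rule P.EndoI)
    fix x y c q
    show "d i (x + y) = d i x + d i y" "d i (c \<cdot> x) = c \<cdot> d i x"
      unfolding I_inject[of i, symmetric] fI[symmetric] I_rules by (simp_all add: F fI)
    show "d i x \<in> V (p + q)" if "x \<in> V q"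
      using J.EndoD(4)[OF fE I_gr[OF that]] by (auto simp: d_def gr_H3 mgr_def intro!: V_scale)
  qed simp
  show "d \<in> T p"
    unfolding tri_iff
  proof (intro conjI allI ballI dE)
    fix i q x y assume x: "x \<in> V q"
    have "(2 * \<b> (d i x) y + sg (p * q) * (2 * \<b> x (d i y))) \<star> (E (i + 1) + E (i + 2)) = 0"
      using J.derD[OF f I_gr[OF x] I_carr, of i i y]
      by (simp add: fI jtable jmul F 0 J.scale_left_distrib)
    then have "((2 * \<b> (d i x) y + sg (p * q) * (2 * \<b> x (d i y))) \<star> (E (i + 1) + E (i + 2))) (i + 1) (i + 1) = 0"
      by (simp only: zero_fun_apply)
    then have "(2 * \<b> (d i x) y + sg (p * q) * (2 * \<b> x (d i y))) \<cdot> \<one> = 0"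
      unfolding scl_H3 by (simp add: je_def munit_def)
    moreover have "2 * u + s * (2 * v) = 2 * (u + s * v)" for u v s :: 'k
      by (simp add: algebra_simps)
    ultimately consider "2 * (\<b> (d i x) y + sg (p * q) * \<b> x (d i y)) = 0" | "\<one> = 0"
      by (metis scale_eq_0_iff)
    then show "\<b> (d i x) y + sg (p * q) * \<b> x (d i y) = 0"
    proof cases
      case 1
      then show ?thesis using two by (metis mult_eq_0_iff)
    next
      case 2
      \<comment> \<open>The zero algebra, where \<open>E\<close> does not determine its coefficients.\<close>
      then have "z = 0" for z :: 'v
        using unit_mul(1)[of z] by simp
      then have "\<b> u v = 0" for u v
        using form_rules(9) by metis
      then show ?thesis by simp
    qed
  next
    fix q x y assume x: "x \<in> V q"
    have 3: "(3::3) = 0"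
      by simp
    have "I 0 (d 0 (x \<diamondop> y)) = I 0 (d 1 x \<diamondop> y + sg (p * q) \<cdot> (x \<diamondop> d 2 y))"
      using J.derD[OF f I_gr[OF x] I_carr, of 1 2 y] table_II_next[of 1] by (simp add: fI 3)
    then show "d 0 (x \<diamondop> y) = d 1 x \<diamondop> y + sg (p * q) \<cdot> (x \<diamondop> d 2 y)"
      by (simp only: I_inject)
  qed
  show "f = Dtri C d"
    by (rule Ops_eqI[OF J.E.hom_gsum[OF fE] J.E.hom_gsum[OF Dtri_Endo[OF dE]]])
      (simp_all only: 0 fI Dtri_E[OF dE] Dtri_I[OF dE])
qed

subsection \<open>Brackets of the operators\<close>

lemma scomm_apply:
  assumes "f \<in> Endo J p" "g \<in> Endo J q"
  shows "scomm J f g X = f (g X) - sg (p * q) \<star> g (f X)"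
  by (simp add: J.scomm_hom[OF assms] fscl_def)

lemma bracket_Dtri_Dtri:
  assumes d: "d \<in> T p" and e: "e \<in> T q"
  shows "scomm J (Dtri C d) (Dtri C e) = Dtri C (mul (tri (para C)) d e)"
proof -
  note de = triD(1)[OF d] triD(1)[OF e]
  have m: "mul (tri (para C)) d e j \<in> PEndo (p + q)" for j
    using P.scomm_Endo[OF de] by (simp add: tri_def)
  have mj: "mul (tri (para C)) d e j x = d j (e j x) - sg (p * q) \<cdot> e j (d j x)" for j x
    using P.scomm_hom[OF de] by (simp add: tri_def fscl_def)
  note D = Dtri_Endo[of d, OF de(1)] Dtri_Endo[of e, OF de(2)]
  show ?thesis
    by (rule Ops_eqI[OF J.E.hom_gsum[OF J.scomm_Endo[OF D]] J.E.hom_gsum[OF Dtri_Endo[OF m]]])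
      (simp_all add: scomm_apply[OF D] Dtri_E[OF de(1)] Dtri_E[OF de(2)] Dtri_E[OF m]
        Dtri_I[OF de(1)] Dtri_I[OF de(2)] Dtri_I[OF m] mj J.OpsD(5)[OF J.E.hom_gsum[OF D(1)]]
        J.OpsD(5)[OF J.E.hom_gsum[OF D(2)]])
qed

lemma Ops_eqI_at:
  assumes f: "f \<in> J.Ops" and g: "g \<in> J.Ops"
    and "f (E i) = g (E i)" "f (E (i + 1)) = g (E (i + 1))" "f (E (i + 2)) = g (E (i + 2))"
    and "\<And>p a. a \<in> V p \<Longrightarrow> f (I i a) = g (I i a)" "\<And>p a. a \<in> V p \<Longrightarrow> f (I (i + 1) a) = g (I (i + 1) a)"
      "\<And>p a. a \<in> V p \<Longrightarrow> f (I (i + 2) a) = g (I (i + 2) a)"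
  shows "f = g"
proof (rule Ops_eqI[OF f g])
  show "f (E j) = g (E j)" for j
    using index3_cases[of j i] assms by auto
  show "f (I j a) = g (I j a)" if "a \<in> V p" for j p a
    using index3_cases[of j i] assms(6-8)[OF that] by auto
qed

text \<open>
  On \<open>\<iota>\<^sub>i(S)\<close> this is skewness of \<open>d\<^sub>i\<close>, on the other two components it is the triality condition in its two
  cyclic forms.
\<close>

lemma bracket_Dtri_D:
  assumes d: "d \<in> T p" and a: "a \<in> V q"
  shows "scomm J (Dtri C d) (D i a) = D i (d i a)"
proof -
  note l = PEndo_rules[OF triD(1)[OF d]]
  note E = Dtri_Endo[of d, OF triD(1)[OF d]] D_Endo[OF a, of i]
  note F = J.OpsD[OF J.E.hom_gsum[OF E(1)]] J.Ops_diff[OF J.E.hom_gsum[OF E(1)]]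
    J.OpsD(5)[OF J.E.hom_gsum[OF E(2)]]
  note tab = scomm_apply[OF E] D_table Dtri_E[OF triD(1)[OF d]] Dtri_I[OF triD(1)[OF d]] F jcarr
  show ?thesis
  proof (rule Ops_eqI_at[OF J.E.hom_gsum[OF J.scomm_Endo[OF E]] J.E.hom_gsum[OF D_Endo[OF l(6)[OF a]]]])
    show "scomm J (Dtri C d) (D i a) (E i) = D i (d i a) (E i)"
      "scomm J (Dtri C d) (D i a) (E (i + 1)) = D i (d i a) (E (i + 1))"
      "scomm J (Dtri C d) (D i a) (E (i + 2)) = D i (d i a) (E (i + 2))"
      by (simp_all add: tab)
    fix r b assume b: "b \<in> V r"
    have "2 * \<b> (d i a) b = - (sg (p * q) * (2 * \<b> a (d i b)))"
      using triD(2)[OF d a, of i b]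
      by (metis add_eq_0_iff mult.left_commute mult_minus_right minus_equation_iff)
    then show "scomm J (Dtri C d) (D i a) (I i b) = D i (d i a) (I i b)"
      by (simp add: tab)
    show "scomm J (Dtri C d) (D i a) (I (i + 1) b) = D i (d i a) (I (i + 1) b)"
      by (simp add: tab tri_cyclic[OF d a])
    show "scomm J (Dtri C d) (D i a) (I (i + 2) b) = D i (d i a) (I (i + 2) b)"
      by (simp add: tab tri_rprod[OF d a b])
  qed
qed

lemma rprod_swap: "a \<in> V p \<Longrightarrow> b \<in> V q \<Longrightarrow> sg (p * q) \<cdot> (b \<lozenge> a) = a \<diamondop> b"
  by (cases p; cases q) (simp_all add: rprod_hom)

text \<open>
  On the \<open>e\<^sub>j\<close>, both sides agree because \<open>b \<lozenge> a\<close> is \<open>a \<diamondop> b\<close> up to sign; on \<open>\<iota>\<^sub>i(S)\<close> and \<open>\<iota>\<^sub>i\<^sub>+\<^sub>1(S)\<close> because of the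
  identities of a symmetric composition, on \<open>\<iota>\<^sub>i\<^sub>+\<^sub>2(S)\<close> because the form is associative.
\<close>

lemma bracket_D_next:
  assumes a: "a \<in> V p" and b: "b \<in> V q"
  shows "scomm J (D i a) (D (i + 1) b) = D (i + 2) (a \<diamondop> b)"
proof -
  note E = D_Endo[OF a, of i] D_Endo[OF b, of "i + 1"]
  note F = J.OpsD[OF J.E.hom_gsum[OF E(1)]] J.Ops_diff[OF J.E.hom_gsum[OF E(1)]]
    J.OpsD[OF J.E.hom_gsum[OF E(2)]] J.Ops_diff[OF J.E.hom_gsum[OF E(2)]]
  have sw: "sg (p * q) \<star> I (i + 2) (b \<lozenge> a) = I (i + 2) (a \<diamondop> b)"
    unfolding rprod_swap[OF a b, symmetric] by simp
  have sw': "sg (p * q) \<star> (1 / 2) \<star> I (i + 2) (b \<lozenge> a) = (1 / 2) \<star> I (i + 2) (a \<diamondop> b)"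
    unfolding sw[symmetric] by (simp add: mult.commute)
  note tab = scomm_apply[OF E] D_table F jcarr
  show ?thesis
  proof (rule Ops_eqI_at[OF J.E.hom_gsum[OF J.scomm_Endo[OF E]] J.E.hom_gsum[OF D_Endo[OF pprod_V[OF a b]]]])
    show "scomm J (D i a) (D (i + 1) b) (E i) = D (i + 2) (a \<diamondop> b) (E i)"
      "scomm J (D i a) (D (i + 1) b) (E (i + 1)) = D (i + 2) (a \<diamondop> b) (E (i + 1))"
      "scomm J (D i a) (D (i + 1) b) (E (i + 2)) = D (i + 2) (a \<diamondop> b) (E (i + 2))"
      using sw' by (simp_all add: tab)
    fix r c assume c: "c \<in> V r"
    note id = prod_identities[OF a b c]
    show "scomm J (D i a) (D (i + 1) b) (I i c) = D (i + 2) (a \<diamondop> b) (I i c)"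
      using two by (simp add: tab id)
    show "scomm J (D i a) (D (i + 1) b) (I (i + 1) c) = D (i + 2) (a \<diamondop> b) (I (i + 1) c)"
      using two by (simp add: tab id)
    show "scomm J (D i a) (D (i + 1) b) (I (i + 2) c) = D (i + 2) (a \<diamondop> b) (I (i + 2) c)"
      using two by (simp add: tab form_assoc form_rprod[OF a b c, symmetric] J.scale_right_diff_distrib mult.left_commute)
  qed
qed

lemma Dtri_inject:
  assumes "\<And>j. d j \<in> PEndo p" "\<And>j. e j \<in> PEndo q" "Dtri C d = Dtri C e"
  shows "d = e"
proof (intro ext)
  fix j a
  have "I j (d j a) = I j (e j a)"
    using assms(3) Dtri_I[of d, OF assms(1)] Dtri_I[of e, OF assms(2)] by metis
  then show "d j a = e j a"
    by (simp add: I_inject)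
qed

text \<open>
  This is how triples are recognised as elements of \<open>tri S\<close> below: the triple of a derivation which kills the
  idempotents is unique.
\<close>

lemma Dtri_der_imp_tri:
  assumes d: "\<And>j. d j \<in> PEndo p" and "Dtri C d \<in> gr (der J) p"
  shows "d \<in> T p"
proof -
  obtain e where e: "e \<in> T p" "Dtri C d = Dtri C e"
    using derivation_killing_idempotents[OF assms(2) Dtri_E[OF d]] .
  show ?thesis
    using Dtri_inject[of d, OF d triD(1)[OF e(1)] e(2)] e(1) by simp
qed

lemma tri_bracket:
  assumes d: "d \<in> T p" and e: "e \<in> T q"
  shows "mul (tri (para C)) d e \<in> T (p + q)"
proof (rule Dtri_der_imp_tri)
  show "mul (tri (para C)) d e j \<in> PEndo (p + q)" for j
    using P.scomm_Endo[OF triD(1)[OF d] triD(1)[OF e]] by (simp add: tri_def)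
  show "Dtri C (mul (tri (para C)) d e) \<in> gr (der J) (p + q)"
    unfolding bracket_Dtri_Dtri[OF d e, symmetric] by (rule J.scomm_der[OF Dtri_der[OF d] Dtri_der[OF e]])
qed

lemma sigma_hom:
  assumes "a \<in> V p" "b \<in> V q" "c \<in> V r"
  shows "sigma (para C) a b c = (sg (p * q) * \<b> a c) \<cdot> b - \<b> b c \<cdot> a"
  using form_even[OF assms(1,3)] form_even[OF assms(2,3)]
  by (cases p; cases q; cases r) (simp_all add: sigma_def hp[OF assms(1)] hp[OF assms(2)] hp[OF assms(3)])

lemma sigma_add: "sigma (para C) a b (c + c') = sigma (para C) a b c + sigma (para C) a b c'"
  using hp_linear by (simp add: sigma_def linear_on_def algebra_simps)

text \<open>
  The \<open>tri S\<close> part of the bracket of \<open>\<iota>\<^sub>i(1 \<otimes> a)\<close> and \<open>\<iota>\<^sub>i(1 \<otimes> b)\<close>; the factor is \<open>\<b>(1, 1) = 2\<close> in \<open>S\<^sub>1\<close>.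
\<close>

abbreviation tw where "tw i a b \<equiv> fscl (fscl (scl C)) 2 (theta_pow i (tt (para C) a b))"

lemma tw_apply:
  "tw i a b i c = 2 \<cdot> sigma (para C) a b c"
  "tw i a b (i + 1) c = \<b> a b \<cdot> c - 2 \<cdot> (a \<lozenge> (b \<diamondop> c))"
  "tw i a b (i + 2) c = \<b> a b \<cdot> c - 2 \<cdot> (a \<diamondop> (b \<lozenge> c))"
proof -
  have i: "i - i = 0" "i + 1 - i = 1" "i + 2 - i = (2 :: 3)"
    by simp_all
  show "tw i a b i c = 2 \<cdot> sigma (para C) a b c"
    by (simp add: fscl_def theta_pow_def i tt_def)
  show "tw i a b (i + 1) c = \<b> a b \<cdot> c - 2 \<cdot> (a \<lozenge> (b \<diamondop> c))"
    "tw i a b (i + 2) c = \<b> a b \<cdot> c - 2 \<cdot> (a \<diamondop> (b \<lozenge> c))"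
    unfolding fscl_def theta_pow_def i using two
    by (simp_all add: tt_def lop_def scale_right_diff_distrib)
qed

text \<open>
  That \<open>t\<^sub>a\<^sub>,\<^sub>b\<close> lies in \<open>tri S\<close> needs no separate computation: \<open>[D\<^sub>i(a), D\<^sub>i(b)]\<close> is a derivation which
  kills the idempotents, and evaluating it identifies its triple as \<open>2 \<theta>\<^sup>i(t\<^sub>a\<^sub>,\<^sub>b)\<close>.
\<close>

lemma bracket_D_same:
  assumes a: "a \<in> V p" and b: "b \<in> V q"
  shows "scomm J (D i a) (D i b) = Dtri C (tw i a b)" "tw i a b \<in> T (p + q)"
proof -
  note E = D_Endo[OF a, of i] D_Endo[OF b, of i]
  note F = J.OpsD[OF J.E.hom_gsum[OF E(1)]] J.Ops_diff[OF J.E.hom_gsum[OF E(1)]]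
    J.OpsD[OF J.E.hom_gsum[OF E(2)]] J.Ops_diff[OF J.E.hom_gsum[OF E(2)]]
  have sw: "sg (p * q) * \<b> b a = \<b> a b"
    using form_sym[OF a b] by simp
  note tab = scomm_apply[OF E] D_table F jcarr sw
  have half: "(1 / 2) \<star> (2 * u) \<star> X = u \<star> X" for u X
    using two by simp
  have half': "sg (p * q) \<star> (1 / 2) \<star> (2 * \<b> b a) \<star> X = \<b> a b \<star> X" for X
    unfolding half by (simp add: sw)
  have sw': "sg (p * q) \<star> \<b> b a \<star> X = \<b> a b \<star> X" for X
    by (simp add: sw)
  have "scomm J (D i a) (D i b) (E j) = 0" for j
    using index3_cases[of j i] by (auto simp: tab half half' sw' simp del: J.scale_scale)
  from derivation_killing_idempotents[OF J.scomm_der[OF D_der[OF a] D_der[OF b]] this]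
  obtain d where d: "d \<in> T (p + q)" "scomm J (D i a) (D i b) = Dtri C d"
    by blast
  note l = PEndo_rules[OF triD(1)[OF d(1)]]
  have dI: "I j (d j c) = scomm J (D i a) (D i b) (I j c)" for j c
    unfolding d(2) Dtri_I[of d, OF triD(1)[OF d(1)]] ..
  have dbl: "2 \<cdot> x = x + x" for x
    using scale_left_distrib[of 1 1 x] by simp
  have twice: "(2 * u) \<star> X = u \<star> X + u \<star> X" for u X
    unfolding J.scale_left_distrib[symmetric] by simp
  have h: "I j (d j c) = I j (tw i a b j c)" if c: "c \<in> V r" for j c r
  proof -
    note id = prod_identities[OF a b c]
    have "scomm J (D i a) (D i b) (I i c) = I i (tw i a b i c)"
      unfolding tw_apply sigma_hom[OF a b c] using two
      by (simp add: tab J.scale_right_diff_distrib scale_right_diff_distrib) (simp add: algebra_simps twice)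
    moreover have "scomm J (D i a) (D i b) (I (i + 1) c) = I (i + 1) (tw i a b (i + 1) c)"
      unfolding tw_apply dbl by (simp add: tab id)
    moreover have "scomm J (D i a) (D i b) (I (i + 2) c) = I (i + 2) (tw i a b (i + 2) c)"
      unfolding tw_apply dbl by (simp add: tab id)
    ultimately show ?thesis
      using index3_cases[of j i] unfolding dI by auto
  qed
  have add: "tw i a b j (c + c') = tw i a b j c + tw i a b j c'" for j c c'
  proof -
    consider "j = i" | "j = i + 1" | "j = i + 2"
      using index3_cases by blast
    then show ?thesis
      by cases (simp_all only: tw_apply sigma_add, simp_all add: algebra_simps)
  qed
  have "d j c = tw i a b j c" for j c
  proof -
    have "d j (hp 0 c + hp 1 c) = tw i a b j (hp 0 c + hp 1 c)"
      unfolding add l(1) h[OF hp_V, unfolded I_inject] ..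
    then show ?thesis by (simp only: hp_decomp)
  qed
  then have "d = tw i a b"
    by (intro ext)
  then show "scomm J (D i a) (D i b) = Dtri C (tw i a b)" "tw i a b \<in> T (p + q)"
    using d by simp_all
qed

subsection \<open>Every derivation is a sum of the standard ones\<close>

text \<open>
  The values \<open>f(e\<^sub>i)\<close> have components only in \<open>\<iota>\<^sub>i\<^sub>+\<^sub>1(S)\<close> and \<open>\<iota>\<^sub>i\<^sub>+\<^sub>2(S)\<close>, and orthogonality of the \<open>e\<^sub>i\<close> makes the components
  of \<open>f(e\<^sub>i\<^sub>+\<^sub>1)\<close> and \<open>f(e\<^sub>i)\<close> in \<open>\<iota>\<^sub>i\<^sub>+\<^sub>2(S)\<close> opposite. The table of \<open>\<Sum>\<^sub>j D\<^sub>j(a\<^sub>j)\<close> has the same shape, so suitable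
  \<open>a\<^sub>j\<close> remove all \<open>f(e\<^sub>i)\<close> at once.
\<close>

lemma derivation_decomposition:
  assumes f: "f \<in> gr (der J) p"
  obtains d a where "d \<in> T p" "\<And>j. a j \<in> V p" "f = Dtri C d + (\<Sum>i\<in>UNIV. D i (a i))"
proof -
  note fE = J.der_Endo[OF f]
  note F = J.OpsD[OF J.E.hom_gsum[OF fE]]
  define u where "u i = coord (i + 1) (f (E i))" for i
  define w where "w i = coord (i + 2) (f (E i))" for i
  have wV: "w i \<in> V p" for i
    using J.EndoD(4)[OF fE E_gr, of i] by (auto simp: w_def gr_H3 mgr_def intro!: V_scale)
  have half2: "(1 / 2) \<star> X + (1 / 2) \<star> X = X" for X
    using two by (simp flip: J.scale_left_distrib)
  \<comment> \<open>As \<open>e\<^sub>i\<close> is idempotent, \<open>f(e\<^sub>i)\<close> lies in its Peirce half space, which \<open>4 e\<^sub>i (x - e\<^sub>i x)\<close> projects onto.\<close>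
  have fe: "f (E i) = I (i + 1) (u i) + I (i + 2) (w i)" for i
  proof -
    define X where "X = f (E i)"
    have Xc: "X \<in> J.carr"
      by (simp add: X_def F)
    have Xg: "X \<in> gr J p"
      using J.EndoD(4)[OF fE E_gr, of i] by (simp add: X_def)
    have "X = E i \<bullet> X + E i \<bullet> X"
      using J.derD[OF f E_gr E_carr, of i i] jprod_comm[OF Xg E_gr, of i] by (simp add: jtable X_def[symmetric])
    then have 1: "E i \<bullet> X = (1 / 2) \<star> X"
      using half2[of "E i \<bullet> X"] by (simp flip: J.scale_right_distrib)
    obtain \<alpha> where X2: "X = \<alpha> i \<star> E i + I i (coord i X)
      + (\<alpha> (i + 1) \<star> E (i + 1) + I (i + 1) (u i)) + (\<alpha> (i + 2) \<star> E (i + 2) + I (i + 2) (w i))"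
      using J_coords[OF Xc, of i] unfolding u_def w_def X_def by blast
    define x where "x = coord i X"
    have 2: "E i \<bullet> X = \<alpha> i \<star> E i + (1 / 2) \<star> (I (i + 1) (u i) + I (i + 2) (w i))"
      by (subst X2, fold x_def) (simp add: jmul jtable J.scale_right_distrib)
    have "E i \<bullet> (E i \<bullet> X) = \<alpha> i \<star> E i + (1 / 2) \<star> (1 / 2) \<star> (I (i + 1) (u i) + I (i + 2) (w i))"
      unfolding 2 by (simp add: jmul jtable J.scale_right_distrib del: J.scale_scale)
    then have 3: "E i \<bullet> X - E i \<bullet> (E i \<bullet> X)
        = (1 / 2) \<star> (I (i + 1) (u i) + I (i + 2) (w i)) - (1 / 2) \<star> (1 / 2) \<star> (I (i + 1) (u i) + I (i + 2) (w i))"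
      unfolding 2 by simp
    have hh: "(1 / 2) \<star> Y - (1 / 2) \<star> (1 / 2) \<star> Y = (1 / 2) \<star> (1 / 2) \<star> Y" for Y
      using half2[of "(1 / 2) \<star> Y"] by (metis add_diff_cancel)
    have "E i \<bullet> X - E i \<bullet> (E i \<bullet> X) = (1 / 2) \<star> (1 / 2) \<star> X"
      unfolding 1 J.mul_scale(1)[OF E_carr Xc] by (rule hh)
    then have "(1 / 2) \<star> (1 / 2) \<star> X = (1 / 2) \<star> (1 / 2) \<star> (I (i + 1) (u i) + I (i + 2) (w i))"
      unfolding 3 hh by (rule sym)
    moreover have "2 \<star> 2 \<star> (1 / 2) \<star> (1 / 2) \<star> Y = Y" for Y
      using two four_neq_0 by simp
    ultimately have "X = I (i + 1) (u i) + I (i + 2) (w i)"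
      by metis
    then show ?thesis
      by (simp add: X_def)
  qed
  have uw: "u (i + 1) = - w i" for i
  proof -
    have "(1 / 2) \<star> I (i + 2) (w i) + (1 / 2) \<star> I (i + 2) (u (i + 1)) = 0"
      using J.derD[OF f E_gr E_carr, of i "i + 1"] by (simp add: jtable jmul fe F)
    then have "(1 / 2) \<star> I (i + 2) (w i + u (i + 1)) = 0"
      by (simp add: J.scale_right_distrib)
    then have "I (i + 2) (w i + u (i + 1)) = I (i + 2) 0"
      using two unfolding I_rules(4) by (simp del: I_rules)
    then show ?thesis
      unfolding I_inject by (simp add: eq_neg_iff_add_eq_0 add.commute)
  qed
  \<comment> \<open>The \<open>\<iota>\<^sub>i\<^sub>+\<^sub>2\<close> component of the sum at \<open>e\<^sub>i\<close> is half of \<open>a (i + 2)\<close>, and \<open>j = i + 2\<close> means \<open>i = j + 1\<close>.\<close>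
  define a where "a j = 2 \<cdot> w (j + 1)" for j
  have aV: "a j \<in> V p" for j
    by (simp add: a_def V_scale wV)
  define g where "g = f - (\<Sum>i\<in>UNIV. D i (a i))"
  have g: "g \<in> gr (der J) p"
    unfolding g_def
    by (intro J.Op.subspace_diff[OF J.der_subspace] J.Op.subspace_sum[OF J.der_subspace] f D_der aV)
  have "g (E i) = 0" for i
  proof -
    have "(\<Sum>j\<in>UNIV. D j (a j)) (E i) = (\<Sum>j\<in>UNIV. D j (a j) (E i))"
      unfolding sum_3[of _ i] by (simp only: plus_fun_apply)
    also have "\<dots> = (1 / 2) \<star> I (i + 2) (a (i + 2)) - (1 / 2) \<star> I (i + 1) (a (i + 1))"
      unfolding sum_3[of _ i] by (simp add: D_table)
    also have "\<dots> = I (i + 2) (w i) - I (i + 1) (w (i + 2))"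
      using two by (simp add: a_def)
    also have "\<dots> = f (E i)"
      using uw[of "i + 2"] by (simp add: fe)
    finally show ?thesis
      by (simp add: g_def)
  qed
  from derivation_killing_idempotents[OF g this] obtain d where "d \<in> T p" "g = Dtri C d"
    by blast
  then show thesis
    using that[of d a] aV by (simp add: g_def algebra_simps)
qed

end

section \<open>Coordinates on \<open>\<gg>(S\<^sub>1, S)\<close>\<close>

lemma S1_simps: "scl S1 = (*)" "gr S1 = (\<lambda>p. if p = 0 then UNIV else {0})" "bf S1 = (\<lambda>x y. 2 * x * y)"
  "mul S1 = (\<lambda>x y. x * y)"
  by (simp_all add: S1_def para_def field_alg_def hconj_def fun_eq_iff algebra_simps)

lemma S1_full: "full_superspace (S1 :: ('k::field, 'k) qsalg)"
proof
  have V: "vector_space ((*) :: 'k \<Rightarrow> 'k \<Rightarrow> 'k)"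
    by (rule vector_space_field)
  show full: "scarrier (S1 :: ('k, 'k) qsalg) = UNIV"
    by (auto simp: scarrier_def gsum_def S1_simps)
  show "superalgebra (S1 :: ('k, 'k) qsalg)"
    unfolding superalgebra_def superspace_def full unfolding S1_simps
  proof (intro conjI allI ballI V)
    show "module.subspace (*) (if p = 0 then UNIV :: 'k set else {0})" for p :: bit
    proof -
      interpret vector_space "(*) :: 'k \<Rightarrow> 'k \<Rightarrow> 'k"
        by (rule V)
      show ?thesis
        by (cases p) simp_all
    qed
    show "(if 0 = (0::bit) then UNIV else {0}) \<inter> (if 1 = (0::bit) then UNIV else {0}) = {0 :: 'k}"
      by simp
    show "bilinear_on (*) (*) (*) UNIV UNIV (\<lambda>x y :: 'k. x * y)"
      by (simp add: bilinear_on_def linear_on_def algebra_simps)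
    show "x * y \<in> (if p + q = 0 then UNIV else {0})"
      if "x \<in> (if p = 0 then UNIV else {0})" "y \<in> (if q = 0 then UNIV else {0})" for p q :: bit and x y :: 'k
      using that by (cases p; cases q) simp_all
  qed
  have "qf (S1 :: ('k, 'k) qsalg) = (\<lambda>x. x\<^sup>2)"
    by (simp add: S1_def para_def field_alg_def)
  then show "quadratic_superform (S1 :: ('k, 'k) qsalg)"
    unfolding quadratic_superform_def full unfolding S1_simps
  proof (intro conjI allI ballI impI)
    show "bilinear_on (*) (*) (*) UNIV UNIV (\<lambda>x y :: 'k. 2 * x * y)"
      by (simp add: bilinear_on_def linear_on_def algebra_simps)
    fix p q :: bit and x y :: 'k
    assume xy: "x \<in> (if p = 0 then UNIV else {0})" "y \<in> (if q = 0 then UNIV else {0})"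
    show "2 * x * y = 0" if "p \<noteq> q"
      using that xy by (cases p; cases q) simp_all
    show "2 * x * y = sg (p * q) * (2 * y * x)"
      using xy by (cases p; cases q) simp_all
  qed (simp_all add: power2_eq_square algebra_simps)
qed

context hurwitz
begin

sublocale FP: full_pair "S1 :: ('k, 'k) qsalg" "para C"
  by (intro full_pair.intro S1_full para_full)

abbreviation "K \<equiv> (S1 :: ('k, 'k) qsalg)"
abbreviation "tn a \<equiv> tens K (para C) 1 a"
abbreviation "tscl \<equiv> (fscl (*) :: 'k \<Rightarrow> ('k, 'k, 'v) tensor \<Rightarrow> ('k, 'k, 'v) tensor)"

lemma tn_linear [simp]: "tn (a + b) = tn a + tn b" "tn (c \<cdot> a) = tscl c (tn a)" "tn 0 = 0"
  "tn (- a) = - tn a" "tn (a - b) = tn a - tn b"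
proof -
  have l: "linear_on (scl C) tscl UNIV (tens K (para C) 1)"
    using bilinear_tens[of K "para C"] by (simp add: bilinear_on_def)
  then show "tn (a + b) = tn a + tn b" "tn (c \<cdot> a) = tscl c (tn a)" "tn 0 = 0" "tn (a - b) = tn a - tn b"
    using linear_on_0[OF l] linear_on_diff[OF l] by (simp_all add: linear_on_def)
  show "tn (- a) = - tn a"
    using linear_on_diff[OF l, of 0 a] linear_on_0[OF l] by simp
qed

lemma tens_tn: "tens K (para C) x a = tn (x \<cdot> a)"
proof -
  have "linear_on (*) tscl UNIV (\<lambda>x. tens K (para C) x a)"
    using bilinear_tens[of K "para C"] by (simp add: bilinear_on_def S1_simps)
  then have "tens K (para C) (x * 1) a = tscl x (tn a)"
    by (simp only: linear_on_def) blast
  then show ?thesis by simp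
qed

lemma tn_inject: "tn a = tn b \<longleftrightarrow> a = b"
proof
  assume "tn a = tn b"
  then have z: "tn (a - b) = 0"
    by simp
  show "a = b"
  proof (rule ccontr)
    assume "a \<noteq> b"
    then obtain \<phi> where \<phi>: "linear_on (scl C) (*) UNIV \<phi>" "\<phi> (a - b) \<noteq> 0"
      using exists_functional[OF vector_space_axioms, of "a - b"] by auto
    define B where "B = (\<lambda>x y. x * \<phi> y)"
    have "bilinear_on (scl K) (scl (para C)) (*) UNIV UNIV B"
      using \<phi>(1) by (simp add: B_def bilinear_on_def linear_on_def S1_simps algebra_simps)
    then have "tn (a - b) B = \<phi> (a - b)"
      by (simp add: tens_def B_def)
    then show False
      using z \<phi>(2) by simp
  qed
qed simp

text \<open>
  Every element of \<open>k \<otimes> S\<close> is of the form \<open>1 \<otimes> a\<close>, with the parity of \<open>a\<close>.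
\<close>

lemma tgr_S1: "tgr K (para C) p = tn ` V p"
proof (intro equalityI subsetI)
  fix t assume "t \<in> tgr K (para C) p"
  then have "t \<in> module.span tscl (tn ` V p)"
    unfolding tgr_def
  proof (rule subsetD[OF FP.tensor.span_mono, rotated])
    show "{tens K (para C) x y |x y q r. x \<in> gr K q \<and> y \<in> gr (para C) r \<and> q + r = p} \<subseteq> tn ` V p"
    proof
      fix s assume "s \<in> {tens K (para C) x y |x y q r. x \<in> gr K q \<and> y \<in> gr (para C) r \<and> q + r = p}"
      then obtain x y q r where s: "s = tens K (para C) x y" "x \<in> gr K q" "y \<in> V r" "q + r = p"
        by auto
      have "x \<cdot> y \<in> V p"
        using s V_0 by (cases q) (auto simp: S1_simps V_scale)
      then show "s \<in> tn ` V p"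
        unfolding s(1) tens_tn[of x y] by (rule imageI)
    qed
  qed
  then show "t \<in> tn ` V p"
  proof (induction rule: FP.tensor.span_induct_alt)
    case base
    show ?case using V_0[of p] by (metis imageI tn_linear(3))
  next
    case (step c x y)
    then obtain a b where "a \<in> V p" "b \<in> V p" "x = tn a" "y = tn b" by blast
    then have "tscl c x + y = tn (c \<cdot> a + b)" "c \<cdot> a + b \<in> V p"
      by (simp_all add: V_add V_scale)
    then show ?case by (metis imageI)
  qed
next
  fix t assume "t \<in> tn ` V p"
  then show "t \<in> tgr K (para C) p"
    using FP.tens_in_tgr[of 1 0 _ p] by (auto simp: S1_simps)
qed

text \<open>
  Evaluating skewness of \<open>d\<^sub>i\<close> at \<open>(1, 1)\<close> gives \<open>4 d\<^sub>i(1) = 0\<close>.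
\<close>

lemma tri_S1: "gr (tri K) p = {0}"
proof -
  have "d i x = 0" if d: "d \<in> gr (tri K) p" for d i x
  proof -
    have o: "d i \<in> osp K p"
      using d by (auto simp: tri_def)
    then have "\<forall>c. \<forall>x\<in>UNIV. d i (scl K c x) = scl K c (d i x)"
      unfolding osp_def Endo_def linear_on_def mem_Collect_eq FP.S.full by blast
    from this[rule_format, of 1 x] have l: "d i (x * 1) = x * d i 1"
      by (simp only: S1_simps UNIV_I)
    have "\<forall>q. \<forall>x\<in>gr K q. \<forall>y\<in>UNIV. bf K (d i x) y + sg (p * q) * bf K x (d i y) = 0"
      using o unfolding osp_def mem_Collect_eq FP.S.full by blast
    from this[rule_format, of 1 0 1] have "(2 * 2) * d i 1 = 0"
      by (simp add: S1_simps)
    then have "d i 1 = 0"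
      using two by (metis mult_eq_0_iff)
    then show ?thesis
      using l by simp
  qed
  then show ?thesis
    using FP.S.tri_0 by (auto simp: fun_eq_iff)
qed

text \<open>
  The coordinates on \<open>\<gg>(S\<^sub>1, S)\<close>: \<open>gelem d a\<close> is \<open>d + \<Sum>\<^sub>i \<iota>\<^sub>i(1 \<otimes> a\<^sub>i)\<close>.
\<close>

definition gelem :: "(3 \<Rightarrow> 'v \<Rightarrow> 'v) \<Rightarrow> (3 \<Rightarrow> 'v) \<Rightarrow> ('k, 'k, 'v) gelem" where
  "gelem d a = (0, d, (\<lambda>j. tn (a j)))"

lemma gelem_inject: "gelem d a = gelem e b \<longleftrightarrow> d = e \<and> a = b"
proof
  assume "gelem d a = gelem e b"
  then have "d = e" "(\<lambda>j. tn (a j)) = (\<lambda>j. tn (b j))"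
    by (simp_all add: gelem_def)
  then show "d = e \<and> a = b"
    using fun_cong[of "\<lambda>j. tn (a j)" "\<lambda>j. tn (b j)"] by (auto simp: tn_inject)
qed simp

lemma gelem_add: "gelem d a + gelem e b = gelem (d + e) (a + b)"
  by (simp add: gelem_def fun_eq_iff)

lemma gelem_diff: "gelem d a - gelem e b = gelem (d - e) (a - b)"
  by (simp add: gelem_def fun_eq_iff)

abbreviation "Tscl \<equiv> (fscl (fscl (scl C)) :: 'k \<Rightarrow> (3 \<Rightarrow> 'v \<Rightarrow> 'v) \<Rightarrow> _)"
abbreviation "gs \<equiv> gscl K (para C)"
abbreviation "L \<equiv> galg K (para C)"

lemma gelem_scale: "gs c (gelem d a) = gelem (Tscl c d) (fscl (scl C) c a)"
  by (simp add: gelem_def gscl_def fun_eq_iff fscl_def tn_linear(2)[unfolded fscl_def])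

lemma gelem_0: "gelem 0 0 = 0"
  by (simp add: gelem_def zero_prod_def fun_eq_iff)

lemma ggr_gelem: "ggr K (para C) p = {gelem d a | d a. d \<in> T p \<and> (\<forall>j. a j \<in> V p)}"
proof (intro equalityI subsetI)
  fix X assume "X \<in> ggr K (para C) p"
  then obtain d u where X: "X = (0, d, u)" "d \<in> T p" "\<And>j. u j \<in> tn ` V p"
    by (auto simp: ggr_def tri_S1 tgr_S1)
  then have "\<forall>j. \<exists>a\<in>V p. u j = tn a"
    by blast
  then obtain a where "\<And>j. a j \<in> V p \<and> u j = tn (a j)"
    by metis
  then show "X \<in> {gelem d a | d a. d \<in> T p \<and> (\<forall>j. a j \<in> V p)}"
    using X by (auto simp: gelem_def)
next
  fix X assume "X \<in> {gelem d a | d a. d \<in> T p \<and> (\<forall>j. a j \<in> V p)}"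
  then show "X \<in> ggr K (para C) p"
    by (auto simp: gelem_def ggr_def tri_S1 tgr_S1)
qed

lemma gelem_ggr: "d \<in> T p \<Longrightarrow> (\<And>j. a j \<in> V p) \<Longrightarrow> gelem d a \<in> ggr K (para C) p"
  by (auto simp: ggr_gelem)

sublocale Tri: vector_space Tscl
  by (intro vector_space_fscl vector_space_axioms)

lemma tri_subspace: "Tri.subspace (T p)"
proof (rule Tri.subspaceI)
  show "0 \<in> T p"
    using S.tri_0 by simp
  have n: "- e \<in> T p" if "e \<in> T p" for e
    using S.tri_diff[OF S.tri_0 that] by simp
  show "d + e \<in> T p" if "d \<in> T p" "e \<in> T p" for d e
    using S.tri_diff[OF that(1) n[OF that(2)]] by simp
  fix c d assume d: "d \<in> T p"
  show "Tscl c d \<in> T p"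
    unfolding tri_iff
  proof (intro conjI allI ballI)
    show "Tscl c d i \<in> PEndo p" for i
      using P.Op.subspace_scale[OF P.Endo_subspace triD(1)[OF d], of c i] by (simp add: fscl_def)
    show "\<b> (Tscl c d i x) y + sg (p * q) * \<b> x (Tscl c d i y) = 0" if "x \<in> V q" for i q x y
      using tri_skew(1)[OF d that, of i y] by (simp add: fscl_def algebra_simps)
    show "Tscl c d 0 (x \<diamondop> y) = Tscl c d 1 x \<diamondop> y + sg (p * q) \<cdot> (x \<diamondop> Tscl c d 2 y)" if "x \<in> V q" for q x y
      using triD(3)[OF d that, of y] by (simp add: fscl_def algebra_simps)
  qed
qed

sublocale TG: graded_space Tscl "gr (tri (para C))"
  by unfold_locales (use tri_subspace S.tri_disj in simp_all)

sublocale GV: vector_space gs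
  by unfold_locales (auto simp: gscl_def fscl_def fun_eq_iff algebra_simps)

sublocale GG: graded_space gs "ggr K (para C)"
proof
  show "GV.subspace (ggr K (para C) p)" for p
  proof (rule GV.subspaceI)
    show "0 \<in> ggr K (para C) p"
      by (rule FP.ggr_0)
    show "X + Y \<in> ggr K (para C) p" if "X \<in> ggr K (para C) p" "Y \<in> ggr K (para C) p" for X Y
    proof -
      obtain d a e b where "X = gelem d a" "d \<in> T p" "\<forall>j. a j \<in> V p"
        "Y = gelem e b" "e \<in> T p" "\<forall>j. b j \<in> V p"
        using \<open>X \<in> _\<close> \<open>Y \<in> _\<close> unfolding ggr_gelem by blast
      then show ?thesis
        using gelem_ggr[OF Tri.subspace_add[OF tri_subspace], of d p e "a + b"] by (simp add: gelem_add V_add)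
    qed
    show "gs c X \<in> ggr K (para C) p" if "X \<in> ggr K (para C) p" for X c
    proof -
      obtain d a where "X = gelem d a" "d \<in> T p" "\<forall>j. a j \<in> V p"
        using \<open>X \<in> _\<close> unfolding ggr_gelem by blast
      then show ?thesis
        using gelem_ggr[OF Tri.subspace_scale[OF tri_subspace], of d p "fscl (scl C) c a" c]
        by (simp add: gelem_scale V_scale fscl_def)
    qed
  qed
  show "X = 0" if hom: "X \<in> ggr K (para C) 0" "X \<in> ggr K (para C) 1" for X
  proof -
    obtain d a e b where X: "X = gelem d a" "d \<in> T 0" "\<forall>j. a j \<in> V 0"
      and Y: "X = gelem e b" "e \<in> T 1" "\<forall>j. b j \<in> V 1"
      using hom unfolding ggr_gelem by blast
    have de: "d = e" and ab: "a = b"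
      using X(1) Y(1) by (simp_all add: gelem_inject)
    have "d = 0"
      using TG.disj X(2) Y(2) unfolding de by blast
    moreover have "a = 0"
      using disj X(3) Y(3) unfolding ab by (intro ext) simp
    ultimately show ?thesis
      using X(1) by (simp add: gelem_0)
  qed
qed

abbreviation "TT \<equiv> gsum (gr (tri (para C)))"

lemma TT_eq: "scarrier (tri (para C)) = TT"
  by (simp add: scarrier_def)

lemma L_simps [simp]: "scl L = gs" "gr L = ggr K (para C)" "mul L = gbracket K (para C)"
  by (simp_all add: galg_def)

lemma L_carrier: "scarrier L = {gelem d a | d a. d \<in> TT}"
proof (intro equalityI subsetI)
  fix X assume "X \<in> scarrier L"
  then obtain Y Z where "Y \<in> ggr K (para C) 0" "Z \<in> ggr K (para C) 1" "X = Y + Z"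
    unfolding scarrier_def L_simps by (rule GG.gsumE)
  then obtain d a e b where "X = gelem d a + gelem e b" "d \<in> T 0" "e \<in> T 1"
    unfolding ggr_gelem by blast
  then show "X \<in> {gelem d a | d a. d \<in> TT}"
    using TG.gsumI by (auto simp: gelem_add)
next
  fix X assume "X \<in> {gelem d a | d a. d \<in> TT}"
  then obtain d a where X: "X = gelem d a" "d \<in> TT" by blast
  then obtain e f where d: "e \<in> T 0" "f \<in> T 1" "d = e + f"
    by (auto elim: TG.gsumE)
  have "X = gelem e (\<lambda>j. hp 0 (a j)) + gelem f (\<lambda>j. hp 1 (a j))"
    unfolding X d(3) gelem_add by (simp add: gelem_inject fun_eq_iff hp_decomp)
  then show "X \<in> scarrier L"
    using GG.gsumI[OF gelem_ggr[OF d(1)] gelem_ggr[OF d(2)]] hp_V by (simp add: scarrier_def)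
qed

subsection \<open>The bracket in coordinates\<close>

lemma hp_S1: "hpart (gr K) p x = (if p = 0 then x else 0)"
  and hp_S1': "hpart (\<lambda>p. if p = 0 then UNIV else {0 :: 'k}) p x = (if p = 0 then x else 0)"
  using FP.S.hp[of x 0 p] by (simp_all add: S1_simps)

text \<open>
  In one dimension all three components of \<open>t\<^sub>x\<^sub>,\<^sub>y\<close> cancel, so brackets have no component in \<open>tri S\<^sub>1\<close>.
\<close>

lemma tt_S1: "tt K x y = 0"
proof (intro ext)
  fix i z
  have "sigma K x y z = 0"
    by (simp add: sigma_def hp_S1' S1_simps)
  moreover have "1 / 2 * (2 * x * y) * z - rop K x (lop K y z) = 0"
    "1 / 2 * (2 * x * y) * z - lop K x (rop K y z) = 0"
    using two by (simp_all add: rop_def lop_def hp_S1' S1_simps)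
  ultimately show "tt K x y i z = 0 i z"
    by (simp add: tt_def S1_simps)
qed

lemma act'_tn:
  assumes f: "f \<in> P.Ops"
  shows "act' K (para C) f (tn b) = tn (f b)"
proof -
  have l: "linear_on (scl (para C)) (scl (para C)) UNIV (hpart PEndo p f)" for p
    using PEndo_rules(1,2)[OF P.E.hpart_in[OF f]] by (simp add: linear_on_def)
  have "act' K (para C) f (tn b) = (\<Sum>p\<in>{0, 1}. \<Sum>q\<in>{0, 1}.
     fscl (*) (sg (p * q)) (tens K (para C) (hpart (gr K) q 1) (hpart PEndo p f b)))"
    unfolding act'_def
    by (rule tlift_tens[OF FP.tensor.vector_space_axioms])
      (intro bilinear_on_sum bilinear_on_scale bilinear_on_comp[OF bilinear_tens]
        FP.tensor.vector_space_axioms FP.S.hp_linear l)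
  also have "\<dots> = tn (hpart PEndo 0 f b) + tn (hpart PEndo 1 f b)"
    by (simp add: hp_S1 FP.tens_0)
  also have "\<dots> = tn ((hpart PEndo 0 f + hpart PEndo 1 f) b)"
    by simp
  finally show ?thesis
    unfolding P.E.hpart_decomp[OF f, symmetric] .
qed

lemma tprod_tn: "tprod K (para C) (tn a) (tn b) = tn (a \<diamondop> b)"
proof -
  have "tprod K (para C) (tn a) (tn b) = tn (hp 0 a \<diamondop> b) + tn (hp 1 a \<diamondop> b)"
    unfolding FP.tprod_tens(1) by (simp add: hp_S1' FP.tens_0 S1_simps)
  also have "\<dots> = tn ((hp 0 a + hp 1 a) \<diamondop> b)"
    by simp
  finally show ?thesis
    by (simp only: hp_decomp)
qed

lemma diag_tn: "diag K (para C) (tn a) (tn b) = 0"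
  unfolding FP.diag_tens(1) tt_S1 by (simp add: fscl_def fun_eq_iff S1_simps)

lemma diag'_tn: "theta_pow i (diag' K (para C) (tn a) (tn b)) = tw i a b"
proof -
  note l = S.tt_linear(1)[of b]
  have "diag' K (para C) (tn a) (tn b)
      = Tscl 2 (tt (para C) (hp 0 a) b) + Tscl 2 (tt (para C) (hp 1 a) b)"
    unfolding FP.diag'_tens(1) by (simp add: hp_S1' S1_simps)
  also have "\<dots> = Tscl 2 (tt (para C) (hp 0 a + hp 1 a) b)"
    using l by (simp add: linear_on_def Tri.scale_right_distrib)
  finally show ?thesis
    by (simp add: hp_decomp theta_pow_def fscl_def)
qed

lemma TT_Ops: "d \<in> TT \<Longrightarrow> d j \<in> P.Ops"
proof -
  assume "d \<in> TT"
  then obtain e f where "e \<in> T 0" "f \<in> T 1" "d = e + f"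
    by (rule TG.gsumE)
  then show ?thesis
    using P.E.gsumI[OF triD(1) triD(1)] by simp
qed

lemma ghalf_gelem:
  assumes "d \<in> TT" "e \<in> TT"
  shows "ghalf K (para C) (gelem d a) (gelem e b) = gelem 0 (\<lambda>j. d j (b j) + a (j + 1) \<diamondop> b (j + 2))"
  by (simp add: ghalf_def gelem_def FP.act_0(2) act'_tn[OF TT_Ops[OF assms(1)]] tprod_tn fun_eq_iff)

abbreviation "brk \<equiv> gbracket K (para C)"
abbreviation "gp \<equiv> hpart (ggr K (para C))"
abbreviation "Gcarr \<equiv> gsum (ggr K (para C))"

lemma Gcarr_eq: "Gcarr = {gelem d a | d a. d \<in> TT}"
  using L_carrier by (simp add: scarrier_def)

lemma GcarrE:
  assumes "X \<in> Gcarr"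
  obtains d a where "X = gelem d a" "d \<in> TT"
  using assms by (auto simp: Gcarr_eq)

lemma gp_carr: "X \<in> Gcarr \<Longrightarrow> gp p X \<in> Gcarr"
  by (rule GG.hom_gsum[OF GG.hpart_in])

text \<open>
  The components of the bracket in \<open>tri S\<^sub>1\<close> and \<open>tri S\<close>. This part and \<open>ghalf\<close> are bilinear by themselves; the bracket is
  assembled from them and from homogeneous components.
\<close>

definition tri_part :: "('k, 'k, 'v) gelem \<Rightarrow> ('k, 'k, 'v) gelem \<Rightarrow> ('k, 'k, 'v) gelem" where
  "tri_part X Y = (case X of (d, d', u) \<Rightarrow> case Y of (e, e', v) \<Rightarrow>
       (mul (tri K) d e + (\<Sum>i\<in>UNIV. theta_pow i (diag K (para C) (u i) (v i))),
        mul (tri (para C)) d' e' + (\<Sum>i\<in>UNIV. theta_pow i (diag' K (para C) (u i) (v i))), 0))"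

lemma tri_part_gelem:
  "tri_part (gelem d a) (gelem e b) = gelem (mul (tri (para C)) d e + (\<Sum>i\<in>UNIV. tw i (a i) (b i))) 0"
  unfolding tri_part_def gelem_def prod.case diag_tn diag'_tn FP.theta_pow_0 FP.S.tri_mul_0[OF FP.S.tri_0]
  by (simp add: fun_eq_iff)

lemma brk_eq: "brk X Y = tri_part X Y + ghalf K (para C) X Y
   - (\<Sum>p\<in>{0, 1}. \<Sum>q\<in>{0, 1}. gs (sg (p * q)) (ghalf K (para C) (gp q Y) (gp p X)))"
  unfolding gbracket_def tri_part_def ..

lemma ghalf_bilinear: "bilinear_on gs gs gs Gcarr Gcarr (ghalf K (para C))"
proof -
  have "ghalf K (para C) X (Y + Z) = ghalf K (para C) X Y + ghalf K (para C) X Z"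
    "ghalf K (para C) (Y + Z) X = ghalf K (para C) Y X + ghalf K (para C) Z X"
    "ghalf K (para C) X (gs c Y) = gs c (ghalf K (para C) X Y)"
    "ghalf K (para C) (gs c X) Y = gs c (ghalf K (para C) X Y)"
    if "X \<in> Gcarr" "Y \<in> Gcarr" "Z \<in> Gcarr" for X Y Z c
  proof -
    obtain d a where X: "X = gelem d a" "d \<in> TT" using \<open>X \<in> Gcarr\<close> by (rule GcarrE)
    obtain e b where Y: "Y = gelem e b" "e \<in> TT" using \<open>Y \<in> Gcarr\<close> by (rule GcarrE)
    obtain f c' where Z: "Z = gelem f c'" "f \<in> TT" using \<open>Z \<in> Gcarr\<close> by (rule GcarrE)
    note s = Tri.subspace_add[OF TG.gsum_subspace] Tri.subspace_scale[OF TG.gsum_subspace]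
    note o = P.OpsD[OF TT_Ops[OF X(2)], simplified] P.OpsD[OF TT_Ops[OF Y(2)], simplified]
    show "ghalf K (para C) X (Y + Z) = ghalf K (para C) X Y + ghalf K (para C) X Z"
      "ghalf K (para C) (Y + Z) X = ghalf K (para C) Y X + ghalf K (para C) Z X"
      "ghalf K (para C) X (gs c Y) = gs c (ghalf K (para C) X Y)"
      "ghalf K (para C) (gs c X) Y = gs c (ghalf K (para C) X Y)"
      unfolding X(1) Y(1) Z(1) gelem_add gelem_scale
      by (simp_all only: ghalf_gelem s X(2) Y(2) Z(2) gelem_add gelem_scale gelem_inject)
        (simp_all add: fun_eq_iff o fscl_def algebra_simps)
  qed
  then show ?thesis
    unfolding bilinear_on_def linear_on_def by blast
qed

lemma tri_part_bilinear: "bilinear_on gs gs gs Gcarr Gcarr tri_part"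
proof -
  have tw: "tw i (a + b) c = tw i a c + tw i b c" "tw i c (a + b) = tw i c a + tw i c b"
    "tw i (k \<cdot> a) b = Tscl k (tw i a b)" "tw i a (k \<cdot> b) = Tscl k (tw i a b)" for i a b c k
    using S.tt_linear(1) S.tt_linear(2)
    by (simp_all add: linear_on_def fscl_def theta_pow_def fun_eq_iff algebra_simps)
  have "tri_part X (Y + Z) = tri_part X Y + tri_part X Z"
    "tri_part (Y + Z) X = tri_part Y X + tri_part Z X"
    "tri_part X (gs c Y) = gs c (tri_part X Y)"
    "tri_part (gs c X) Y = gs c (tri_part X Y)"
    if "X \<in> Gcarr" "Y \<in> Gcarr" "Z \<in> Gcarr" for X Y Z c
  proof -
    obtain d a where X: "X = gelem d a" "d \<in> TT" using \<open>X \<in> Gcarr\<close> by (rule GcarrE)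
    obtain e b where Y: "Y = gelem e b" "e \<in> TT" using \<open>Y \<in> Gcarr\<close> by (rule GcarrE)
    obtain f c' where Z: "Z = gelem f c'" "f \<in> TT" using \<open>Z \<in> Gcarr\<close> by (rule GcarrE)
    have m: "mul (tri (para C)) d e j = scomm (para C) (d j) (e j)" for d e j
      by (simp add: tri_def)
    have mt: "mul (tri (para C)) d (e + f) = mul (tri (para C)) d e + mul (tri (para C)) d f"
      "mul (tri (para C)) (e + f) d = mul (tri (para C)) e d + mul (tri (para C)) f d"
      "mul (tri (para C)) d (Tscl c e) = Tscl c (mul (tri (para C)) d e)"
      "mul (tri (para C)) (Tscl c d) e = Tscl c (mul (tri (para C)) d e)"
      using P.scomm_add[OF TT_Ops[OF X(2)] TT_Ops[OF Y(2)] TT_Ops[OF Z(2)]]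
        P.scomm_add(2)[OF TT_Ops[OF Y(2)] TT_Ops[OF Z(2)] TT_Ops[OF X(2)]]
        P.scomm_scale[OF TT_Ops[OF X(2)] TT_Ops[OF Y(2)]]
      by (intro ext, simp only: m plus_fun_apply fscl_def[of "fscl (scl C)"])+
    have ap: "(fscl (scl C) c a) i = c \<cdot> a i" for c i and a :: "3 \<Rightarrow> 'v"
      by (simp add: fscl_def)
    have z: "fscl (scl C) c (0 :: 3 \<Rightarrow> 'v) = 0" for c
      by (simp add: fun_eq_iff fscl_def)
    have pl: "(a + b) i = a i + b i" for i and a b :: "3 \<Rightarrow> 'v"
      by simp
    have stw: "(\<Sum>i\<in>UNIV. tw i (a i) ((b + c') i)) = (\<Sum>i\<in>UNIV. tw i (a i) (b i)) + (\<Sum>i\<in>UNIV. tw i (a i) (c' i))"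
      "(\<Sum>i\<in>UNIV. tw i ((b + c') i) (a i)) = (\<Sum>i\<in>UNIV. tw i (b i) (a i)) + (\<Sum>i\<in>UNIV. tw i (c' i) (a i))"
      "(\<Sum>i\<in>UNIV. tw i (a i) (fscl (scl C) c b i)) = Tscl c (\<Sum>i\<in>UNIV. tw i (a i) (b i))"
      "(\<Sum>i\<in>UNIV. tw i (fscl (scl C) c a i) (b i)) = Tscl c (\<Sum>i\<in>UNIV. tw i (a i) (b i))"
      by (simp_all only: pl ap tw sum.distrib Tri.scale_sum_right)
    show "tri_part X (Y + Z) = tri_part X Y + tri_part X Z"
      "tri_part (Y + Z) X = tri_part Y X + tri_part Z X"
      "tri_part X (gs c Y) = gs c (tri_part X Y)"
      "tri_part (gs c X) Y = gs c (tri_part X Y)"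
      unfolding X(1) Y(1) Z(1) gelem_add gelem_scale tri_part_gelem stw mt
      by (simp_all only: gelem_inject Tri.scale_right_distrib z add_0_left simp_thms add_ac)
  qed
  then show ?thesis
    unfolding bilinear_on_def linear_on_def by blast
qed

lemma brk_bilinear: "bilinear_on gs gs gs Gcarr Gcarr brk"
proof -
  note h = ghalf_bilinear[unfolded bilinear_on_def linear_on_def]
    and e = tri_part_bilinear[unfolded bilinear_on_def linear_on_def]
  have h': "ghalf K (para C) X (Y + Z) = ghalf K (para C) X Y + ghalf K (para C) X Z"
    "ghalf K (para C) (Y + Z) X = ghalf K (para C) Y X + ghalf K (para C) Z X"
    "ghalf K (para C) X (gs c Y) = gs c (ghalf K (para C) X Y)"
    "ghalf K (para C) (gs c X) Y = gs c (ghalf K (para C) X Y)"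
    "tri_part X (Y + Z) = tri_part X Y + tri_part X Z"
    "tri_part (Y + Z) X = tri_part Y X + tri_part Z X"
    "tri_part X (gs c Y) = gs c (tri_part X Y)"
    "tri_part (gs c X) Y = gs c (tri_part X Y)"
    if "X \<in> Gcarr" "Y \<in> Gcarr" "Z \<in> Gcarr" for X Y Z c
    using h e that by blast+
  show ?thesis
    unfolding bilinear_on_def linear_on_def
  proof (intro conjI allI ballI)
    fix X Y Z c assume c: "X \<in> Gcarr" "Y \<in> Gcarr"
    show "brk X (gs c Y) = gs c (brk X Y)" "brk (gs c Y) X = gs c (brk Y X)"
      unfolding brk_eq using c
      by (simp_all add: h' gp_carr GG.hpart_scale GV.scale_right_distrib GV.scale_right_diff_distrib mult.commute)
    assume z: "Z \<in> Gcarr"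
    show "brk X (Y + Z) = brk X Y + brk X Z" "brk (Y + Z) X = brk Y X + brk Z X"
      unfolding brk_eq using c z
      by (simp_all add: h' gp_carr GG.hpart_add GV.scale_right_distrib algebra_simps)
  qed
qed

text \<open>
  The bracket of \<open>\<gg>(S\<^sub>1, S)\<close> in coordinates; the tensor factor \<open>1\<close> is even, so that all signs come from \<open>p\<close> and \<open>q\<close>.
\<close>

lemma brk_hom:
  assumes d: "d \<in> T p" and e: "e \<in> T q" and a: "\<And>j. a j \<in> V p" and b: "\<And>j. b j \<in> V q"
  shows "brk (gelem d a) (gelem e b) = gelem (mul (tri (para C)) d e + (\<Sum>i\<in>UNIV. tw i (a i) (b i)))
    (\<lambda>j. d j (b j) + a (j + 1) \<diamondop> b (j + 2) - sg (p * q) \<cdot> (e j (a j) + b (j + 1) \<diamondop> a (j + 2)))"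
proof -
  note g = gelem_ggr[OF d a] gelem_ggr[OF e b] and t = TG.hom_gsum[OF d] TG.hom_gsum[OF e]
  show ?thesis
    unfolding FP.gbracket_homogeneous[OF g] tri_part_def[symmetric] tri_part_gelem
      ghalf_gelem[OF t] ghalf_gelem[OF t(2,1)]
    by (simp add: gelem_add gelem_diff gelem_scale gelem_inject fun_eq_iff fscl_def)
qed

text \<open>
  Closure rests on \<open>tri S\<close> being closed under brackets and containing the \<open>t\<^sub>a\<^sub>,\<^sub>b\<close>, both of which were seen in \<open>der J\<close>.
\<close>

lemma brk_ggr:
  assumes "X \<in> ggr K (para C) p" "Y \<in> ggr K (para C) q"
  shows "brk X Y \<in> ggr K (para C) (p + q)"
proof -
  obtain d a where X: "X = gelem d a" "d \<in> T p" "\<And>j. a j \<in> V p"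
    using assms(1) unfolding ggr_gelem by blast
  obtain e b where Y: "Y = gelem e b" "e \<in> T q" "\<And>j. b j \<in> V q"
    using assms(2) unfolding ggr_gelem by blast
  show ?thesis
    unfolding X(1) Y(1) brk_hom[OF X(2) Y(2) X(3) Y(3)]
  proof (rule gelem_ggr)
    show "mul (tri (para C)) d e + (\<Sum>i\<in>UNIV. tw i (a i) (b i)) \<in> T (p + q)"
      by (intro Tri.subspace_add[OF tri_subspace] Tri.subspace_sum[OF tri_subspace] tri_bracket X(2) Y(2)
          bracket_D_same(2) X(3) Y(3))
    have "d j (b j) \<in> V (p + q)" "e j (a j) \<in> V (p + q)" "a (j + 1) \<diamondop> b (j + 2) \<in> V (p + q)"
      "b (j + 1) \<diamondop> a (j + 2) \<in> V (p + q)" for j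
      using PEndo_rules(6)[OF triD(1)[OF X(2)] Y(3)] PEndo_rules(6)[OF triD(1)[OF Y(2)] X(3)]
        pprod_V[OF X(3) Y(3)] pprod_V[OF Y(3) X(3)] by (simp_all add: add.commute)
    then show "d j (b j) + a (j + 1) \<diamondop> b (j + 2) - sg (p * q) \<cdot> (e j (a j) + b (j + 1) \<diamondop> a (j + 2)) \<in> V (p + q)" for j
      by (intro V_diff V_add V_scale)
  qed
qed

lemma superalgebra_L: "superalgebra L"
  unfolding superalgebra_def superspace_def L_simps
proof (intro conjI allI ballI)
  show "vector_space gs"
    by (rule GV.vector_space_axioms)
  show "GV.subspace (ggr K (para C) p)" for p
    by (rule GG.sub)
  show "ggr K (para C) 0 \<inter> ggr K (para C) 1 = {0}"
    using GG.disj GV.subspace_0[OF GG.sub] by blast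
  show "bilinear_on gs gs gs (scarrier L) (scarrier L) brk"
    using brk_bilinear by (simp add: scarrier_def)
  show "brk X Y \<in> ggr K (para C) (p + q)" if "X \<in> ggr K (para C) p" "Y \<in> ggr K (para C) q" for X Y p q
    using brk_ggr that .
qed

section \<open>The isomorphism\<close>

text \<open>
  The map \<open>\<Phi>\<close> in the coordinates \<open>gelem d a\<close>.
\<close>

definition phi :: "(3 \<Rightarrow> 'v \<Rightarrow> 'v) \<Rightarrow> (3 \<Rightarrow> 'v) \<Rightarrow> 'v mat3 \<Rightarrow> 'v mat3" where
  "phi d a = Dtri C d + (\<Sum>i\<in>UNIV. D i (a i))"

abbreviation "Fscl \<equiv> fscl (scl J)"

lemma Dtri_linear: "Dtri C (d + e) = Dtri C d + Dtri C e" "Dtri C (Tscl c d) = Fscl c (Dtri C d)"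
proof -
  show "Dtri C (d + e) = Dtri C d + Dtri C e"
    by (rule ext) (simp add: Dtri_def sum.distrib)
  show "Dtri C (Tscl c d) = Fscl c (Dtri C d)"
    by (rule ext) (simp add: Dtri_def fscl_def[of "scl J"] fscl_def[of "fscl (scl C)"] fscl_def[of "scl C"] J.scale_sum_right)
qed

lemma phi_add: "phi (d + e) (a + b) = phi d a + phi e b"
proof -
  have "(\<Sum>i\<in>UNIV. D i ((a + b) i)) = (\<Sum>i\<in>UNIV. D i (a i)) + (\<Sum>i\<in>UNIV. D i (b i))"
    by (simp add: D_add sum.distrib)
  then show ?thesis
    by (simp only: phi_def Dtri_linear add_ac)
qed

lemma phi_scale: "phi (Tscl c d) (fscl (scl C) c a) = Fscl c (phi d a)"
proof -
  have "(\<Sum>i\<in>UNIV. D i (fscl (scl C) c a i)) = Fscl c (\<Sum>i\<in>UNIV. D i (a i))"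
    by (simp only: fscl_def[of "scl C"] D_scale J.Op.scale_sum_right)
  then show ?thesis
    by (simp only: phi_def Dtri_linear J.Op.scale_right_distrib)
qed

lemma phi_diff: "phi (d - e) (a - b) = phi d a - phi e b"
proof -
  have "phi (d - e) (a - b) + phi e b = phi d a"
    unfolding phi_add[symmetric] by simp
  then show ?thesis
    by (simp only: eq_diff_eq)
qed

lemma phi_der: "d \<in> T p \<Longrightarrow> (\<And>j. a j \<in> V p) \<Longrightarrow> phi d a \<in> gr (der J) p"
  unfolding phi_def
  by (intro J.Op.subspace_add[OF J.der_subspace] J.Op.subspace_sum[OF J.der_subspace] Dtri_der D_der)

lemma
  assumes "d \<in> TT"
  shows Dtri_E_TT: "Dtri C d (E i) = 0" and Dtri_I_TT: "Dtri C d (I i a) = I i (d i a)"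
proof -
  obtain e f where d: "e \<in> T 0" "f \<in> T 1" "d = e + f"
    using assms by (rule TG.gsumE)
  show "Dtri C d (E i) = 0" "Dtri C d (I i a) = I i (d i a)"
    unfolding d(3) Dtri_linear
    by (simp_all add: Dtri_E[of e, OF triD(1)[OF d(1)]] Dtri_E[of f, OF triD(1)[OF d(2)]]
        Dtri_I[of e, OF triD(1)[OF d(1)]] Dtri_I[of f, OF triD(1)[OF d(2)]])
qed

text \<open>The values on the idempotents determine the \<open>a\<^sub>i\<close>, and the values on the \<open>\<iota>\<^sub>i(S)\<close> then the triple.\<close>

lemma phi_kernel:
  assumes d: "d \<in> TT" and 0: "phi d a = 0"
  shows "d = 0" "a = 0"
proof -
  have "a (i + 2) = 0" for i
  proof -
    have "(\<Sum>j\<in>UNIV. D j (a j)) (E i) = (1 / 2) \<star> I (i + 2) (a (i + 2)) - (1 / 2) \<star> I (i + 1) (a (i + 1))"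
      unfolding sum_3[of _ i] by (simp add: D_table)
    then have "(1 / 2) \<star> I (i + 2) (a (i + 2)) - (1 / 2) \<star> I (i + 1) (a (i + 1)) = 0"
      using fun_cong[OF 0, of "E i"] Dtri_E_TT[OF d] by (simp only: phi_def plus_fun_apply zero_fun_apply add_0_left)
    then have "I (i + 2) ((1 / 2) \<cdot> a (i + 2)) = I (i + 1) ((1 / 2) \<cdot> a (i + 1))"
      by simp
    then have "coord (i + 2) (I (i + 2) ((1 / 2) \<cdot> a (i + 2))) = coord (i + 2) (I (i + 1) ((1 / 2) \<cdot> a (i + 1)))"
      by (simp only:)
    then have "(1 / 2) \<cdot> a (i + 2) = 0"
      unfolding coord_I by (simp add: I_def munit_def)
    then show ?thesis
      using two by simp
  qed
  from this[of "j + 1" for j] have a: "a j = 0" for j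
    by simp
  then show "a = 0"
    by (intro ext) simp
  have D0: "D i 0 = 0" for i
    using D_scale[of i 0 0] by simp
  have "Dtri C d = 0"
    using 0 by (simp add: phi_def a D0)
  then have "I j (d j x) = I j 0" for j x
    using Dtri_I_TT[OF d, of j x] by simp
  then show "d = 0"
    unfolding I_inject by (intro ext) simp
qed

text \<open>
  The double sum of the brackets \<open>[D\<^sub>i(a\<^sub>i), D\<^sub>j(b\<^sub>j)]\<close> splits according to \<open>j = i\<close>, \<open>i + 1\<close>, \<open>i + 2\<close>, where the last case
  is the second one with the roles exchanged. Shifting the summation index then gives the coordinates of the bracket of \<open>\<gg>(S\<^sub>1, S)\<close>.
\<close>

lemma scomm_phi:
  assumes d: "d \<in> T p" and e: "e \<in> T q" and a: "\<And>j. a j \<in> V p" and b: "\<And>j. b j \<in> V q"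
  shows "scomm J (phi d a) (phi e b)
    = phi (mul (tri (para C)) d e + (\<Sum>i\<in>UNIV. tw i (a i) (b i)))
      (\<lambda>j. d j (b j) + a (j + 1) \<diamondop> b (j + 2) - sg (p * q) \<cdot> (e j (a j) + b (j + 1) \<diamondop> a (j + 2)))"
proof -
  note Dd = Dtri_Endo[of d, OF triD(1)[OF d]] and De = Dtri_Endo[of e, OF triD(1)[OF e]]
  note o = J.E.hom_gsum[OF Dd] J.E.hom_gsum[OF De] J.E.hom_gsum[OF D_Endo[OF a]] J.E.hom_gsum[OF D_Endo[OF b]]
  have so: "(\<Sum>i\<in>UNIV. D i (a i)) \<in> J.Ops" "(\<Sum>i\<in>UNIV. D i (b i)) \<in> J.Ops"
    by (intro J.Op.subspace_sum[OF J.E.gsum_subspace] o)+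
  have 1: "scomm J (phi d a) (phi e b) = scomm J (Dtri C d) (Dtri C e)
    + (\<Sum>j\<in>UNIV. scomm J (Dtri C d) (D j (b j))) + (\<Sum>i\<in>UNIV. scomm J (D i (a i)) (Dtri C e))
    + (\<Sum>j\<in>UNIV. \<Sum>i\<in>UNIV. scomm J (D i (a i)) (D j (b j)))"
    unfolding phi_def using so J.Op.subspace_add[OF J.E.gsum_subspace o(2) so(2)]
    by (simp only: J.scomm_add J.scomm_sums o add_ac)
  have sw: "(\<Sum>j\<in>UNIV. \<Sum>i\<in>UNIV. scomm J (D i (a i)) (D j (b j)))
      = (\<Sum>i\<in>UNIV. \<Sum>j\<in>UNIV. scomm J (D i (a i)) (D j (b j)))"
    by (rule sum.swap)
  have 2: "scomm J (D i (a i)) (Dtri C e) = - Fscl (sg (p * q)) (D i (e i (a i)))" for i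
    unfolding J.scomm_anticomm[OF D_Endo[OF a] De] bracket_Dtri_D[OF e a] ..
  have 3: "scomm J (D i (a i)) (D (i + 2) (b (i + 2))) = - Fscl (sg (p * q)) (D (i + 1) (b (i + 2) \<diamondop> a i))" for i
    using bracket_D_next[OF b a, of "i + 2" "i + 2" i]
    unfolding J.scomm_anticomm[OF D_Endo[OF a] D_Endo[OF b]] by simp
  have "(\<Sum>i\<in>UNIV. \<Sum>j\<in>UNIV. scomm J (D i (a i)) (D j (b j)))
      = (\<Sum>i\<in>UNIV. Dtri C (tw i (a i) (b i)) + D (i + 2) (a i \<diamondop> b (i + 1))
          + - Fscl (sg (p * q)) (D (i + 1) (b (i + 2) \<diamondop> a i)))"
    by (rule sum.cong[OF refl])
      (simp only: sum_3[of "\<lambda>j. scomm J (D i (a i)) (D j (b j))" i for i] bracket_D_same(1)[OF a b]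
        bracket_D_next[OF a b] 3)
  also have "\<dots> = (\<Sum>i\<in>UNIV. Dtri C (tw i (a i) (b i))) + (\<Sum>i\<in>UNIV. D (i + 2) (a i \<diamondop> b (i + 1)))
      + (\<Sum>i\<in>UNIV. - Fscl (sg (p * q)) (D (i + 1) (b (i + 2) \<diamondop> a i)))"
    by (simp only: sum.distrib)
  also have "(\<Sum>i\<in>UNIV. D (i + 2) (a i \<diamondop> b (i + 1))) = (\<Sum>j\<in>UNIV. D j (a (j + 1) \<diamondop> b (j + 2)))"
    using sum_shift_3[of "\<lambda>j. D j (a (j + 1) \<diamondop> b (j + 2))" 2] by simp
  also have "(\<Sum>i\<in>UNIV. - Fscl (sg (p * q)) (D (i + 1) (b (i + 2) \<diamondop> a i)))
      = (\<Sum>j\<in>UNIV. - Fscl (sg (p * q)) (D j (b (j + 1) \<diamondop> a (j + 2))))"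
    using sum_shift_3[of "\<lambda>j. - Fscl (sg (p * q)) (D j (b (j + 1) \<diamondop> a (j + 2)))" 1] by simp
  finally have 4: "(\<Sum>i\<in>UNIV. \<Sum>j\<in>UNIV. scomm J (D i (a i)) (D j (b j)))
    = (\<Sum>i\<in>UNIV. Dtri C (tw i (a i) (b i))) + (\<Sum>j\<in>UNIV. D j (a (j + 1) \<diamondop> b (j + 2)))
      + (\<Sum>j\<in>UNIV. - Fscl (sg (p * q)) (D j (b (j + 1) \<diamondop> a (j + 2))))" .
  have D0: "Dtri C 0 = 0"
    using Dtri_linear(1)[of 0 0] by simp
  have Ds: "Dtri C (\<Sum>i\<in>I. f i) = (\<Sum>i\<in>I. Dtri C (f i))" for f :: "3 \<Rightarrow> 3 \<Rightarrow> 'v \<Rightarrow> 'v" and I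
    by (induction I rule: infinite_finite_induct)
      (simp_all only: sum.infinite sum.empty sum.insert not_False_eq_True D0 Dtri_linear)
  have Dm: "D j (x - sg (p * q) \<cdot> y) = D j x + - Fscl (sg (p * q)) (D j y)" for j x y
  proof -
    have "D j (x - sg (p * q) \<cdot> y) + D j (sg (p * q) \<cdot> y) = D j x"
      unfolding D_add[symmetric] by simp
    then show ?thesis
      unfolding D_scale by (simp only: eq_diff_eq diff_conv_add_uminus[symmetric])
  qed
  show ?thesis
    unfolding 1 sw 4 2 bracket_Dtri_Dtri[OF d e] bracket_Dtri_D[OF d b]
    unfolding phi_def Dtri_linear Ds Dm D_add J.Op.scale_right_distrib
    by (simp only: sum.distrib minus_add_distrib add_ac)
qed

text \<open>
  The defining property of \<open>\<Phi>\<close> fixes it on elements which span \<open>\<gg>(S\<^sub>1, S)\<close>, hence everywhere there.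
\<close>

lemma is_Phi_gelem:
  assumes Phi: "is_Phi C \<Phi>" and d: "d \<in> TT"
  shows "\<Phi> (gelem d a) = phi d a"
proof -
  note P = Phi[unfolded is_Phi_def TT_eq L_simps]
  have add: "\<Phi> (X + Y) = \<Phi> X + \<Phi> Y" if "X \<in> scarrier L" "Y \<in> scarrier L" for X Y
    using P that unfolding linear_on_def by blast
  have 0: "0 \<in> TT"
    by (rule TG.hom_gsum[OF Tri.subspace_0[OF tri_subspace]])
  have c: "gelem e b \<in> scarrier L" if "e \<in> TT" for e b
    using that by (auto simp: L_carrier)
  have sa: "X + Y \<in> scarrier L" if "X \<in> scarrier L" "Y \<in> scarrier L" for X Y
    using GV.subspace_add[OF GG.gsum_subspace] that by (simp add: scarrier_def)
  define x where "x i j = (if j = i then a i else 0)" for i j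
  have io: "gelem 0 (x i) = giota i (tens K (para C) 1 (a i))" for i
    by (auto simp: gelem_def giota_def x_def fun_eq_iff)
  have tr: "gelem e 0 = gtri' e" for e
    by (simp add: gelem_def gtri'_def fun_eq_iff)
  have "a = x 0 + x 1 + x 2"
  proof
    fix j
    show "a j = (x 0 + x 1 + x 2) j"
      using index3_cases[of j 0] by (auto simp: x_def)
  qed
  then have "gelem d a = gelem d 0 + gelem 0 (x 0) + gelem 0 (x 1) + gelem 0 (x 2)"
    unfolding gelem_add by (simp add: add_ac)
  then have "\<Phi> (gelem d a) = \<Phi> (gelem d 0) + \<Phi> (gelem 0 (x 0)) + \<Phi> (gelem 0 (x 1)) + \<Phi> (gelem 0 (x 2))"
    by (simp only: add sa c[OF d] c[OF 0])
  also have "\<dots> = Dtri C d + D 0 (a 0) + D 1 (a 1) + D 2 (a 2)"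
  proof -
    have "\<Phi> (gtri' d) = Dtri C d"
      using P d by blast
    moreover have "\<Phi> (giota i (tens K (para C) 1 (a i))) = D i (a i)" for i
      using P S.full by blast
    ultimately show ?thesis
      unfolding io tr by simp
  qed
  also have "\<dots> = phi d a"
    unfolding phi_def sum_3[of _ 0] by (simp add: add_ac)
  finally show ?thesis .
qed

lemma phi_in_der: "d \<in> TT \<Longrightarrow> phi d a \<in> scarrier (der J)"
proof -
  assume "d \<in> TT"
  then obtain e f where d: "e \<in> T 0" "f \<in> T 1" "d = e + f"
    by (rule TG.gsumE)
  have "a = (\<lambda>j. hp 0 (a j)) + (\<lambda>j. hp 1 (a j))"
    by (simp add: fun_eq_iff hp_decomp)
  then have "phi d a = phi e (\<lambda>j. hp 0 (a j)) + phi f (\<lambda>j. hp 1 (a j))"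
    unfolding d(3) phi_add[symmetric] by simp
  then show ?thesis
    unfolding J.scarrier_der
    using J.D.gsumI[OF phi_der[OF d(1) hp_V] phi_der[OF d(2) hp_V]] by simp
qed

lemma is_Phi_exists: "\<exists>\<Phi>. is_Phi C \<Phi>"
proof
  define \<Phi> :: "('k, 'k, 'v) gelem \<Rightarrow> 'v mat3 \<Rightarrow> 'v mat3"
    where "\<Phi> = (\<lambda>(d0, d, u). phi d (\<lambda>i. inv (tens K (para C) 1) (u i)))"
  have "inj (tens K (para C) 1)"
    by (rule injI) (simp add: tn_inject)
  then have \<Phi>: "\<Phi> (gelem d a) = phi d a" for d a
    by (simp add: \<Phi>_def gelem_def)
  have D0: "D i 0 = 0" for i
    using D_scale[of i 0 0] by simp
  have Dt0: "Dtri C 0 = 0"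
    using Dtri_linear(1)[of 0 0] by simp
  show "is_Phi C \<Phi>"
    unfolding is_Phi_def TT_eq L_simps J.der_simps
  proof (intro conjI ballI allI)
    show "linear_on gs Fscl (scarrier L) \<Phi>"
      unfolding linear_on_def L_carrier by (auto simp only: mem_Collect_eq gelem_add gelem_scale \<Phi> phi_add phi_scale)
    show "\<Phi> ` scarrier L \<subseteq> scarrier (der J)"
      using phi_in_der by (auto simp: L_carrier \<Phi>)
    show "\<Phi> (gtri' d) = Dtri C d" for d
    proof -
      have "gtri' d = gelem d 0"
        by (simp add: gelem_def gtri'_def fun_eq_iff)
      then show ?thesis
        by (simp add: \<Phi> phi_def D0)
    qed
    show "\<Phi> (giota i (tens K (para C) 1 a)) = Diota C i a" for i a
    proof -
      have "giota i (tens K (para C) 1 a) = gelem 0 (\<lambda>j. if j = i then a else 0)"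
        by (auto simp: gelem_def giota_def fun_eq_iff)
      then show ?thesis
        by (simp add: \<Phi> phi_def Dt0 sum_3[of _ i] D0)
    qed
  qed
qed

text \<open>
  The homomorphism property is checked on homogeneous elements in coordinates and extends by
  bilinearity of both brackets; surjectivity is the decomposition of derivations, for each parity.
\<close>

lemma is_Phi_iso:
  assumes Phi: "is_Phi C \<Phi>"
  shows "lie_superalgebra_iso L (der J) \<Phi>"
proof -
  note P = Phi[unfolded is_Phi_def]
  interpret L: super_algebra L
    by (rule super_algebra.intro[OF superalgebra_L])
  have lin: "linear_on (scl L) (scl (der J)) (scarrier L) \<Phi>"
    using P by blast
  have inj: "inj_on \<Phi> (scarrier L)"
  proof (rule inj_onI)
    fix X Y assume "X \<in> scarrier L" "Y \<in> scarrier L" and eq: "\<Phi> X = \<Phi> Y"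
    then obtain d a e b where X: "X = gelem d a" "d \<in> TT" and Y: "Y = gelem e b" "e \<in> TT"
      by (auto simp: L_carrier)
    have "phi (d - e) (a - b) = 0"
      using eq unfolding phi_diff X(1) Y(1) is_Phi_gelem[OF Phi X(2)] is_Phi_gelem[OF Phi Y(2)] by simp
    then have "d - e = 0" "a - b = 0"
      using phi_kernel[OF Tri.subspace_diff[OF TG.gsum_subspace X(2) Y(2)]] by blast+
    then show "X = Y"
      by (simp add: X(1) Y(1))
  qed
  have gr: "\<Phi> X \<in> gr (der J) p" if XL: "X \<in> gr L p" for X p
  proof -
    obtain d a where X: "X = gelem d a" "d \<in> T p" "\<And>j. a j \<in> V p"
      using XL unfolding L_simps ggr_gelem by blast
    show ?thesis
      unfolding X(1) is_Phi_gelem[OF Phi TG.hom_gsum[OF X(2)]] by (rule phi_der[OF X(2,3)])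
  qed
  have "scarrier (der J) \<subseteq> \<Phi> ` scarrier L"
  proof
    fix f assume "f \<in> scarrier (der J)"
    then obtain g h where f: "g \<in> gr (der J) 0" "h \<in> gr (der J) 1" "f = g + h"
      unfolding J.scarrier_der by (rule J.D.gsumE)
    obtain d a where g: "d \<in> T 0" "g = phi d a"
      using derivation_decomposition[OF f(1)] unfolding phi_def by metis
    obtain e b where h: "e \<in> T 1" "h = phi e b"
      using derivation_decomposition[OF f(2)] unfolding phi_def by metis
    have de: "d + e \<in> TT"
      by (rule TG.gsumI[OF g(1) h(1)])
    have "f = \<Phi> (gelem (d + e) (a + b))"
      unfolding is_Phi_gelem[OF Phi de] phi_add f(3) g(2) h(2) ..
    moreover have "gelem (d + e) (a + b) \<in> scarrier L"
      using de by (auto simp: L_carrier)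
    ultimately show "f \<in> \<Phi> ` scarrier L"
      by blast
  qed
  then have bij: "bij_betw \<Phi> (scarrier L) (scarrier (der J))"
    using inj P by (auto simp: bij_betw_def)
  have hom_gr: "\<Phi> (mul L X Y) = mul (der J) (\<Phi> X) (\<Phi> Y)" if XL: "X \<in> gr L p" and YL: "Y \<in> gr L q" for X Y p q
  proof -
    obtain d a where X: "X = gelem d a" "d \<in> T p" "\<And>j. a j \<in> V p"
      using XL unfolding L_simps ggr_gelem by blast
    obtain e b where Y: "Y = gelem e b" "e \<in> T q" "\<And>j. b j \<in> V q"
      using YL unfolding L_simps ggr_gelem by blast
    have t: "mul (tri (para C)) d e + (\<Sum>i\<in>UNIV. tw i (a i) (b i)) \<in> TT"
      by (intro TG.hom_gsum[of _ "p + q"] Tri.subspace_add[OF tri_subspace] Tri.subspace_sum[OF tri_subspace]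
          tri_bracket X(2) Y(2) bracket_D_same(2) X(3) Y(3))
    show ?thesis
      unfolding X(1) Y(1) L_simps J.der_simps brk_hom[OF X(2) Y(2) X(3) Y(3)] is_Phi_gelem[OF Phi t]
        is_Phi_gelem[OF Phi TG.hom_gsum[OF X(2)]] is_Phi_gelem[OF Phi TG.hom_gsum[OF Y(2)]]
        scomm_phi[OF X(2) Y(2) X(3) Y(3)] ..
  qed
  have hom: "\<Phi> (mul L X Y) = mul (der J) (\<Phi> X) (\<Phi> Y)" if XL: "X \<in> scarrier L" and YL: "Y \<in> scarrier L" for X Y
  proof -
    obtain X0 X1 where X: "X0 \<in> gr L 0" "X1 \<in> gr L 1" "X = X0 + X1"
      using XL unfolding L.carr_gsum by (rule L.gsumE)
    obtain Y0 Y1 where Y: "Y0 \<in> gr L 0" "Y1 \<in> gr L 1" "Y = Y0 + Y1"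
      using YL unfolding L.carr_gsum by (rule L.gsumE)
    have add: "\<Phi> (Z + W) = \<Phi> Z + \<Phi> W" if "Z \<in> scarrier L" "W \<in> scarrier L" for Z W
      using lin that unfolding linear_on_def by blast
    note c = L.hom_carr[OF X(1)] L.hom_carr[OF X(2)] L.hom_carr[OF Y(1)] L.hom_carr[OF Y(2)]
    note o = J.E.hom_gsum[OF J.der_Endo[OF gr[OF X(1)]]] J.E.hom_gsum[OF J.der_Endo[OF gr[OF X(2)]]]
      J.E.hom_gsum[OF J.der_Endo[OF gr[OF Y(1)]]] J.E.hom_gsum[OF J.der_Endo[OF gr[OF Y(2)]]]
    note oo = J.Op.subspace_add[OF J.E.gsum_subspace]
    have "\<Phi> (mul L X Y) = \<Phi> (mul L X0 Y0) + \<Phi> (mul L X1 Y0) + (\<Phi> (mul L X0 Y1) + \<Phi> (mul L X1 Y1))"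
      unfolding X(3) Y(3) using c by (simp only: L.mul_add L.carr_add L.mul_carr add)
    also have "\<dots> = mul (der J) (\<Phi> X) (\<Phi> Y)"
      unfolding hom_gr[OF X(1) Y(1)] hom_gr[OF X(1) Y(2)] hom_gr[OF X(2) Y(1)] hom_gr[OF X(2) Y(2)]
      unfolding X(3) Y(3) add[OF c(1,2)] add[OF c(3,4)] J.der_simps
      by (simp only: J.scomm_add o oo add_ac)
    finally show ?thesis .
  qed
  show ?thesis
    unfolding lie_superalgebra_iso_def
    using lie_superalgebra_pullback[OF superalgebra_L J.lie_superalgebra_der lin inj gr hom]
      J.lie_superalgebra_der lin bij gr hom by blast
qed

end

theorem theorem3p13:
  fixes C :: "('k::field, 'v::ab_group_add) unital_qsalg"
  assumes "CHAR('k) \<noteq> 2"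
    and "hurwitz_superalgebra C"
    and "scarrier C = UNIV"
  shows "(\<exists>\<Phi>. is_Phi C \<Phi>) \<and>
         (\<forall>\<Phi>. is_Phi C \<Phi> \<longrightarrow> lie_superalgebra_iso (galg S1 (para C)) (der (H3 C)) \<Phi>)"
proof -
  have "(2::'k) \<noteq> 0"
  proof
    assume "(2::'k) = 0"
    then have "CHAR('k) dvd 2"
      using of_nat_eq_0_iff_char_dvd[of 2, where 'a = 'k] by simp
    moreover from this have "CHAR('k) \<noteq> 0" "CHAR('k) \<le> 2"
      using dvd_imp_le by (metis dvd_0_left_iff zero_neq_numeral, fastforce)
    ultimately have "CHAR('k) = 1"
      using assms(1) by linarith
    then show False
      by simp
  qed
  then interpret hurwitz C
    using assms by unfold_locales
  show ?thesis
    using is_Phi_exists is_Phi_iso by blast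
qed

end
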